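(* Let $\mathbf{A}=\{A_1,\dots,A_N\}$ be a collection of $N\ge 2$ non-singular $d\times d$ real matrices with $\|A_i\|<1/2$ for all $i=1,\dots,N$. Suppose that for every $s>0$ there exist $C>0$ and $K\in\mathbb{N}$ such that for all finite words $\mathtt{i},\mathtt{j}\in\Sigma_*$ there exists a word $\mathtt{k}\in\Sigma_K$ with $$\varphi^s(A_{\mathtt{i}\mathtt{k}\mathtt{j}})\ge C\,\varphi^s(A_{\mathtt{i}})\,\varphi^s(A_{\mathtt{j}}).$$ Let $(\lambda_k)_{k\in\mathbb{N}}\in(\Sigma_* )^{\mathbb{N}}$ be any sequence of finite words, and let $s_0:=\inf\{t>0: P(t)\le\alpha(t)\}$. Then $$\dim_H R_{\mathbf{t}}((\lambda_k)_k)=\min\{d,s_0\}\quad\text{for Lebesgue-almost every }\mathbf{t}\in(\mathbb{R}^d)^N.$$ Moreover, if $s_0>d$ then $\mathcal{L}_d(R_{\mathbf{t}}((\lambda_k)_k))>0$ for Lebesgue-almost every $\mathbf{t}\in(\mathbb{R}^d)^N$.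
   Context: Words: $\Sigma_n=\{1,\dots,N\}^n$ is the set of words of length $n$, $\Sigma_*$ the set of all finite words (the length of $\mathtt{i}\in\Sigma_*$ is $|\mathtt{i}|$), $\Sigma=\{1,\dots,N\}^{\mathbb{N}}$ the set of infinite words, $\sigma:\Sigma\to\Sigma$ the left shift. For $\lambda\in\Sigma_*$, $[\lambda]\subseteq\Sigma$ is the cylinder of infinite words having $\lambda$ as prefix. For $\mathtt{i}=i_1\cdots i_n\in\Sigma_*$, $A_{\mathtt{i}}=A_{i_1}\cdots A_{i_n}$ (the identity for the empty word); juxtaposition of words denotes concatenation. $\|\cdot\|$ is the Euclidean operator norm. Natural projection: for $\mathbf{t}=(t_1,\dots,t_N)\in(\mathbb{R}^d)^N$ let $f_i(x)=A_ix+t_i$ and $\pi_{\mathbf{t}}(\mathtt{i})=\lim_{n\to\infty}f_{i_1}\circ\cdots\circ f_{i_n}(0)=\sum_{k=1}^\infty A_{i_1}\cdots A_{i_{k-1}}t_{i_k}$ for $\mathtt{i}=i_1i_2\cdots\in\Sigma$. Singular value function: with $\alpha_1(A)\ge\dots\ge\alpha_d(A)>0$ the singular values of $A\in GL_d(\mathbb{R})$, $\varphi^t(A)=\alpha_1(A)\cdots\alpha_{\lfloor t\rfloor}(A)\,\alpha_{\lfloor t\rfloor+1}(A)^{t-\lfloor t\rfloor}$ for $0\le t<d$ and $\varphi^t(A)=(\alpha_1(A)\cdots\alpha_d(A))^{t/d}$ for $t\ge d$. Pressure: $P(t)=\lim_{n\to\infty}\frac1n\log\sum_{\mathtt{i}\in\Sigma_n}\varphi^t(A_{\mathtt{i}})$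 (the limit exists). Inverse lower pressure of the sequence $(\lambda_k)$: $\alpha(t)=\liminf_{k\to\infty}\frac{-1}{k}\log\varphi^t(A_{\lambda_k})\in[0,\infty]$. Shrinking target set: $R_{\mathbf{t}}((\lambda_k)_k)=\pi_{\mathbf{t}}\{\mathtt{i}\in\Sigma:\sigma^k\mathtt{i}\in[\lambda_k]\text{ for infinitely many }k\in\mathbb{N}\}$. $\dim_H$ is Hausdorff dimension and $\mathcal{L}_d$ is $d$-dimensional Lebesgue measure. *)

theory Defs
  imports "HOL-Analysis.Analysis" "HOL-Library.Stream"
begin

section \<open>Hausdorff dimension\<close>

text \<open>The \<open>s\<close>-th power of the diameter, with the convention that a nonempty set counts
  as \<open>1\<close> when \<open>s = 0\<close> (note that \<open>0 powr 0 = 0\<close>).\<close>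

definition diam_pow :: "real \<Rightarrow> 'a::metric_space set \<Rightarrow> ennreal" where
  "diam_pow s U = (if U = {} then 0 else if s = 0 then 1 else ennreal (diameter U powr s))"

text \<open>Boundedness of the covering sets is required explicitly, because \<open>diameter\<close> is
  unspecified on unbounded sets.\<close>

definition hausdorff_premeasure :: "real \<Rightarrow> real \<Rightarrow> 'a::metric_space set \<Rightarrow> ennreal" where
  "hausdorff_premeasure s \<delta> E =
     (INF U \<in> {U :: nat \<Rightarrow> 'a set. E \<subseteq> (\<Union>n. U n) \<and> (\<forall>n. bounded (U n) \<and> diameter (U n) \<le> \<delta>)}.
        \<Sum>n. diam_pow s (U n))"

definition hausdorff_measure :: "real \<Rightarrow> 'a::metric_space set \<Rightarrow> ennreal" where
  "hausdorff_measure s E = (SUP \<delta> \<in> {0<..}. hausdorff_premeasure s \<delta> E)"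

definition hausdorff_dim :: "'a::metric_space set \<Rightarrow> ereal" where
  "hausdorff_dim E = Inf {ereal s | s. 0 \<le> s \<and> hausdorff_measure s E = 0}"


section \<open>Singular values and the singular value function\<close>

definition singular_value_space :: "real ^ 'd ^ 'd \<Rightarrow> real \<Rightarrow> (real ^ 'd) set" where
  "singular_value_space A a = {v. (transpose A ** A) *v v = a\<^sup>2 *\<^sub>R v}"

text \<open>The singular values in decreasing order, each repeated according to its multiplicity, i.e.
  the dimension of the corresponding eigenspace of the symmetric matrix \<open>transpose A ** A\<close>.
  The list is indexed from \<open>0\<close>: the \<open>i\<close>-th singular value \<open>\<alpha>\<^sub>i\<close> is
  \<open>singular_values A ! (i - 1)\<close>.\<close>

definition singular_values :: "real ^ 'd ^ 'd \<Rightarrow> real list" where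
  "singular_values A =
     concat (map (\<lambda>a. replicate (dim (singular_value_space A a)) a)
       (rev (sorted_list_of_set {a. 0 \<le> a \<and> (\<exists>v\<in>singular_value_space A a. v \<noteq> 0)})))"

text \<open>Meant for \<open>t \<ge> 0\<close> and invertible \<open>A\<close>.\<close>

definition svf :: "real \<Rightarrow> real ^ 'd ^ 'd \<Rightarrow> real" where
  "svf t A =
     (if t < real CARD('d)
      then (\<Prod>i<nat \<lfloor>t\<rfloor>. singular_values A ! i) *
             (singular_values A ! nat \<lfloor>t\<rfloor>) powr (t - of_int \<lfloor>t\<rfloor>)
      else (\<Prod>i<CARD('d). singular_values A ! i) powr (t / real CARD('d)))"


section \<open>Words, pressure and the shrinking target set\<close>

text \<open>The alphabet is a finite type \<open>'n\<close>; finite words are lists and infinite words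
  are streams over it. The left shift is \<open>stl\<close>, with iterates \<open>sdrop k\<close>.\<close>

definition cylinder :: "'n list \<Rightarrow> 'n stream set" where
  "cylinder w = {\<omega>. stake (length w) \<omega> = w}"

definition word_matrix :: "('n \<Rightarrow> real ^ 'd ^ 'd) \<Rightarrow> 'n list \<Rightarrow> real ^ 'd ^ 'd" where
  "word_matrix A w = foldr (\<lambda>i B. A i ** B) w (mat 1)"

definition affine_map ::
    "('n::finite \<Rightarrow> real ^ 'd ^ 'd) \<Rightarrow> (real ^ 'd) ^ 'n \<Rightarrow> 'n \<Rightarrow> real ^ 'd \<Rightarrow> real ^ 'd" where
  "affine_map A t i x = A i *v x + t $ i"

definition natural_proj ::
    "('n::finite \<Rightarrow> real ^ 'd ^ 'd) \<Rightarrow> (real ^ 'd) ^ 'n \<Rightarrow> 'n stream \<Rightarrow> real ^ 'd" where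
  "natural_proj A t \<omega> = lim (\<lambda>n. foldr (affine_map A t) (stake n \<omega>) 0)"

definition pressure :: "('n::finite \<Rightarrow> real ^ 'd ^ 'd) \<Rightarrow> real \<Rightarrow> real" where
  "pressure A t =
     lim (\<lambda>n. 1 / real n * ln (\<Sum>w\<in>{w :: 'n list. length w = n}. svf t (word_matrix A w)))"

text \<open>For a sequence of words \<open>lam\<close>, the index \<open>0\<close> affects neither the lower limit
  below nor the shrinking target set.\<close>

definition inverse_lower_pressure ::
    "('n \<Rightarrow> real ^ 'd ^ 'd) \<Rightarrow> (nat \<Rightarrow> 'n list) \<Rightarrow> real \<Rightarrow> ereal" where
  "inverse_lower_pressure A lam t =
     liminf (\<lambda>k. ereal (- 1 / real k * ln (svf t (word_matrix A (lam k)))))"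

definition critical_exponent ::
    "('n::finite \<Rightarrow> real ^ 'd ^ 'd) \<Rightarrow> (nat \<Rightarrow> 'n list) \<Rightarrow> ereal" where
  "critical_exponent A lam =
     Inf {ereal t | t. 0 < t \<and> ereal (pressure A t) \<le> inverse_lower_pressure A lam t}"

definition shrinking_target ::
    "('n::finite \<Rightarrow> real ^ 'd ^ 'd) \<Rightarrow> (real ^ 'd) ^ 'n \<Rightarrow> (nat \<Rightarrow> 'n list) \<Rightarrow> (real ^ 'd) set" where
  "shrinking_target A t lam =
     natural_proj A t ` {\<omega>. \<exists>\<^sub>\<infinity>k. sdrop k \<omega> \<in> cylinder (lam k)}"

end

theory Submission
  imports Defs "HOL-Probability.Probability"
begin

text \<open>Upper bound: for \<open>t > s\<^sub>0\<close> the ellipsoids \<open>f\<^sub>w f\<^bsub>\<lambda>\<^sub>k\<^esub> (ball)\<close> with \<open>w\<close> of length \<open>k\<close> cover the target set,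
  and their total \<open>t\<close>-dimensional content is of order \<open>exp (k (P(t) - \<alpha>(t)))\<close>, which is summable.

  Lower bound: let \<open>P(s) > \<alpha>(s)\<close>, with \<open>s \<le> d\<close>. Random sequences are built by concatenating independent
  blocks of a long fixed length, chosen with probability proportional to \<open>\<phi>\<^sup>s\<close>, with connecting words that
  make \<open>\<phi>\<^sup>s\<close> multiplicative up to constants. At a sparse sequence of positions \<open>k\<close> with
  \<open>\<phi>\<^sup>s(A\<^bsub>\<lambda>\<^sub>k\<^esub>) \<ge> exp (- k b)\<close>, where \<open>\<alpha>(s) < b < P(s)\<close>, the word \<open>\<lambda>\<^sub>k\<close> is inserted. Since the blocks gain
  \<open>exp (k P(s))\<close>, the energy \<open>\<integral>\<integral> 1 / \<phi>\<^sup>s(A\<^bsub>x\<and>y\<^esub>)\<close> of the law remains finite. As the norms are below \<open>1/2\<close>, transversality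
  holds: the set of bounded \<open>t\<close> with \<open>\<bar>\<pi>\<^sub>t(x) - \<pi>\<^sub>t(y)\<bar> \<le> r\<close> has measure at most a constant times \<open>r\<^sup>s / \<phi>\<^sup>s(A\<^bsub>x\<and>y\<^esub>)\<close>.
  Hence for almost every \<open>t\<close> the projected law has finite \<open>s'\<close>-energy for \<open>s' < s\<close>, and for \<open>s = d\<close> it is
  not carried by a null set.\<close>

section \<open>Linear images of Lebesgue measure\<close>

text \<open>Connecting words cost a factor \<open>C\<close> at every block. The block length m is
  therefore chosen with \<open>C * Z s m\<close> larger than exp(b (m + K)): the gain per block then
  exceeds this loss and also exp(b) per letter, the rate at which inserted target words are paid
  for. A rate strictly between the two is the budget for all insertions. Lying above exp(b) per
  letter, it makes insertions affordable infinitely often; lying below the gain, it turns the energy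
  into a convergent geometric series. The insertion positions are fixed beforehand and do not depend
  on the random blocks. Hence the blocks occupy the same places in all random points, and the energy
  can be computed from the first block in which two independent points differ. The measure statement
  has an obstacle of its own: \<open>emeasure\<close> is 0 on nonmeasurable sets, so a set that is
  not null need not have positive \<open>emeasure\<close>. This is why the target set has to be
  proved measurable, although it is only given as a projection of a set of sequences.\<close>

lemma nn_integral_lborel_reflect_translate:
  fixes h :: "'a::euclidean_space \<Rightarrow> ennreal" and c :: real
  assumes [measurable]: "h \<in> borel_measurable borel" and c: "\<bar>c\<bar> = 1"
  shows "(\<integral>\<^sup>+x. h (t + c *\<^sub>R x) \<partial>lborel) = (\<integral>\<^sup>+x. h x \<partial>lborel)"
proof -
  have "c \<noteq> 0" using c by auto
  have "(\<integral>\<^sup>+x. h x \<partial>lborel) = (\<integral>\<^sup>+x. h x \<partial>density (distr lborel borel (\<lambda>x. t + c *\<^sub>R x)) (\<lambda>_. ennreal (\<bar>c\<bar> ^ DIM('a))))"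
    using lborel_affine[OF \<open>c \<noteq> 0\<close>, of t] by simp
  also have "\<dots> = (\<integral>\<^sup>+x. h (t + c *\<^sub>R x) \<partial>lborel)"
    using c by (simp add: nn_integral_density nn_integral_distr)
  finally show ?thesis ..
qed

text \<open>Both sides are equal to
  \<open>\<integral>\<integral> 1\<^bsub>A\<^esub>(x + f y) 1\<^bsub>B\<^esub>(f y) dx dy\<close> for \<open>B\<close> the unit ball.\<close>
lemma emeasure_linear_vimage:
  fixes f :: "'a::euclidean_space \<Rightarrow> 'a"
  assumes lin: "linear f" and inj: "inj f" and A[measurable]: "A \<in> sets borel"
  shows "emeasure lborel (f -` A) * emeasure lborel (ball (0::'a) 1)
       = emeasure lborel A * emeasure lborel (f -` ball 0 1)"
proof -
  let ?B = "ball (0::'a) 1"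
  have cont: "continuous_on UNIV f" using lin by (simp add: linear_continuous_on linear_linear)
  have [measurable]: "f \<in> borel_measurable borel" by (rule borel_measurable_continuous_onI[OF cont])
  have surj: "surj f" using lin inj linear_injective_imp_surjective by blast
  define g where "g = inv f"
  have fg: "f (g x) = x" for x using surj by (simp add: g_def surj_f_inv_f)
  have B[measurable]: "?B \<in> sets borel" by simp
  have ind: "emeasure lborel (f -` S) = (\<integral>\<^sup>+y. indicator S (f y) \<partial>lborel)" if S: "S \<in> sets borel" for S
  proof -
    have "f -` S \<in> sets borel" using S measurable_sets[of f borel borel S] by simp
    then have "emeasure lborel (f -` S) = (\<integral>\<^sup>+y. indicator (f -` S) y \<partial>lborel)" by simp
    also have "\<dots> = (\<integral>\<^sup>+y. indicator S (f y) \<partial>lborel)"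
      by (intro nn_integral_cong) (auto simp: indicator_def)
    finally show ?thesis .
  qed
  have mi[measurable]: "(\<lambda>y. indicator S (f y) :: ennreal) \<in> borel_measurable lborel" if [measurable]: "S \<in> sets borel" for S
    by measurable
  have "emeasure lborel A * emeasure lborel (f -` ?B)
      = (\<integral>\<^sup>+y. indicator ?B (f y) * (\<integral>\<^sup>+x. indicator A x \<partial>lborel) \<partial>lborel)"
    by (subst nn_integral_multc[OF mi]) (simp_all add: ind mult.commute)
  also have "\<dots> = (\<integral>\<^sup>+y. indicator ?B (f y) * (\<integral>\<^sup>+x. indicator A (f y + 1 *\<^sub>R x) \<partial>lborel) \<partial>lborel)"
    by (subst nn_integral_lborel_reflect_translate) auto
  also have "\<dots> = (\<integral>\<^sup>+y. (\<integral>\<^sup>+x. indicator ?B (f y) * indicator A (f y + x) \<partial>lborel) \<partial>lborel)"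
    by (simp add: nn_integral_cmult)
  also have "\<dots> = (\<integral>\<^sup>+x. (\<integral>\<^sup>+y. indicator ?B (f y) * indicator A (f y + x) \<partial>lborel) \<partial>lborel)"
    by (rule lborel_pair.Fubini') measurable
  \<comment> \<open>Since \<open>f (g x) = x\<close>, shifting y by \<open>- g x\<close> moves the
    dependence on x from the factor with A to the factor with the ball.\<close>
  also have "\<dots> = (\<integral>\<^sup>+x. (\<integral>\<^sup>+y. indicator ?B (f (- g x + 1 *\<^sub>R y)) * indicator A (f (- g x + 1 *\<^sub>R y) + x) \<partial>lborel) \<partial>lborel)"
    by (subst nn_integral_lborel_reflect_translate) auto
  also have "\<dots> = (\<integral>\<^sup>+x. (\<integral>\<^sup>+y. indicator ?B (f y - x) * indicator A (f y) \<partial>lborel) \<partial>lborel)"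
  proof -
    have *: "f (- g x + 1 *\<^sub>R y) = f y - x" for x y
      using linear_diff[OF lin, of y "g x"] fg[of x] by (simp add: algebra_simps)
    show ?thesis by (simp only: *) simp
  qed
  also have "\<dots> = (\<integral>\<^sup>+y. (\<integral>\<^sup>+x. indicator ?B (f y - x) * indicator A (f y) \<partial>lborel) \<partial>lborel)"
    by (rule lborel_pair.Fubini') measurable
  also have "\<dots> = (\<integral>\<^sup>+y. (\<integral>\<^sup>+x. indicator ?B (f y + (-1) *\<^sub>R x) \<partial>lborel) * indicator A (f y) \<partial>lborel)"
    by (simp add: nn_integral_multc)
  also have "\<dots> = (\<integral>\<^sup>+y. emeasure lborel ?B * indicator A (f y) \<partial>lborel)"
    by (subst nn_integral_lborel_reflect_translate) auto
  also have "\<dots> = emeasure lborel (f -` A) * emeasure lborel ?B"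
    by (subst nn_integral_cmult[OF mi]) (simp_all add: ind mult.commute)
  finally show ?thesis ..
qed

lemma emeasure_unit_ball: 
  shows "emeasure lborel (ball (0::'a::euclidean_space) 1) \<noteq> 0"
    "emeasure lborel (ball (0::'a::euclidean_space) 1) \<noteq> \<infinity>"
  using emeasure_lborel_ball_finite[of "0::'a" 1] by (auto simp: emeasure_ball less_imp_neq[OF unit_ball_vol_pos, symmetric])

text \<open>An orthogonal map preserves the unit ball, so the two ball factors in
  \<open>emeasure_linear_vimage\<close> cancel. No determinant enters.\<close>

lemma emeasure_orthogonal_vimage:
  fixes f :: "'a::euclidean_space \<Rightarrow> 'a"
  assumes f: "orthogonal_transformation f" and A: "A \<in> sets borel"
  shows "emeasure lborel (f -` A) = emeasure lborel A"
proof -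
  have *: "f -` ball 0 1 = ball 0 1" using f by (auto simp: orthogonal_transformation_norm)
  show ?thesis
    using emeasure_linear_vimage[OF orthogonal_transformation_linear[OF f] orthogonal_transformation_inj[OF f] A]
      emeasure_unit_ball[where 'a='a] by (simp add: * mult.commute[of _ "emeasure lborel (ball 0 1)"] ennreal_mult_cancel_left)
qed

text \<open>The preimage of the unit ball lies in the ball of radius 1 / \<kappa>, which bounds the
  ratio in \<open>emeasure_linear_vimage\<close>. This is the form in which transversality is turned
  into a measure estimate.\<close>

lemma emeasure_expanding_vimage_le:
  fixes f :: "'a::euclidean_space \<Rightarrow> 'a"
  assumes lin: "linear f" and k: "\<kappa> > 0" "\<And>v. norm (f v) \<ge> \<kappa> * norm v" and A: "A \<in> sets borel"
  shows "emeasure lborel {v. f v + c \<in> A} \<le> ennreal ((1/\<kappa>) ^ DIM('a)) * emeasure lborel A"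
proof -
  have inj: "inj f" unfolding linear_injective_0[OF lin] using k by (metis mult_le_0_iff norm_le_zero_iff norm_zero not_less)
  let ?A = "{x. x + c \<in> A}"
  have A': "?A \<in> sets borel" 
  proof -
    have "(\<lambda>x. x + c) \<in> borel_measurable borel" by simp
    from measurable_sets[OF this A] show ?thesis by (simp add: vimage_def)
  qed
  have trans: "emeasure lborel ?A = emeasure lborel A"
  proof -
    have "emeasure lborel ?A = (\<integral>\<^sup>+x. indicator ?A x \<partial>lborel)" using A' by simp
    also have "\<dots> = (\<integral>\<^sup>+x. indicator A (c + 1 *\<^sub>R x) \<partial>lborel)"
      by (intro nn_integral_cong) (auto simp: add.commute split: split_indicator)
    also have "\<dots> = emeasure lborel A"
      using A by (subst nn_integral_lborel_reflect_translate) auto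
    finally show ?thesis .
  qed
  have "f -` ball 0 1 \<subseteq> ball 0 (1/\<kappa>)"
  proof
    fix v assume "v \<in> f -` ball 0 1"
    then have "\<kappa> * norm v < 1" using k(2)[of v] by simp
    then show "v \<in> ball 0 (1/\<kappa>)" using k(1) by (simp add: field_simps)
  qed
  then have "emeasure lborel (f -` ball 0 1) \<le> emeasure lborel (ball (0::'a) (1/\<kappa>))"
    by (intro emeasure_mono) auto
  also have "\<dots> = ennreal ((1/\<kappa>) ^ DIM('a)) * emeasure lborel (ball (0::'a) 1)"
    using k(1) by (simp add: emeasure_ball mult.commute flip: ennreal_mult)
  finally have le: "emeasure lborel (f -` ball 0 1) \<le> \<dots>" .
  have "emeasure lborel (f -` ?A) * emeasure lborel (ball (0::'a) 1) \<le>
        (ennreal ((1/\<kappa>) ^ DIM('a)) * emeasure lborel A) * emeasure lborel (ball (0::'a) 1)"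
    unfolding emeasure_linear_vimage[OF lin inj A'] trans
    using mult_left_mono[OF le, of "emeasure lborel A"] by (simp add: ac_simps)
  then have "emeasure lborel (f -` ?A) \<le> ennreal ((1/\<kappa>) ^ DIM('a)) * emeasure lborel A"
    using emeasure_unit_ball[where 'a='a] by (metis ennreal_mult_le_mult_iff infinity_ennreal_def mult.commute)
  then show ?thesis by (simp add: vimage_def)
qed

text \<open>An orthogonal map sends the given frame to the standard basis and hence the oblique box
  to an axis-parallel one of the same measure. The frame is a sequence because it will be the
  singular frame, which is ordered.\<close>

lemma emeasure_orthonormal_box:
  fixes e :: "nat \<Rightarrow> 'a::euclidean_space"
  assumes on: "\<And>i j. i < DIM('a) \<Longrightarrow> j < DIM('a) \<Longrightarrow> e i \<bullet> e j = (if i = j then 1 else 0)"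
    and c: "\<And>i. i < DIM('a) \<Longrightarrow> 0 \<le> c i"
  shows "{y. \<forall>i<DIM('a). \<bar>y \<bullet> e i\<bar> \<le> c i} \<in> sets borel"
    "emeasure lborel {y. \<forall>i<DIM('a). \<bar>y \<bullet> e i\<bar> \<le> c i} = ennreal (\<Prod>i<DIM('a). 2 * c i)"
proof -
  obtain b where b: "bij_betw b {..<DIM('a)} (Basis::'a set)"
    using ex_bij_betw_nat_finite[of "Basis::'a set"] by (auto simp: atLeast0LessThan)
  define f where "f y = (\<Sum>i<DIM('a). (y \<bullet> e i) *\<^sub>R b i)" for y
  have lin: "linear f" unfolding f_def
    by (intro linear_compose_sum ballI) (auto intro!: linearI simp: inner_add_left algebra_simps)
  have bB: "b i \<in> Basis" if "i < DIM('a)" for i using b that by (auto simp: bij_betw_def)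
  have bi: "b i \<bullet> b j = (if i = j then 1 else 0)" if "i < DIM('a)" "j < DIM('a)" for i j
    using b that by (auto simp: inner_Basis bB bij_betw_def inj_on_def)
  have fb: "f y \<bullet> b i = y \<bullet> e i" if "i < DIM('a)" for i y
  proof -
    have "f y \<bullet> b i = (\<Sum>j<DIM('a). (y \<bullet> e j) * (if j = i then 1 else 0))"
      unfolding f_def inner_sum_left by (intro sum.cong) (auto simp: bi that)
    then show ?thesis using that by (simp add: if_distrib cong: if_cong)
  qed
  have "independent (e ` {..<DIM('a)})"
  proof (rule pairwise_orthogonal_independent)
    show "pairwise orthogonal (e ` {..<DIM('a)})"
      using on by (auto simp: pairwise_def orthogonal_def) 
    show "0 \<notin> e ` {..<DIM('a)}" using on by force
  qed
  moreover have inje: "inj_on e {..<DIM('a)}"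
    by (rule inj_onI) (metis on lessThan_iff zero_neq_one)
  ultimately have span: "span (e ` {..<DIM('a)}) = UNIV"
    by (metis basis_subspace_exists card_image card_lessThan dim_UNIV dim_eq_card_independent dim_eq_full)
  have injf: "f y = 0 \<Longrightarrow> y = 0" for y
  proof -
    assume "f y = 0"
    then have "y \<bullet> e i = 0" if "i < DIM('a)" for i using fb[OF that, of y] by simp
    then have "\<And>z. z \<in> e ` {..<DIM('a)} \<Longrightarrow> orthogonal y z" by (auto simp: orthogonal_def)
    then have "\<And>z. z \<in> span (e ` {..<DIM('a)}) \<Longrightarrow> orthogonal y z" using orthogonal_to_span by blast
    then show "y = 0" using span by (metis UNIV_I orthogonal_self)
  qed
  have "orthogonal_transformation f"
  proof -
    have fe: "f (e i) = b i" if "i < DIM('a)" for i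
      unfolding f_def using that on by (simp add: if_distrib[of "\<lambda>x. x *\<^sub>R _"] cong: if_cong)
    have "norm (f y) = norm y" for y
    proof -
      have y: "y = (\<Sum>i<DIM('a). (y \<bullet> e i) *\<^sub>R e i)"
      proof -
        have "f (y - (\<Sum>i<DIM('a). (y \<bullet> e i) *\<^sub>R e i)) = 0"
        proof -
          have "f (\<Sum>i<DIM('a). (y \<bullet> e i) *\<^sub>R e i) = (\<Sum>i<DIM('a). (y \<bullet> e i) *\<^sub>R b i)"
            unfolding linear_sum[OF lin] by (intro sum.cong) (auto simp: linear_scale[OF lin] fe)
          then show ?thesis unfolding linear_diff[OF lin] by (simp add: f_def)
        qed
        from injf[OF this] show ?thesis by simp
      qed
      have "y \<bullet> y = (\<Sum>i<DIM('a). (y \<bullet> e i)\<^sup>2)"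
        by (subst (2) y) (simp add: inner_sum_right power2_eq_square)
      moreover have "f y \<bullet> f y = (\<Sum>i<DIM('a). (y \<bullet> e i)\<^sup>2)"
        by (subst (2) f_def) (simp add: inner_sum_right power2_eq_square fb)
      ultimately show ?thesis by (simp add: norm_eq_sqrt_inner)
    qed
    then show ?thesis using lin by (simp add: orthogonal_transformation)
  qed
  note orth = this
  have co: "(\<Sum>j<DIM('a). h j *\<^sub>R b j) \<bullet> b i = h i" if "i < DIM('a)" for i h
  proof -
    have "(\<Sum>j<DIM('a). h j *\<^sub>R b j) \<bullet> b i = (\<Sum>j<DIM('a). h j * (if j = i then 1 else 0))"
      unfolding inner_sum_left by (intro sum.cong) (auto simp: bi that)
    then show ?thesis using that by (simp add: if_distrib cong: if_cong)
  qed
  define lo hi where "lo = (\<Sum>i<DIM('a). (- c i) *\<^sub>R b i)" and "hi = (\<Sum>i<DIM('a). c i *\<^sub>R b i)"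
  have lohi: "lo \<bullet> b i = - c i" "hi \<bullet> b i = c i" if "i < DIM('a)" for i
    unfolding lo_def hi_def by (rule co[OF that])+
  have BB: "(\<forall>x\<in>Basis. P x) \<longleftrightarrow> (\<forall>i\<in>{..<DIM('a)}. P (b i))" for P
    using b bB unfolding bij_betw_def by (metis imageE lessThan_iff)
  have eq: "{y. \<forall>i<DIM('a). \<bar>y \<bullet> e i\<bar> \<le> c i} = f -` cbox lo hi"
  proof (rule set_eqI)
    fix x
    have abs: "\<bar>z\<bar> \<le> w \<longleftrightarrow> - w \<le> z \<and> z \<le> w" for z w :: real by auto
    have "f x \<in> cbox lo hi \<longleftrightarrow> (\<forall>i\<in>{..<DIM('a)}. lo \<bullet> b i \<le> f x \<bullet> b i \<and> f x \<bullet> b i \<le> hi \<bullet> b i)"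
      unfolding cbox_def mem_Collect_eq by (rule BB)
    also have "\<dots> \<longleftrightarrow> (\<forall>i\<in>{..<DIM('a)}. \<bar>x \<bullet> e i\<bar> \<le> c i)"
      by (intro ball_cong refl) (simp add: lohi fb abs)
    finally show "x \<in> {y. \<forall>i<DIM('a). \<bar>y \<bullet> e i\<bar> \<le> c i} \<longleftrightarrow> x \<in> f -` cbox lo hi"
      by (simp add: Ball_def)
  qed
  have "f \<in> borel_measurable borel"
    using lin by (intro borel_measurable_continuous_onI) (simp add: linear_continuous_on linear_linear)
  then show "{y. \<forall>i<DIM('a). \<bar>y \<bullet> e i\<bar> \<le> c i} \<in> sets borel"
    unfolding eq using measurable_sets[of f borel borel "cbox lo hi"] by simp
  have "emeasure lborel (f -` cbox lo hi) = emeasure lborel (cbox lo hi)"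
    by (rule emeasure_orthogonal_vimage[OF orth]) simp
  also have "\<dots> = ennreal (\<Prod>x\<in>Basis. (hi - lo) \<bullet> x)"
    by (rule emeasure_lborel_cbox) (use BB[of "\<lambda>x. lo \<bullet> x \<le> hi \<bullet> x"] lohi c in force)
  also have "(\<Prod>x\<in>Basis. (hi - lo) \<bullet> x) = (\<Prod>i<DIM('a). (hi - lo) \<bullet> b i)"
    using prod.reindex_bij_betw[OF b, of "\<lambda>x. (hi - lo) \<bullet> x"] by simp
  also have "\<dots> = (\<Prod>i<DIM('a). 2 * c i)"
    by (intro prod.cong) (auto simp: lohi inner_diff_left)
  finally show "emeasure lborel {y. \<forall>i<DIM('a). \<bar>y \<bullet> e i\<bar> \<le> c i} = ennreal (\<Prod>i<DIM('a). 2 * c i)"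
    unfolding eq .
qed

section \<open>Singular values\<close>

text \<open>The quadratic form \<open>f x \<bullet> x\<close> attains its maximum on the unit sphere
  of S. At a maximum point x the first variation in every direction of S orthogonal to x vanishes,
  so f x is parallel to x.\<close>

lemma symmetric_eigenvector_exists:
  fixes f :: "'a::euclidean_space \<Rightarrow> 'a"
  assumes lin: "linear f" and sym: "\<And>x y. f x \<bullet> y = x \<bullet> f y"
    and S: "subspace S" "f ` S \<subseteq> S" "S \<noteq> {0}"
  shows "\<exists>x\<in>S. norm x = 1 \<and> (\<exists>l. f x = l *\<^sub>R x)"
proof -
  interpret linear f by fact
  let ?K = "S \<inter> sphere 0 1"
  have "compact ?K" using S(1) by (simp add: closed_subspace closed_Int_compact)
  moreover have "?K \<noteq> {}"
  proof -
    obtain y where "y \<in> S" "y \<noteq> 0" using S subspace_0 by blast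
    then have "y /\<^sub>R norm y \<in> ?K" using S(1) by (simp add: subspace_scale)
    then show ?thesis by blast
  qed
  moreover have "continuous_on ?K (\<lambda>x. f x \<bullet> x)"
    using lin by (intro continuous_intros linear_continuous_on) (simp add: linear_linear)
  ultimately obtain x where x: "x \<in> S" "norm x = 1" and max: "\<And>y. y \<in> S \<Longrightarrow> norm y = 1 \<Longrightarrow> f y \<bullet> y \<le> f x \<bullet> x"
    using continuous_attains_sup[of ?K "\<lambda>x. f x \<bullet> x"] by (metis (no_types, lifting) Int_iff mem_sphere_0)
  define l where "l = f x \<bullet> x"
  have max': "f y \<bullet> y \<le> l * (y \<bullet> y)" if "y \<in> S" for y
  proof (cases "y = 0")
    case False
    have "f (y /\<^sub>R norm y) \<bullet> (y /\<^sub>R norm y) \<le> l"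
      unfolding l_def using False that S(1) by (intro max) (auto simp: subspace_scale)
    then have "(f y \<bullet> y) / (norm y)\<^sup>2 \<le> l"
      using False by (simp add: scale power2_eq_square field_simps)
    then show ?thesis using False by (simp add: field_simps power2_norm_eq_inner)
  qed (simp add: zero)
  have xx: "x \<bullet> x = 1" using x(2) by (simp add: norm_eq_1)
  have perp: "f x \<bullet> y = 0" if y: "y \<in> S" "x \<bullet> y = 0" for y
  proof (rule ccontr)
    assume n: "f x \<bullet> y \<noteq> 0"
    define q where "q = f y \<bullet> y - l * (y \<bullet> y)"
    \<comment> \<open>Maximality tested at \<open>x + e *\<^sub>R y\<close>: a parabola in e that
      must stay nonpositive, although its linear coefficient is nonzero.\<close>
    have le: "2 * e * (f x \<bullet> y) + e\<^sup>2 * q \<le> 0" for e :: real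
    proof -
      have "x + e *\<^sub>R y \<in> S" using x y S(1) by (simp add: subspace_add subspace_scale)
      from max'[OF this] have "f x \<bullet> x + e * (f x \<bullet> y) + e * (f y \<bullet> x) + e\<^sup>2 * (f y \<bullet> y) \<le> l * (1 + e\<^sup>2 * (y \<bullet> y))"
        using y(2) by (simp add: add scale inner_add_left inner_add_right xx inner_commute[of y x] power2_eq_square algebra_simps)
      moreover have "f y \<bullet> x = f x \<bullet> y" using sym[of y x] by (simp add: inner_commute)
      ultimately show ?thesis by (simp add: l_def q_def algebra_simps)
    qed
    have q: "q \<le> 0" using max'[OF y(1)] by (simp add: q_def)
    define s where "s = f x \<bullet> y"
    show False
    proof (cases "q = 0")
      case True then show False using le[of s] n by (simp add: s_def power2_eq_square) (smt (verit) not_sum_squares_lt_zero zero_less_mult_iff)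
    next
      case False
      then have "q < 0" using q by simp
      \<comment> \<open>The parameter -s/q is the vertex of the parabola, where its value is
        positive.\<close>
      have "2 * (- s/q) * s + (- s/q)\<^sup>2 * q = - (s\<^sup>2) / q"
        using False by (simp add: field_simps power2_eq_square)
      moreover have "- (s\<^sup>2) / q > 0" using \<open>q < 0\<close> n by (simp add: s_def divide_less_0_iff)
      ultimately show False using le[of "- s/q"] by (simp add: s_def)
    qed
  qed
  define z where "z = f x - l *\<^sub>R x"
  have zS: "z \<in> S" unfolding z_def using x S by (auto intro!: subspace_diff subspace_scale)
  have "x \<bullet> z = 0" by (simp add: z_def inner_diff_right l_def xx inner_commute)
  moreover from perp[OF zS this] have "f x \<bullet> z = 0" .
  ultimately have "z \<bullet> z = 0" by (subst z_def) (simp add: inner_diff_left)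
  then have "f x = l *\<^sub>R x" by (simp add: z_def)
  then show ?thesis using x by blast
qed

text \<open>Splits off one eigenvector. By symmetry its orthogonal complement in S is again
  invariant, and this is why the claim is made for all invariant subspaces and not for the whole
  space alone.\<close>

lemma symmetric_eigenbasis:
  fixes f :: "'a::euclidean_space \<Rightarrow> 'a"
  assumes lin: "linear f" and sym: "\<And>x y. f x \<bullet> y = x \<bullet> f y"
    and S: "subspace S" "f ` S \<subseteq> S"
  shows "\<exists>B. finite B \<and> B \<subseteq> S \<and> pairwise orthogonal B \<and> (\<forall>b\<in>B. norm b = 1) \<and> span B = S \<and> (\<forall>b\<in>B. \<exists>l. f b = l *\<^sub>R b)"
  using S
proof (induction "dim S" arbitrary: S)
  case 0
  then have "S = {0}" using subspace_0 by (auto simp: dim_eq_0)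
  then show ?case by (intro exI[of _ "{}"]) auto
next
  case (Suc n)
  then have "S \<noteq> {0}" by auto
  then obtain x l where x: "x \<in> S" "norm x = 1" "f x = l *\<^sub>R x"
    using symmetric_eigenvector_exists[OF lin sym Suc.prems] by blast
  have xx: "x \<bullet> x = 1" using x(2) by (simp add: norm_eq_1)
  let ?T = "{y \<in> S. x \<bullet> y = 0}"
  have T: "subspace ?T" using Suc.prems(1) by (auto simp: subspace_def inner_add_right)
  have fT: "f ` ?T \<subseteq> ?T"
  proof clarify
    fix y assume "y \<in> S" "x \<bullet> y = 0"
    then show "f y \<in> S \<and> x \<bullet> f y = 0" using Suc.prems(2) sym[of x y] x(3) by auto
  qed
  have dec: "\<exists>y\<in>?T. v = (x \<bullet> v) *\<^sub>R x + y" if "v \<in> S" for v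
    using that x Suc.prems(1) by (intro bexI[of _ "v - (x \<bullet> v) *\<^sub>R x"]) (auto simp: inner_diff_right xx subspace_diff subspace_scale)
  have spS: "span (insert x ?T) = S"
  proof
    show "span (insert x ?T) \<subseteq> S" using x Suc.prems(1) by (intro span_minimal) auto
    show "S \<subseteq> span (insert x ?T)"
    proof
      fix v assume "v \<in> S"
      then obtain y where "y \<in> ?T" "v = (x \<bullet> v) *\<^sub>R x + y" using dec by blast
      then show "v \<in> span (insert x ?T)" by (metis insertI1 insertI2 span_add span_base span_scale)
    qed
  qed
  have "x \<notin> span ?T" using T xx by (metis (mono_tags, lifting) mem_Collect_eq span_eq_iff zero_neq_one)
  then have "dim S = Suc (dim ?T)" using dim_insert[of x ?T] spS by (metis dim_span Suc_eq_plus1)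
  then have "n = dim ?T" using Suc.hyps(2) by simp
  from Suc.hyps(1)[OF this T fT] obtain B where B: "finite B" "B \<subseteq> ?T" "pairwise orthogonal B" "\<forall>b\<in>B. norm b = 1" "span B = ?T" "\<forall>b\<in>B. \<exists>l. f b = l *\<^sub>R b"
    by blast
  have "span (insert x B) = S"
  proof -
    have "span (insert x B) = span (insert x (span B))" by (simp add: span_insert span_span)
    then show ?thesis using spS B(5) by simp
  qed
  moreover have "pairwise orthogonal (insert x B)"
    using B(2,3) by (auto simp: pairwise_insert orthogonal_def inner_commute subset_iff)
  ultimately show ?case using B x by (intro exI[of _ "insert x B"]) auto
qed

lemma transpose_mult_inner:
  fixes A :: "real ^ 'n ^ 'n"
  shows "((transpose A ** A) *v x) \<bullet> y = (A *v x) \<bullet> (A *v y)"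
  by (metis dot_lmul_matrix matrix_vector_mul_assoc transpose_matrix_vector)

lemma sorted_concat_replicate:
  fixes xs :: "'a::linorder list"
  shows "sorted xs \<Longrightarrow> sorted (concat (map (\<lambda>a. replicate (n a) a) xs))"
  by (induction xs) (auto simp: sorted_append)

text \<open>The frame is an orthonormal eigenbasis of \<open>transpose A ** A\<close>, sorted by the
  norms of the images under A. The list of singular values counts dimensions of eigenspaces; these
  agree with the multiplicities in the sorted basis because the space for a is spanned by the basis
  vectors whose image has norm a.\<close>

lemma singular_frame_exists:
  fixes A :: "real ^ 'd ^ 'd"
  shows "\<exists>e :: nat \<Rightarrow> real ^ 'd. (\<forall>i<CARD('d). \<forall>j<CARD('d). e i \<bullet> e j = (if i = j then 1 else 0))
    \<and> (\<forall>i<CARD('d). \<forall>j<CARD('d). i \<noteq> j \<longrightarrow> (A *v e i) \<bullet> (A *v e j) = 0)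
    \<and> (\<forall>i<CARD('d). norm (A *v e i) = singular_values A ! i)
    \<and> length (singular_values A) = CARD('d) \<and> sorted (rev (singular_values A))"
proof -
  let ?f = "(*v) (transpose A ** A)"
  have sym: "?f x \<bullet> y = x \<bullet> ?f y" for x y
    by (metis transpose_mult_inner inner_commute)
  obtain B where B: "finite B" "pairwise orthogonal B" "\<And>b. b \<in> B \<Longrightarrow> norm b = 1" "span B = (UNIV :: (real^'d) set)"
      and ev: "\<And>b. b \<in> B \<Longrightarrow> \<exists>l. ?f b = l *\<^sub>R b"
    using symmetric_eigenbasis[of ?f UNIV] sym by auto
  define g where "g b = norm (A *v b)" for b
  have fb: "?f b = (g b)\<^sup>2 *\<^sub>R b" if b: "b \<in> B" for b
  proof -
    obtain l where l: "?f b = l *\<^sub>R b" using ev b by blast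
    have "l = ?f b \<bullet> b" using B(3)[OF b] by (simp add: l norm_eq_1)
    also have "\<dots> = (g b)\<^sup>2" by (simp add: transpose_mult_inner g_def power2_norm_eq_inner)
    finally show ?thesis using l by simp
  qed
  have B0: "b \<noteq> 0" if "b \<in> B" for b using B(3)[OF that] by auto
  have ind: "independent X" if "X \<subseteq> B" for X
    using that B(2) B0 by (intro pairwise_orthogonal_independent) (auto intro: pairwise_subset)
  have cardB: "card B = CARD('d)"
    using ind[of B] B(4) by (metis DIM_cart DIM_real dim_UNIV dim_span indep_card_eq_dim_span mult.right_neutral order_refl)
  have space: "singular_value_space A a = span {b \<in> B. g b = a}" if a: "0 \<le> a" for a
  proof
    show "span {b \<in> B. g b = a} \<subseteq> singular_value_space A a"
    proof (rule span_minimal)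
      show "subspace (singular_value_space A a)"
        unfolding singular_value_space_def by (auto simp: subspace_def matrix_vector_right_distrib scaleR_add_right matrix_vector_mult_scaleR)
    qed (auto simp: singular_value_space_def fb)
    show "singular_value_space A a \<subseteq> span {b \<in> B. g b = a}"
    proof
      fix v assume "v \<in> singular_value_space A a"
      then have v: "?f v = a\<^sup>2 *\<^sub>R v" by (simp add: singular_value_space_def)
      have z: "v \<bullet> b = 0" if b: "b \<in> B" "g b \<noteq> a" for b
      proof -
        have "a\<^sup>2 * (v \<bullet> b) = ?f v \<bullet> b" by (simp add: v)
        also have "\<dots> = (g b)\<^sup>2 * (v \<bullet> b)" unfolding sym fb[OF b(1)] by simp
        finally have "(a\<^sup>2 - (g b)\<^sup>2) * (v \<bullet> b) = 0" by (simp add: algebra_simps)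
        moreover have "a\<^sup>2 \<noteq> (g b)\<^sup>2" using b(2) a by (simp add: g_def power2_eq_iff_nonneg)
        ultimately show ?thesis by simp
      qed
      have "v = (\<Sum>b\<in>B. (v \<bullet> b) *\<^sub>R b)"
        using orthonormal_basis_expand[of B v] B by simp
      also have "\<dots> \<in> span {b \<in> B. g b = a}"
      proof (rule span_sum)
        fix b assume "b \<in> B"
        then show "(v \<bullet> b) *\<^sub>R b \<in> span {b \<in> B. g b = a}"
          using z[of b] by (cases "g b = a") (simp_all add: span_scale span_base span_zero)
      qed
      finally show "v \<in> span {b \<in> B. g b = a}" .
    qed
  qed
  have dims: "dim (singular_value_space A a) = card {b \<in> B. g b = a}" if "0 \<le> a" for a
    using ind[of "{b \<in> B. g b = a}"] by (simp add: space[OF that] dim_eq_card_independent)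
  have T: "{a. 0 \<le> a \<and> (\<exists>v\<in>singular_value_space A a. v \<noteq> 0)} = g ` B"
  proof safe
    fix a v assume "0 \<le> a" "v \<in> singular_value_space A a" "v \<noteq> 0"
    then have "{b \<in> B. g b = a} \<noteq> {}" using space by (metis singletonD span_empty)
    then show "a \<in> g ` B" by blast
  next
    fix b assume b: "b \<in> B"
    then show "\<exists>v\<in>singular_value_space A (g b). v \<noteq> 0"
      by (intro bexI[of _ b]) (auto simp: singular_value_space_def fb B0)
  qed (simp add: g_def)
  have rv: "rev (singular_values A) = concat (map (\<lambda>a. replicate (dim (singular_value_space A a)) a) (sorted_list_of_set (g ` B)))"
    unfolding singular_values_def T by (simp add: rev_concat rev_map comp_def)
  have srt: "sorted (rev (singular_values A))"
    unfolding rv by (rule sorted_concat_replicate) simp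
  have cnt: "count (mset (concat (map (\<lambda>a. replicate (n a) a) xs))) a = (if a \<in> set xs then n a else 0)"
    if "distinct xs" for n :: "real \<Rightarrow> nat" and xs a
    using that by (induction xs) auto
  \<comment> \<open>Two sorted lists with the same multiset are equal, so only multiplicities have
    to be compared.\<close>
  have ms: "mset (rev (singular_values A)) = image_mset g (mset_set B)"
  proof (rule multiset_eqI)
    fix a
    have "count (image_mset g (mset_set B)) a = (\<Sum>x | x \<in># mset_set B \<and> a = g x. count (mset_set B) x)"
      by (rule count_image_mset')
    also have "{x. x \<in># mset_set B \<and> a = g x} = {b \<in> B. g b = a}" using B(1) by auto
    also have "(\<Sum>x\<in>{b \<in> B. g b = a}. count (mset_set B) x) = (\<Sum>x\<in>{b \<in> B. g b = a}. 1)"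
      using B(1) by (intro sum.cong) auto
    finally have "count (image_mset g (mset_set B)) a = card {b \<in> B. g b = a}" by simp
    moreover have "count (mset (rev (singular_values A))) a = (if a \<in> g ` B then dim (singular_value_space A a) else 0)"
      unfolding rv using B(1) by (subst cnt) auto
    moreover have "a \<in> g ` B \<Longrightarrow> 0 \<le> a" by (auto simp: g_def)
    moreover have "a \<notin> g ` B \<Longrightarrow> card {b \<in> B. g b = a} = 0" by (auto simp: card_eq_0_iff)
    ultimately show "count (mset (rev (singular_values A))) a = count (image_mset g (mset_set B)) a"
      using dims[of a] by auto
  qed
  obtain ys where ys: "set ys = B" "distinct ys" using B(1) finite_distinct_list by blast
  define zs where "zs = rev (sort_key g ys)"
  have mys: "mset_set B = mset ys" using ys by (metis mset_set_set)
  have zs: "map g zs = singular_values A"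
  proof -
    have 1: "sort (map g ys) = map g (sort_key g ys)" by (rule properties_for_sort) simp_all
    have 2: "sort (map g ys) = rev (singular_values A)"
      by (rule properties_for_sort) (simp_all add: ms mys srt del: mset_rev)
    show ?thesis unfolding zs_def rev_map[symmetric] 1[symmetric] 2 by simp
  qed
  have dz: "set zs = B" "distinct zs" "length zs = CARD('d)"
    using ys cardB distinct_card[of ys] by (auto simp: zs_def)
  have nth: "zs ! i \<in> B" if "i < CARD('d)" for i using dz that by (metis nth_mem)
  have on: "zs ! i \<bullet> zs ! j = (if i = j then 1 else 0)" if "i < CARD('d)" "j < CARD('d)" for i j
  proof (cases "i = j")
    case True then show ?thesis using B(3)[OF nth[OF that(1)]] by (simp add: norm_eq_1)
  next
    case False
    then have "zs ! i \<noteq> zs ! j" using dz that by (simp add: nth_eq_iff_index_eq)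
    then show ?thesis using B(2) nth that False by (auto simp: pairwise_def orthogonal_def)
  qed
  have orthA: "(A *v zs ! i) \<bullet> (A *v zs ! j) = 0" if "i < CARD('d)" "j < CARD('d)" "i \<noteq> j" for i j
    unfolding transpose_mult_inner[symmetric] fb[OF nth[OF that(1)]] using on[OF that(1,2)] that(3) by simp
  have nm: "norm (A *v zs ! i) = singular_values A ! i" if "i < CARD('d)" for i
    using that dz zs by (metis g_def nth_map)
  have len: "length (singular_values A) = CARD('d)" using zs dz by (metis length_map)
  show ?thesis
    by (intro exI[of _ "\<lambda>i. zs ! i"]) (use on orthA nm len srt in auto)
qed

section \<open>Singular frames and coordinates with respect to them\<close>

abbreviation sv :: "real ^ 'd ^ 'd \<Rightarrow> nat \<Rightarrow> real" where "sv A i \<equiv> singular_values A ! i"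

text \<open>Right singular vectors in the order of decreasing singular values. They are not unique,
  so one choice is fixed for each matrix.\<close>

definition singular_frame :: "real ^ 'd ^ 'd \<Rightarrow> nat \<Rightarrow> real ^ 'd" where
  "singular_frame A = (SOME e. (\<forall>i<CARD('d). \<forall>j<CARD('d). e i \<bullet> e j = (if i = j then 1 else 0))
    \<and> (\<forall>i<CARD('d). \<forall>j<CARD('d). i \<noteq> j \<longrightarrow> (A *v e i) \<bullet> (A *v e j) = 0)
    \<and> (\<forall>i<CARD('d). norm (A *v e i) = singular_values A ! i)
    \<and> length (singular_values A) = CARD('d) \<and> sorted (rev (singular_values A)))"

lemma
  fixes A :: "real ^ 'd ^ 'd"
  shows singular_frame_orthonormal: "i < CARD('d) \<Longrightarrow> j < CARD('d) \<Longrightarrow> singular_frame A i \<bullet> singular_frame A j = (if i = j then 1 else 0)"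
    and singular_frame_image_orthogonal: "i < CARD('d) \<Longrightarrow> j < CARD('d) \<Longrightarrow> i \<noteq> j \<Longrightarrow> (A *v singular_frame A i) \<bullet> (A *v singular_frame A j) = 0"
    and norm_singular_frame_image: "i < CARD('d) \<Longrightarrow> norm (A *v singular_frame A i) = sv A i"
    and length_singular_values: "length (singular_values A) = CARD('d)"
    and sorted_rev_singular_values: "sorted (rev (singular_values A))"
  using someI_ex[OF singular_frame_exists[of A]] unfolding singular_frame_def[symmetric] by blast+

lemma sv_antimono:
  fixes A :: "real ^ 'd ^ 'd"
  assumes "i \<le> j" "j < CARD('d)"
  shows "sv A j \<le> sv A i"
  using sorted_rev_nth_mono[OF sorted_rev_singular_values[of A] assms(1)] assms(2) by (simp add: length_singular_values)

lemma sv_pos: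
  fixes A :: "real ^ 'd ^ 'd"
  assumes "invertible A" "i < CARD('d)"
  shows "0 < sv A i"
proof -
  have "singular_frame A i \<noteq> 0" using singular_frame_orthonormal[OF assms(2,2), of A] by auto
  then have "A *v singular_frame A i \<noteq> 0"
    using inj_eq[OF inj_matrix_vector_mult[OF assms(1)], of _ 0] by simp
  then show ?thesis using norm_singular_frame_image[OF assms(2)] by (metis zero_less_norm_iff)
qed

lemma norm_singular_frame:
  fixes A :: "real ^ 'd ^ 'd"
  assumes "i < CARD('d)"
  shows "norm (singular_frame A i) = 1"
  using singular_frame_orthonormal[OF assms assms] by (simp add: norm_eq_1)

lemma sv_le_onorm:
  fixes A :: "real ^ 'd ^ 'd"
  assumes "i < CARD('d)"
  shows "sv A i \<le> onorm ((*v) A)"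
  using onorm[OF matrix_vector_mul_bounded_linear, of A "singular_frame A i"] norm_singular_frame_image[OF assms, of A]
    norm_singular_frame[OF assms, of A] by simp

lemma sv_ge:
  fixes A :: "real ^ 'd ^ 'd"
  assumes "i < CARD('d)" "\<And>v. norm (A *v v) \<ge> k * norm v"
  shows "k \<le> sv A i"
  using assms(2)[of "singular_frame A i"] by (simp add: norm_singular_frame_image norm_singular_frame assms(1))

lemma singular_frame_expand:
  fixes A :: "real ^ 'd ^ 'd"
  shows "(\<Sum>i<CARD('d). (y \<bullet> singular_frame A i) *\<^sub>R singular_frame A i) = y"
proof -
  let ?E = "singular_frame A ` {..<CARD('d)}"
  have inj: "inj_on (singular_frame A) {..<CARD('d)}"
    by (rule inj_onI) (metis singular_frame_orthonormal lessThan_iff zero_neq_one)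
  have orth: "pairwise orthogonal ?E"
    by (auto simp: pairwise_def orthogonal_def singular_frame_orthonormal)
  have "singular_frame A i \<noteq> 0" if "i < CARD('d)" for i using norm_singular_frame[OF that, of A] by auto
  then have "0 \<notin> ?E" by force
  then have "independent ?E" using orth by (rule pairwise_orthogonal_independent[rotated])
  moreover have "card ?E = CARD('d)" using inj by (simp add: card_image)
  ultimately have "dim ?E = DIM(real^'d)" by (simp add: dim_eq_card_independent)
  then have "span ?E = UNIV" unfolding dim_eq_full .
  then have "(\<Sum>v\<in>?E. (y \<bullet> v) *\<^sub>R v) = y"
    by (intro orthonormal_basis_expand orth) (auto simp: norm_singular_frame)
  then show ?thesis by (simp add: sum.reindex[OF inj])
qed

lemma matrix_singular_expand:
  fixes A :: "real ^ 'd ^ 'd"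
  shows "A *v y = (\<Sum>i<CARD('d). (y \<bullet> singular_frame A i) *\<^sub>R (A *v singular_frame A i))"
proof -
  have "A *v y = A *v (\<Sum>i<CARD('d). (y \<bullet> singular_frame A i) *\<^sub>R singular_frame A i)"
    by (simp add: singular_frame_expand)
  then show ?thesis by (simp add: linear_sum[OF matrix_vector_mul_linear] matrix_vector_mult_scaleR)
qed

text \<open>Pairing \<open>A *v y\<close> with the image of the i-th frame vector leaves a single
  term, because these images are orthogonal; Cauchy-Schwarz then gives the bound.\<close>

lemma sv_coordinate_le:
  fixes A :: "real ^ 'd ^ 'd"
  assumes i: "i < CARD('d)"
  shows "sv A i * \<bar>y \<bullet> singular_frame A i\<bar> \<le> norm (A *v y)"
proof -
  let ?w = "A *v singular_frame A i"
  have ww: "?w \<bullet> ?w = (sv A i)\<^sup>2" using norm_singular_frame_image[OF i, of A] by (simp flip: power2_norm_eq_inner)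
  have "(A *v y) \<bullet> ?w = (\<Sum>j<CARD('d). (y \<bullet> singular_frame A j) * (if j = i then (sv A i)\<^sup>2 else 0))"
    unfolding matrix_singular_expand[of A y] inner_sum_left
    by (intro sum.cong) (auto simp: ww singular_frame_image_orthogonal i)
  also have "\<dots> = (y \<bullet> singular_frame A i) * (sv A i)\<^sup>2" using i by (simp add: if_distrib cong: if_cong)
  finally have "\<bar>y \<bullet> singular_frame A i\<bar> * (sv A i)\<^sup>2 \<le> norm (A *v y) * sv A i"
    using Cauchy_Schwarz_ineq2[of "A *v y" ?w] norm_singular_frame_image[OF i, of A] by (simp add: abs_mult)
  moreover have "0 \<le> sv A i" using norm_singular_frame_image[OF i, of A] by (metis norm_ge_zero)
  moreover have "\<bar>y \<bullet> singular_frame A i\<bar> * (sv A i)\<^sup>2 = (sv A i * \<bar>y \<bullet> singular_frame A i\<bar>) * sv A i"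
    by (simp add: power2_eq_square)
  ultimately show ?thesis
    using mult_right_le_imp_le[of "sv A i * \<bar>y \<bullet> singular_frame A i\<bar>" "sv A i" "norm (A *v y)"]
    by (cases "sv A i = 0") auto
qed

text \<open>The exponent in \<open>svf t\<close> of the singular value with index i, counted from 0:
  it is 1 below the floor of t, the fractional part at the floor and 0 above. With it
  \<open>svf t\<close> is one product of powers for all t in [0, d], including integers and the end
  point d.\<close>

definition svf_weight :: "real \<Rightarrow> nat \<Rightarrow> real" where "svf_weight t i = max 0 (min 1 (t - real i))"

text \<open>An integer t may be split at m = t or at m = t - 1. The second choice is the one
  available at t = d, where index d does not exist.\<close>

lemma prod_svf_weight_split:
  fixes A :: "real ^ 'd ^ 'd"
  assumes A: "invertible A" and m: "m < CARD('d)" "real m \<le> t" "t \<le> real m + 1"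
  shows "(\<Prod>i<CARD('d). sv A i powr svf_weight t i) = (\<Prod>i<m. sv A i) * sv A m powr (t - real m)"
proof -
  have split: "{..<CARD('d)} = {..<m} \<union> ({m} \<union> {m<..<CARD('d)})" using m(1) by auto
  have "(\<Prod>i<CARD('d). sv A i powr svf_weight t i) = (\<Prod>i<m. sv A i powr svf_weight t i) *
      (sv A m powr svf_weight t m * (\<Prod>i\<in>{m<..<CARD('d)}. sv A i powr svf_weight t i))"
    unfolding split by (subst prod.union_disjoint) auto
  also have "(\<Prod>i<m. sv A i powr svf_weight t i) = (\<Prod>i<m. sv A i)"
  proof (intro prod.cong refl)
    fix i assume "i \<in> {..<m}"
    then have "svf_weight t i = 1" "0 < sv A i" using m sv_pos[OF A, of i] by (auto simp: svf_weight_def)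
    then show "sv A i powr svf_weight t i = sv A i" by simp
  qed
  also have "(\<Prod>i\<in>{m<..<CARD('d)}. sv A i powr svf_weight t i) = 1"
  proof (intro prod.neutral ballI)
    fix i assume i: "i \<in> {m<..<CARD('d)}"
    then have "real m + 1 \<le> real i" by auto
    then have "svf_weight t i = 0" using m by (simp add: svf_weight_def)
    then show "sv A i powr svf_weight t i = 1" using i sv_pos[OF A, of i] by simp
  qed
  also have "svf_weight t m = t - real m" using m by (simp add: svf_weight_def)
  finally show ?thesis by simp
qed

lemma svf_eq_prod:
  fixes A :: "real ^ 'd ^ 'd"
  assumes A: "invertible A" and t: "0 \<le> t" "t \<le> real CARD('d)"
  shows "svf t A = (\<Prod>i<CARD('d). sv A i powr svf_weight t i)"
proof (cases "t < CARD('d)")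
  case True
  define m where "m = nat \<lfloor>t\<rfloor>"
  have m: "real m \<le> t" "t \<le> real m + 1" "of_int \<lfloor>t\<rfloor> = real m" using t by (auto simp: m_def)
  have "m < CARD('d)" using m True by linarith
  from prod_svf_weight_split[OF A this m(1,2)] show ?thesis using True m(3) by (simp add: svf_def m_def)
next
  case False
  then have tt: "t = CARD('d)" using t by simp
  have "(\<Prod>i<CARD('d). sv A i powr svf_weight t i) = (\<Prod>i<CARD('d). sv A i)"
    by (intro prod.cong) (auto simp: svf_weight_def min_def max_def tt less_imp_le[OF sv_pos[OF A]])
  moreover have "0 \<le> (\<Prod>i<CARD('d). sv A i)" by (intro prod_nonneg) (use sv_pos[OF A] in force)
  ultimately show ?thesis using False by (simp add: svf_def tt)
qed

lemma svf_split:
  fixes A :: "real ^ 'd ^ 'd"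
  assumes A: "invertible A" and m: "m < CARD('d)" "real m \<le> t" "t \<le> real m + 1"
  shows "svf t A = (\<Prod>i<m. sv A i) * sv A m powr (t - real m)"
proof -
  have "0 \<le> t" "t \<le> real CARD('d)" using m by linarith+
  then show ?thesis using svf_eq_prod[OF A] prod_svf_weight_split[OF A m] by simp
qed

lemma svf_weight_nonneg [simp]: "0 \<le> svf_weight t i" and svf_weight_le_1 [simp]: "svf_weight t i \<le> 1"
  by (auto simp: svf_weight_def)

lemma svf_weight_mono: "s \<le> t \<Longrightarrow> svf_weight s i \<le> svf_weight t i"
  by (auto simp: svf_weight_def)

lemma sum_svf_weight:
  assumes "0 \<le> t" "t \<le> real n"
  shows "(\<Sum>i<n. svf_weight t i) = t"
  using assms(2)
proof (induction n)
  case 0 then show ?case using assms(1) by simp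
next
  case (Suc n)
  show ?case
  proof (cases "t \<le> real n")
    case True then show ?thesis using Suc.IH by (simp add: svf_weight_def)
  next
    case False
    then have "(\<Sum>i<n. svf_weight t i) = (\<Sum>i<n. 1)" by (intro sum.cong) (auto simp: svf_weight_def min_def max_def)
    then show ?thesis using False Suc.prems by (simp add: svf_weight_def)
  qed
qed

lemma svf_pos:
  fixes A :: "real ^ 'd ^ 'd"
  assumes "invertible A" "0 \<le> t" "t \<le> real CARD('d)"
  shows "0 < svf t A"
  unfolding svf_eq_prod[OF assms] by (intro prod_pos) (use sv_pos[OF assms(1)] in force)

text \<open>The exponent vector of \<open>svf t\<close> sums to \<open>t\<close>, which gives all comparisons between
  different exponents.\<close>
lemma svf_mult_le:
  fixes A :: "real ^ 'd ^ 'd"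
  assumes A: "invertible A" and st: "0 \<le> s" "s \<le> t" "t \<le> real CARD('d)" and \<eta>: "onorm ((*v) A) \<le> \<eta>" "\<eta> > 0"
  shows "svf t A \<le> svf s A * \<eta> powr (t - s)"
proof -
  have "svf t A = (\<Prod>i<CARD('d). sv A i powr svf_weight s i * sv A i powr (svf_weight t i - svf_weight s i))"
    using st by (simp add: svf_eq_prod[OF A] powr_add[symmetric])
  also have "\<dots> \<le> (\<Prod>i<CARD('d). sv A i powr svf_weight s i * \<eta> powr (svf_weight t i - svf_weight s i))"
    using sv_le_onorm[of _ A] \<eta>(1) st(2) svf_weight_mono
    by (intro prod_mono) (auto intro!: mult_left_mono powr_mono2 simp: less_imp_le[OF sv_pos[OF A]] intro: order_trans)
  also have "\<dots> = svf s A * (\<Prod>i<CARD('d). \<eta> powr (svf_weight t i - svf_weight s i))"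
    using st by (simp add: svf_eq_prod[OF A] prod.distrib)
  also have "(\<Prod>i<CARD('d). \<eta> powr (svf_weight t i - svf_weight s i)) = \<eta> powr (\<Sum>i<CARD('d). svf_weight t i - svf_weight s i)"
    using \<eta>(2) by (simp add: powr_sum)
  also have "(\<Sum>i<CARD('d). svf_weight t i - svf_weight s i) = t - s"
    using st by (simp add: sum_subtractf sum_svf_weight)
  finally show ?thesis .
qed

lemma svf_ge_powr:
  fixes A :: "real ^ 'd ^ 'd"
  assumes A: "invertible A" and t: "0 \<le> t" "t \<le> real CARD('d)" and k: "k > 0" "\<And>v. norm (A *v v) \<ge> k * norm v"
  shows "k powr t \<le> svf t A"
proof -
  have "k powr t = (\<Prod>i<CARD('d). k powr svf_weight t i)"
    using k(1) sum_svf_weight[OF t] by (simp add: powr_sum[symmetric])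
  also have "\<dots> \<le> svf t A"
    unfolding svf_eq_prod[OF A t] using k by (intro prod_mono) (auto intro!: powr_mono2 sv_ge)
  finally show ?thesis .
qed

text \<open>For x > 0 and w in [0, 1], min 1 x is at most x powr w. Using the weights of t as
  exponents w turns the product into r powr t over \<open>svf t A\<close>, because the weights sum
  to t.\<close>

lemma prod_min_le_svf:
  fixes A :: "real ^ 'd ^ 'd"
  assumes A: "invertible A" and t: "0 \<le> t" "t \<le> real CARD('d)" and r: "r > 0"
  shows "(\<Prod>i<CARD('d). min 1 (r / sv A i)) \<le> r powr t / svf t A"
proof -
  have le: "min 1 x \<le> x powr svf_weight t i" if "x > 0" for x :: real and i
  proof (cases "x \<le> 1")
    case True
    have "x powr 1 \<le> x powr svf_weight t i" using True that by (intro powr_mono') auto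
    then show ?thesis using that True by simp
  next
    case False
    then have "1 \<le> x powr svf_weight t i" by (intro ge_one_powr_ge_zero) auto
    then show ?thesis by simp
  qed
  have "(\<Prod>i<CARD('d). min 1 (r / sv A i)) \<le> (\<Prod>i<CARD('d). (r / sv A i) powr svf_weight t i)"
    using le r sv_pos[OF A] by (intro prod_mono) (auto intro!: le divide_pos_pos simp: less_imp_le)
  also have "\<dots> = (\<Prod>i<CARD('d). r powr svf_weight t i) / svf t A"
    unfolding svf_eq_prod[OF A t] prod_dividef[symmetric]
    using r by (intro prod.cong) (simp_all add: powr_divide sv_pos[OF A, THEN less_imp_le])
  also have "(\<Prod>i<CARD('d). r powr svf_weight t i) = r powr t"
    using r sum_svf_weight[OF t] by (simp add: powr_sum[symmetric])
  finally show ?thesis .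
qed

section \<open>The singular value function as a content\<close>

text \<open>In the singular frame each coordinate of such a y is at most \<rho> by the first
  condition and at most r / \<open>sv A i\<close> by the second. The set therefore lies in an
  orthonormal box, whose volume is controlled by \<open>prod_min_le_svf\<close>.\<close>

lemma emeasure_small_image_le:
  fixes A :: "real ^ 'd ^ 'd"
  assumes A: "invertible A" and s: "0 \<le> s" "s \<le> real CARD('d)" and r: "r > 0" and \<rho>: "\<rho> \<ge> 1"
  shows "emeasure lborel {y. norm y \<le> \<rho> \<and> norm (A *v y) \<le> r} \<le> ennreal ((2 * \<rho>) ^ CARD('d) * (r powr s / svf s A))"
proof -
  define c where "c i = \<rho> * min 1 (r / sv A i)" for i
  have c0: "0 \<le> c i" if "i < CARD('d)" for i using sv_pos[OF A that] r \<rho> by (simp add: c_def)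
  have DIM: "DIM(real^'d) = CARD('d)" by simp
  note box = emeasure_orthonormal_box[of "singular_frame A :: nat \<Rightarrow> real^'d" c, unfolded DIM, OF singular_frame_orthonormal[of _ _ A] c0]
  have "{y. norm y \<le> \<rho> \<and> norm (A *v y) \<le> r} \<subseteq> {y. \<forall>i<CARD('d). \<bar>y \<bullet> singular_frame A i\<bar> \<le> c i}"
  proof safe
    fix y i assume y: "norm y \<le> \<rho>" "norm (A *v y) \<le> r" and i: "i < CARD('d)"
    have "\<bar>y \<bullet> singular_frame A i\<bar> \<le> norm y"
      using Cauchy_Schwarz_ineq2[of y "singular_frame A i"] by (simp add: norm_singular_frame[OF i])
    then have 1: "\<bar>y \<bullet> singular_frame A i\<bar> \<le> \<rho>" using y by simp
    have p: "0 < sv A i" using sv_pos[OF A i] .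
    have "sv A i * \<bar>y \<bullet> singular_frame A i\<bar> \<le> r" using sv_coordinate_le[OF i, of A y] y by simp
    then have "\<bar>y \<bullet> singular_frame A i\<bar> \<le> r / sv A i" using p by (simp add: field_simps)
    also have "\<dots> \<le> \<rho> * (r / sv A i)" using mult_right_mono[OF \<rho>, of "r / sv A i"] p r by simp
    finally show "\<bar>y \<bullet> singular_frame A i\<bar> \<le> c i" using 1 by (simp add: c_def min_def)
  qed
  then have "emeasure lborel {y. norm y \<le> \<rho> \<and> norm (A *v y) \<le> r} \<le> emeasure lborel {y. \<forall>i<CARD('d). \<bar>y \<bullet> singular_frame A i\<bar> \<le> c i}"
    by (intro emeasure_mono) (use box(1) in auto)
  also have "\<dots> = ennreal (\<Prod>i<CARD('d). 2 * c i)" by (rule box(2))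
  also have "(\<Prod>i<CARD('d). 2 * c i) = (2 * \<rho>) ^ CARD('d) * (\<Prod>i<CARD('d). min 1 (r / sv A i))"
    by (simp add: c_def prod.distrib power_mult_distrib mult.assoc)
  also have "ennreal \<dots> \<le> ennreal ((2 * \<rho>) ^ CARD('d) * (r powr s / svf s A))"
    using \<rho> by (intro ennreal_leI mult_left_mono prod_min_le_svf A s r) auto
  finally show ?thesis .
qed

lemma closed_small_image: 
  fixes A :: "real ^ 'd ^ 'd"
  shows "closed {y. norm y \<le> \<rho> \<and> norm (A *v y) \<le> r}"
  by (intro closed_Collect_conj closed_Collect_le continuous_intros matrix_vector_mult_linear_continuous_on)

text \<open>Subtracting one point of the set centres it at the origin and doubles both radii. This
  is the source of the 4 and of the 2 r.\<close>

lemma emeasure_ball_image_le: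
  fixes A :: "real ^ 'd ^ 'd"
  assumes A: "invertible A" and s: "0 \<le> s" "s \<le> real CARD('d)" and r: "r > 0"
  shows "emeasure lborel {y. norm y \<le> 1 \<and> norm (A *v y - x) \<le> r} \<le> ennreal (4 ^ CARD('d) * ((2 * r) powr s / svf s A))"
    (is "emeasure lborel ?S \<le> _")
proof (cases "?S = {}")
  case False
  then obtain z where z: "norm z \<le> 1" "norm (A *v z - x) \<le> r" by blast
  let ?T = "{y. norm y \<le> 2 \<and> norm (A *v y) \<le> 2 * r}"
  have "?S \<subseteq> {y. y - z \<in> ?T}"
  proof safe
    fix y assume y: "norm y \<le> 1" "norm (A *v y - x) \<le> r"
    show "norm (y - z) \<le> 2" using norm_triangle_ineq4[of y z] y z by simp
    have "A *v (y - z) = (A *v y - x) - (A *v z - x)" by (simp add: matrix_vector_mult_diff_distrib)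
    then show "norm (A *v (y - z)) \<le> 2 * r" using norm_triangle_ineq4[of "A *v y - x" "A *v z - x"] y z by simp
  qed
  moreover have T: "?T \<in> sets borel" using closed_small_image by (rule borel_closed)
  moreover have "linear (\<lambda>v::real^'d. v)" by (rule linearI) simp_all
  from emeasure_expanding_vimage_le[OF this, of 1 ?T "-z"] T
  have "emeasure lborel {y. y - z \<in> ?T} \<le> emeasure lborel ?T" by (simp only: diff_conv_add_uminus) simp
  moreover have "(\<lambda>y. y - z) -` ?T \<inter> space borel \<in> sets borel" using T by (intro measurable_sets[of _ borel borel]) simp_all
  then have "{y. y - z \<in> ?T} \<in> sets lborel" by (simp only: vimage_def sets_lborel space_borel Int_UNIV_right)
  ultimately have "emeasure lborel ?S \<le> emeasure lborel ?T"
    using emeasure_mono[of ?S "{y. y - z \<in> ?T}" lborel] by (meson order_trans)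
  also have "\<dots> \<le> ennreal (4 ^ CARD('d) * ((2 * r) powr s / svf s A))"
    using emeasure_small_image_le[OF A s, of "2 * r" 2] r by simp
  finally show ?thesis .
next
  case True
  then show ?thesis unfolding True by simp
qed

text \<open>A volume count in the domain: one ball of radius r accounts for only a small part of the
  unit ball, so many balls are required. Together with \<open>ellipsoid_cover\<close> it identifies
  \<open>svf s A\<close> with the content of the ellipsoid for covers by equal balls, up to
  constants.\<close>

lemma svf_le_cover:
  fixes A :: "real ^ 'd ^ 'd"
  assumes A: "invertible A" and s: "0 \<le> s" "s \<le> real CARD('d)" and r: "r > 0"
    and X: "finite X" "(*v) A ` cball 0 1 \<subseteq> (\<Union>x\<in>X. cball x r)"
  shows "svf s A \<le> 4 ^ CARD('d) * 2 powr s / unit_ball_vol CARD('d) * (real (card X) * r powr s)"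
proof -
  let ?S = "\<lambda>x. {y. norm y \<le> 1 \<and> norm (A *v y - x) \<le> r}"
  define q where "q = 4 ^ CARD('d) * ((2 * r) powr s / svf s A)"
  have q0: "0 \<le> q" using svf_pos[OF A s] by (simp add: q_def)
  have Sb: "?S x \<in> sets borel" for x
    by (intro borel_closed closed_Collect_conj closed_Collect_le continuous_intros matrix_vector_mult_linear_continuous_on)
  have "cball 0 1 \<subseteq> (\<Union>x\<in>X. ?S x)"
  proof
    fix y :: "real^'d" assume y: "y \<in> cball 0 1"
    then obtain x where "x \<in> X" "A *v y \<in> cball x r" using X(2) by blast
    then show "y \<in> (\<Union>x\<in>X. ?S x)" using y by (auto simp: dist_norm norm_minus_commute)
  qed
  then have "emeasure lborel (cball (0::real^'d) 1) \<le> emeasure lborel (\<Union>x\<in>X. ?S x)"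
    using X(1) Sb by (intro emeasure_mono) auto
  also have "\<dots> \<le> (\<Sum>x\<in>X. emeasure lborel (?S x))"
    using X(1) Sb by (intro emeasure_subadditive_finite) auto
  also have "\<dots> \<le> (\<Sum>x\<in>X. ennreal q)"
    unfolding q_def by (intro sum_mono emeasure_ball_image_le A s r)
  also have "\<dots> = ennreal (real (card X) * q)"
    using q0 by (simp add: ennreal_mult ennreal_of_nat_eq_real_of_nat)
  finally have "unit_ball_vol CARD('d) \<le> real (card X) * q"
    using q0 by (simp add: emeasure_cball)
  then show ?thesis
    using svf_pos[OF A s] unit_ball_vol_pos[of "CARD('d)"] r by (simp add: q_def field_simps powr_mult)
qed

lemma coordinate_grid:
  fixes c :: real
  assumes c: "\<bar>c\<bar> \<le> 1" and n: "n > 0"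
  shows "\<exists>k\<le>n::nat. \<bar>c - (-1 + 2 * real k / real n)\<bar> \<le> 2 / real n"
proof -
  define z where "z = (c + 1) / 2 * real n"
  define k where "k = nat \<lfloor>z\<rfloor>"
  have "0 \<le> z" using c by (simp add: z_def)
  then have "real k = of_int \<lfloor>z\<rfloor>" by (simp add: k_def)
  then have le: "real k \<le> z" "z < real k + 1" by linarith+
  have "z \<le> 1 * real n" unfolding z_def using c by (intro mult_right_mono) auto
  then have "k \<le> n" using le by linarith
  moreover have "\<bar>c - (-1 + 2 * real k / real n)\<bar> \<le> 2 / real n"
  proof -
    have "c - (-1 + 2 * real k / real n) = 2 / real n * (z - real k)"
      using n by (simp add: z_def field_simps)
    then have "\<bar>c - (-1 + 2 * real k / real n)\<bar> = 2 / real n * \<bar>z - real k\<bar>"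
      by (simp only: abs_mult abs_divide abs_numeral abs_of_nat)
    also have "\<dots> \<le> 2 / real n * 1" using le by (intro mult_left_mono) auto
    finally show ?thesis by simp
  qed
  ultimately show ?thesis by blast
qed

text \<open>The balls have radius comparable to one singular value \<sigma>. An axis longer than
  \<sigma> is cut into about \<open>sv A i\<close> / \<sigma> pieces and a shorter one is
  essentially left whole, so the number of balls times \<sigma> powr t is of the order of
  \<open>svf t A\<close>.\<close>

lemma ellipsoid_cover:
  fixes A :: "real ^ 'd ^ 'd"
  assumes A: "invertible A" and t: "0 < t" "t \<le> real CARD('d)"
  shows "\<exists>X r. finite X \<and> 0 < r \<and> r \<le> 2 * real CARD('d) * onorm ((*v) A) \<and> (*v) A ` cball 0 1 \<subseteq> (\<Union>x\<in>X. cball x r)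
     \<and> real (card X) * r powr t \<le> 3 ^ CARD('d) * (2 * real CARD('d)) powr t * svf t A"
proof -
  \<comment> \<open>The ceiling minus 1 replaces the floor: it is strictly below t, hence a valid
    index even for t = d.\<close>
  define m where "m = nat (\<lceil>t\<rceil> - 1)"
  have m: "real m \<le> t" "t \<le> real m + 1" "real m < t" using t(1) unfolding m_def by linarith+
  have md: "m < CARD('d)" using m(3) t(2) by linarith
  define \<sigma> where "\<sigma> = sv A m"
  have \<sigma>0: "0 < \<sigma>" using sv_pos[OF A md] by (simp add: \<sigma>_def)
  define n where "n i = nat \<lceil>sv A i / \<sigma>\<rceil>" for i
  have p: "0 < sv A i" if "i < CARD('d)" for i using sv_pos[OF A that] .
  have n: "0 < n i" "sv A i / \<sigma> \<le> real (n i)" "real (n i) \<le> sv A i / \<sigma> + 1" if "i < CARD('d)" for i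
  proof -
    have "0 < sv A i / \<sigma>" using p[OF that] \<sigma>0 by simp
    then show "0 < n i" "sv A i / \<sigma> \<le> real (n i)" "real (n i) \<le> sv A i / \<sigma> + 1" unfolding n_def by linarith+
  qed
  let ?P = "PiE {..<CARD('d)} (\<lambda>i. {..n i})"
  define pt where "pt k = (\<Sum>i<CARD('d). (-1 + 2 * real (k i) / real (n i)) *\<^sub>R (A *v singular_frame A i))" for k :: "nat \<Rightarrow> nat"
  let ?r = "2 * real CARD('d) * \<sigma>"
  have cover: "\<exists>k\<in>?P. norm (A *v y - pt k) \<le> ?r" if y: "norm y \<le> 1" for y
  proof -
    have "\<exists>k\<le>n i. \<bar>y \<bullet> singular_frame A i - (-1 + 2 * real k / real (n i))\<bar> \<le> 2 / real (n i)" if i: "i < CARD('d)" for i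
    proof (rule coordinate_grid)
      show "\<bar>y \<bullet> singular_frame A i\<bar> \<le> 1"
        using Cauchy_Schwarz_ineq2[of y "singular_frame A i"] y by (simp add: norm_singular_frame[OF i])
    qed (use n[OF i] in auto)
    then obtain k where k: "\<And>i. i < CARD('d) \<Longrightarrow> k i \<le> n i \<and> \<bar>y \<bullet> singular_frame A i - (-1 + 2 * real (k i) / real (n i))\<bar> \<le> 2 / real (n i)"
      by metis
    define k' where "k' = restrict k {..<CARD('d)}"
    have "k' \<in> ?P" using k by (auto simp: k'_def)
    moreover have "norm (A *v y - pt k') \<le> ?r"
    proof -
      have "A *v y - pt k' = (\<Sum>i<CARD('d). (y \<bullet> singular_frame A i - (-1 + 2 * real (k i) / real (n i))) *\<^sub>R (A *v singular_frame A i))"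
        unfolding matrix_singular_expand[of A y] pt_def sum_subtractf[symmetric] k'_def
        by (intro sum.cong) (auto simp: scaleR_diff_left)
      also have "norm \<dots> \<le> (\<Sum>i<CARD('d). \<bar>y \<bullet> singular_frame A i - (-1 + 2 * real (k i) / real (n i))\<bar> * sv A i)"
        by (rule sum_norm_le) (auto simp: norm_singular_frame_image)
      also have "\<dots> \<le> (\<Sum>i<CARD('d). 2 * \<sigma>)"
      proof (rule sum_mono)
        fix i assume "i \<in> {..<CARD('d)}"
        then have i: "i < CARD('d)" by simp
        have "\<bar>y \<bullet> singular_frame A i - (-1 + 2 * real (k i) / real (n i))\<bar> * sv A i \<le> 2 / real (n i) * sv A i"
          using k[OF i] p[OF i] by (intro mult_right_mono) auto
        also have "\<dots> \<le> 2 * \<sigma>" using n[OF i] \<sigma>0 by (simp add: field_simps)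
        finally show "\<bar>y \<bullet> singular_frame A i - (-1 + 2 * real (k i) / real (n i))\<bar> * sv A i \<le> 2 * \<sigma>" .
      qed
      also have "\<dots> = ?r" by simp
      finally show ?thesis .
    qed
    ultimately show ?thesis by blast
  qed
  have "real (card (pt ` ?P)) \<le> real (card ?P)"
    by (simp add: card_image_le finite_PiE)
  also have "\<dots> = (\<Prod>i<CARD('d). real (n i) + 1)" by (simp add: card_PiE add.commute)
  \<comment> \<open>A long axis has at most \<open>sv A i\<close> / \<sigma> + 2 grid points, and
    this ratio is at least 1; any other axis has at most 2. Both cases fit under the factor
    3.\<close>
  also have "\<dots> \<le> (\<Prod>i<CARD('d). 3 * (if i < m then sv A i / \<sigma> else 1))"
  proof (rule prod_mono)
    fix i assume "i \<in> {..<CARD('d)}"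
    then have i: "i < CARD('d)" by simp
    have "1 \<le> sv A i / \<sigma>" if "i < m" using sv_antimono[of i m A] that md \<sigma>0 by (simp add: \<sigma>_def)
    moreover have "n i \<le> 1" if "\<not> i < m"
    proof -
      have "sv A i / \<sigma> \<le> 1" using sv_antimono[of m i A] that i \<sigma>0 by (simp add: \<sigma>_def)
      then have "\<lceil>sv A i / \<sigma>\<rceil> \<le> 1" by (simp add: ceiling_le_iff)
      then show ?thesis by (simp add: n_def)
    qed
    ultimately show "0 \<le> real (n i) + 1 \<and> real (n i) + 1 \<le> 3 * (if i < m then sv A i / \<sigma> else 1)"
      using n[OF i] by (cases "i < m") auto
  qed
  also have "\<dots> = 3 ^ CARD('d) * (\<Prod>i<CARD('d). if i < m then sv A i / \<sigma> else 1)"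
    by (simp add: prod.distrib)
  also have "(\<Prod>i<CARD('d). if i < m then sv A i / \<sigma> else 1) = (\<Prod>i<m. sv A i / \<sigma>)"
    using md by (intro prod.mono_neutral_cong_right) auto
  also have "\<dots> = (\<Prod>i<m. sv A i) / \<sigma> ^ m" by (simp add: prod_dividef)
  finally have card: "real (card (pt ` ?P)) \<le> 3 ^ CARD('d) * ((\<Prod>i<m. sv A i) / \<sigma> ^ m)" .
  have "real (card (pt ` ?P)) * ?r powr t \<le> 3 ^ CARD('d) * ((\<Prod>i<m. sv A i) / \<sigma> ^ m) * ?r powr t"
    by (intro mult_right_mono card) auto
  also have "\<dots> = 3 ^ CARD('d) * (2 * real CARD('d)) powr t * ((\<Prod>i<m. sv A i) * (\<sigma> powr t / \<sigma> powr m))"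
    using \<sigma>0 by (simp add: powr_mult powr_realpow)
  also have "(\<Prod>i<m. sv A i) * (\<sigma> powr t / \<sigma> powr m) = svf t A"
    using svf_split[OF A md m(1,2)] by (simp add: powr_diff \<sigma>_def)
  finally have fin: "real (card (pt ` ?P)) * ?r powr t \<le> 3 ^ CARD('d) * (2 * real CARD('d)) powr t * svf t A" .
  show ?thesis
  proof (intro exI[of _ "pt ` ?P"] exI[of _ ?r] conjI fin)
    show "finite (pt ` ?P)" by (intro finite_imageI finite_PiE) auto
    show "0 < ?r" using \<sigma>0 by simp
    show "?r \<le> 2 * real CARD('d) * onorm ((*v) A)" using sv_le_onorm[OF md, of A] by (simp add: \<sigma>_def)
    show "(*v) A ` cball 0 1 \<subseteq> (\<Union>x\<in>pt ` ?P. cball x ?r)"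
    proof clarify
      fix y :: "real^'d" assume "y \<in> cball 0 1"
      then obtain k where "k \<in> ?P" "norm (A *v y - pt k) \<le> ?r" using cover[of y] by auto
      then show "A *v y \<in> (\<Union>x\<in>pt ` ?P. cball x ?r)"
        by (intro UN_I[of "pt k"]) (auto simp: dist_norm norm_minus_commute)
    qed
  qed
qed

text \<open>Up to constants \<open>svf t A\<close> is the \<open>t\<close>-dimensional content of the ellipsoid \<open>A ` cball 0 1\<close>, and
  contents of composed maps are submultiplicative. This avoids exterior powers.\<close>
lemma svf_submultiplicative:
  assumes t: "0 < t" "t \<le> real CARD('d)"
  shows "\<exists>C\<ge>1. \<forall>A B :: real ^ 'd ^ 'd. invertible A \<longrightarrow> invertible B \<longrightarrow> svf t (A ** B) \<le> C * svf t A * svf t B"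
proof -
  define K where "K = 3 ^ CARD('d) * (2 * real CARD('d)) powr t"
  define K' where "K' = 4 ^ CARD('d) * 2 powr t / unit_ball_vol CARD('d)"
  have K: "0 \<le> K" "0 \<le> K'" unfolding K_def K'_def using unit_ball_vol_pos[of "CARD('d)"] by auto
  have "svf t (A ** B) \<le> max 1 (K' * K * K) * svf t A * svf t B" if AB: "invertible A" "invertible B" for A B :: "real^'d^'d"
  proof -
    obtain X r where X: "finite X" "0 < r" "(*v) A ` cball 0 1 \<subseteq> (\<Union>x\<in>X. cball x r)" "real (card X) * r powr t \<le> K * svf t A"
      using ellipsoid_cover[OF AB(1) t] unfolding K_def by blast
    obtain Y q where Y: "finite Y" "0 < q" "(*v) B ` cball 0 1 \<subseteq> (\<Union>x\<in>Y. cball x q)" "real (card Y) * q powr t \<le> K * svf t B"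
      using ellipsoid_cover[OF AB(2) t] unfolding K_def by blast
    \<comment> \<open>A maps a ball of radius q about y to a translate of q times its own ellipsoid.
      The cover of that ellipsoid, scaled by q, therefore covers the image with balls of radius r
      q.\<close>
    let ?Z = "(\<lambda>(x, y). A *v y + q *\<^sub>R x) ` (X \<times> Y)"
    have "(*v) (A ** B) ` cball 0 1 \<subseteq> (\<Union>z\<in>?Z. cball z (r * q))"
    proof clarify
      fix v :: "real^'d" assume "v \<in> cball 0 1"
      then obtain y where y: "y \<in> Y" "dist y (B *v v) \<le> q" using Y(3) by fastforce
      define w where "w = (1/q) *\<^sub>R (B *v v - y)"
      have "norm w \<le> 1" using y(2) Y(2) by (simp add: w_def dist_norm norm_minus_commute)
      then have "w \<in> cball 0 1" by simp
      then obtain x where x: "x \<in> X" "dist x (A *v w) \<le> r" using X(3) by fastforce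
      have "(A ** B) *v v = A *v y + q *\<^sub>R (A *v w)"
        using Y(2) by (simp add: w_def matrix_vector_mult_scaleR matrix_vector_mult_diff_distrib matrix_vector_mul_assoc)
      then have "dist (A *v y + q *\<^sub>R x) ((A ** B) *v v) = q * dist x (A *v w)"
        using Y(2) by (simp add: dist_norm flip: scaleR_diff_right)
      also have "\<dots> \<le> r * q" using x(2) Y(2) by simp
      finally show "(A ** B) *v v \<in> (\<Union>z\<in>?Z. cball z (r * q))"
        using x y by (intro UN_I[of "A *v y + q *\<^sub>R x"]) auto
    qed
    then have "svf t (A ** B) \<le> K' * (real (card ?Z) * (r * q) powr t)"
      unfolding K'_def using svf_le_cover[of "A ** B" t "r * q" ?Z] AB t X Y by (simp add: invertible_mult)
    also have "\<dots> \<le> K' * ((real (card X) * real (card Y)) * (r * q) powr t)"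
    proof -
      have "card ?Z \<le> card X * card Y" using X Y by (metis card_cartesian_product card_image_le finite_cartesian_product)
      then have "real (card ?Z) \<le> real (card X) * real (card Y)" by (metis of_nat_le_iff of_nat_mult)
      then show ?thesis using K by (intro mult_left_mono mult_right_mono) auto
    qed
    also have "\<dots> = K' * ((real (card X) * r powr t) * (real (card Y) * q powr t))"
      using X Y by (simp add: powr_mult)
    also have "\<dots> \<le> K' * ((K * svf t A) * (K * svf t B))"
      using K svf_pos[OF AB(1), of t] t by (intro mult_left_mono mult_mono[OF X(4) Y(4)]) auto
    also have "\<dots> = (K' * K * K) * (svf t A * svf t B)" by simp
    also have "\<dots> \<le> max 1 (K' * K * K) * (svf t A * svf t B)"
      using svf_pos[OF AB(1), of t] svf_pos[OF AB(2), of t] t by (intro mult_right_mono) auto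
    finally show ?thesis by (simp add: mult.assoc)
  qed
  then show ?thesis by (intro exI[of _ "max 1 (K' * K * K)"]) auto
qed

section \<open>Pressure\<close>

text \<open>Fekete's lemma: the limit is the infimum of the quotients. The linear lower bound keeps
  this infimum finite.\<close>

lemma subadditive_convergent:
  fixes a :: "nat \<Rightarrow> real"
  assumes sub: "\<And>m n. a (m + n) \<le> a m + a n" and bdd: "\<And>n. - K * real n \<le> a n"
  shows "convergent (\<lambda>n. a n / real n)"
proof -
  define L where "L = (INF n\<in>{1..}. a n / real n)"
  have bb: "bdd_below ((\<lambda>n. a n / real n) ` {1..})"
  proof (rule bdd_belowI2)
    fix n :: nat assume "n \<in> {1..}"
    then show "- K \<le> a n / real n" using bdd[of n] by (simp add: field_simps)
  qed
  have lower: "L \<le> a n / real n" if "n \<ge> 1" for n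
    unfolding L_def using that by (intro cINF_lower[OF bb]) auto
  have mult: "a (q * m + r) \<le> real q * a m + a r" for q m r
  proof (induction q)
    case (Suc q)
    have "a (Suc q * m + r) \<le> a m + a (q * m + r)" using sub[of m "q * m + r"] by (simp add: add.assoc)
    then show ?case using Suc.IH by (simp add: algebra_simps)
  qed simp
  have "(\<lambda>n. a n / real n) \<longlonglongrightarrow> L"
  proof (rule LIMSEQ_I)
    fix e :: real assume e: "e > 0"
    then have "\<exists>n\<in>{1..}. a n / real n < L + e / 2"
      using cINF_less_iff[OF _ bb, of "L + e/2"] by (auto simp: L_def)
    then obtain m where m: "m \<ge> 1" "a m / real m < L + e / 2" by auto
    \<comment> \<open>Bounds the contribution of the remainder n mod m uniformly; it disappears
      after division by n.\<close>
    define B where "B = (\<Sum>r<m. \<bar>a r\<bar>)"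
    have B: "a r \<le> B" if "r < m" for r
      unfolding B_def using member_le_sum[of r "{..<m}" "\<lambda>r. \<bar>a r\<bar>"] that by simp
    obtain N :: nat where N: "real N > 2 * (\<bar>a m\<bar> + B) / e" using reals_Archimedean2 by blast
    have "norm (a n / real n - L) < e" if n: "n \<ge> max 1 N" for n
    proof -
      have n1: "n \<ge> 1" "real n > 0" using n by auto
      have eq: "real (n div m) = (real n - real (n mod m)) / real m"
        using m(1) by (metis div_mult_mod_eq add_diff_cancel_right' nonzero_mult_div_cancel_right of_nat_add of_nat_eq_0_iff of_nat_mult not_one_le_zero)
      have "a n \<le> real (n div m) * a m + a (n mod m)"
        using mult[of "n div m" m "n mod m"] by simp
      also have "real (n div m) * a m = real n * (a m / real m) - (real (n mod m) / real m) * a m"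
        using m(1) unfolding eq by (simp add: field_simps)
      finally have 1: "a n \<le> real n * (a m / real m) - (real (n mod m) / real m) * a m + a (n mod m)" .
      have "- ((real (n mod m) / real m) * a m) \<le> 1 * \<bar>a m\<bar>"
      proof -
        have "\<bar>(real (n mod m) / real m) * a m\<bar> \<le> 1 * \<bar>a m\<bar>"
          unfolding abs_mult using m(1) by (intro mult_right_mono) (auto simp: less_imp_le)
        then show ?thesis by linarith
      qed
      moreover have "a (n mod m) \<le> B" using m(1) by (intro B) simp
      ultimately have "a n \<le> real n * (a m / real m) + (\<bar>a m\<bar> + B)" using 1 by linarith
      then have "a n / real n \<le> a m / real m + (\<bar>a m\<bar> + B) / real n" using n1 by (simp add: field_simps)
      also have "(\<bar>a m\<bar> + B) / real n < e / 2"
      proof -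
        have "real n > 2 * (\<bar>a m\<bar> + B) / e" using N n by (smt (verit) max.boundedE of_nat_le_iff)
        then show ?thesis using e n1 by (simp add: field_simps)
      qed
      finally have "a n / real n < L + e" using m(2) by simp
      then show ?thesis using lower[OF n1(1)] by simp
    qed
    then show "\<exists>no. \<forall>n\<ge>no. norm (a n / real n - L) < e" by blast
  qed
  then show ?thesis by (rule convergentI)
qed

lemma svf_0: 
  fixes A :: "real ^ 'd ^ 'd"
  assumes "invertible A" shows "svf 0 A = 1"
proof -
  have "(\<Prod>i<CARD('d). sv A i powr svf_weight 0 i) = 1"
    using sv_pos[OF assms] by (intro prod.neutral) (force simp: svf_weight_def)
  then show ?thesis by (subst svf_eq_prod[OF assms]) auto
qed

lemma invertible_mat_1: "invertible (mat 1 :: real ^ 'd ^ 'd)"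
  unfolding invertible_def by (rule exI[of _ "mat 1"]) simp

section \<open>Matrix products along words and their partition sums\<close>

locale contracting_matrices =
  fixes A :: "'n::finite \<Rightarrow> real ^ 'd ^ 'd" and \<eta> :: real
  assumes inv: "\<And>i. invertible (A i)"
    and onorm_le: "\<And>i. onorm ((*v) (A i)) \<le> \<eta>"
    and eta: "0 < \<eta>" "\<eta> < 1 / 2"
begin

abbreviation W :: "'n list \<Rightarrow> real ^ 'd ^ 'd" where "W \<equiv> word_matrix A"
abbreviation \<phi> :: "real \<Rightarrow> 'n list \<Rightarrow> real" where "\<phi> t w \<equiv> svf t (W w)"
definition Z :: "real \<Rightarrow> nat \<Rightarrow> real" where "Z t n = (\<Sum>w\<in>{w. length w = n}. \<phi> t w)"

lemma W_simps [simp]: "W [] = mat 1" "W (i # w) = A i ** W w"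
  by (auto simp: word_matrix_def)

lemma W_append: "W (u @ v) = W u ** W v"
  by (induction u) (auto simp: matrix_mul_assoc)

lemma inv_W: "invertible (W w)"
  by (induction w) (auto simp: inv invertible_mult invertible_mat_1)

lemma norm_A_le: "norm (A i *v v) \<le> \<eta> * norm v"
  using onorm[OF matrix_vector_mul_bounded_linear, of "A i" v] onorm_le[of i]
  by (meson mult_right_mono norm_ge_zero order_trans)

lemma norm_W_le: "norm (W w *v v) \<le> \<eta> ^ length w * norm v"
proof (induction w)
  case (Cons i w)
  have "norm (W (i # w) *v v) \<le> \<eta> * norm (W w *v v)"
    using norm_A_le[of i "W w *v v"] by (simp add: matrix_vector_mul_assoc)
  also have "\<dots> \<le> \<eta> * (\<eta> ^ length w * norm v)" using Cons.IH eta by (intro mult_left_mono) auto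
  finally show ?case by simp
qed simp

lemma onorm_W_le: "onorm ((*v) (W w)) \<le> \<eta> ^ length w"
  by (rule onorm_bound) (use norm_W_le eta in auto)

text \<open>Finitely many invertible matrices contract at most at a common exponential rate. This
  keeps \<open>Z t n\<close> from decaying faster than exponentially, so the pressure is a real
  number.\<close>

lemma lower_contraction: "\<exists>\<delta>>0. \<delta> \<le> 1 \<and> (\<forall>w v. norm (W w *v v) \<ge> \<delta> ^ length w * norm v)"
proof -
  obtain B where B: "\<And>i. B i ** A i = mat 1" using inv unfolding invertible_def by metis
  define g where "g i = 1 / (onorm ((*v) (B i)) + 1)" for i
  have o: "0 \<le> onorm ((*v) (B i))" for i by (intro onorm_pos_le matrix_vector_mul_bounded_linear)
  have g0: "0 < g i" for i using o[of i] by (simp add: g_def)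
  have g: "norm (A i *v v) \<ge> g i * norm v" for i v
  proof -
    have "v = B i *v (A i *v v)"
      by (simp add: matrix_vector_mul_assoc B)
    then have "norm v \<le> onorm ((*v) (B i)) * norm (A i *v v)"
      using onorm[OF matrix_vector_mul_bounded_linear, of "B i" "A i *v v"] by simp
    also have "\<dots> \<le> (onorm ((*v) (B i)) + 1) * norm (A i *v v)" by (intro mult_right_mono) auto
    finally show ?thesis using o[of i] by (simp add: g_def field_simps)
  qed
  define \<delta> where "\<delta> = min 1 (Min (range g))"
  have d: "0 < \<delta>" "\<delta> \<le> 1" "\<delta> \<le> g i" for i
    using g0 by (auto simp: \<delta>_def min_le_iff_disj)
  have "norm (W w *v v) \<ge> \<delta> ^ length w * norm v" for w v
  proof (induction w)
    case (Cons i w)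
    have "\<delta> * (\<delta> ^ length w * norm v) \<le> g i * norm (W w *v v)"
      using Cons.IH d g0[of i] by (intro mult_mono) (auto simp: less_imp_le)
    also have "\<dots> \<le> norm (W (i # w) *v v)" using g[of i "W w *v v"] by (simp add: matrix_vector_mul_assoc)
    finally show ?case by simp
  qed simp
  then show ?thesis using d by blast
qed

context
  fixes t :: real
  assumes t: "0 < t" "t \<le> real CARD('d)"
begin

lemma \<phi>_pos: "0 < \<phi> t w" using svf_pos[OF inv_W] t by simp

lemma \<phi>_nonneg: "0 \<le> \<phi> t w" using \<phi>_pos[of w] by simp

lemma \<phi>_mult_le:
  assumes "0 \<le> s" "s \<le> t"
  shows "\<phi> t w \<le> \<phi> s w * (\<eta> ^ length w) powr (t - s)"
  using svf_mult_le[OF inv_W assms t(2) onorm_W_le] eta by simp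

lemma \<phi>_antimono:
  assumes "0 \<le> s" "s \<le> t"
  shows "\<phi> t w \<le> \<phi> s w"
proof -
  have "(\<eta> ^ length w) powr (t - s) \<le> 1" using eta assms by (intro powr_le1) (auto intro: power_le_one)
  then show ?thesis using \<phi>_mult_le[OF assms, of w] mult_left_mono[of _ 1 "\<phi> s w"] svf_pos[OF inv_W, of s w] assms t
    by (smt (verit) mult_cancel_left2)
qed

lemma \<phi>_le_1: "\<phi> t w \<le> 1"
  using \<phi>_antimono[of 0 w] t by (simp add: svf_0 inv_W)

lemma \<phi>_Nil: "\<phi> t [] = 1"
proof -
  have "1 powr t \<le> svf t (mat 1 :: real^'d^'d)" by (rule svf_ge_powr) (use t in \<open>auto simp: invertible_mat_1\<close>)
  then show ?thesis using \<phi>_le_1[of "[]"] by simp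
qed

lemma \<phi>_append_bound: "\<exists>C\<ge>1. \<forall>u v. \<phi> t (u @ v) \<le> C * \<phi> t u * \<phi> t v"
  using svf_submultiplicative[OF t] inv_W by (metis W_append)

definition subC :: real where "subC = (SOME C. C \<ge> 1 \<and> (\<forall>u v. \<phi> t (u @ v) \<le> C * \<phi> t u * \<phi> t v))"

lemma subC: "subC \<ge> 1" "\<phi> t (u @ v) \<le> subC * \<phi> t u * \<phi> t v"
  using someI_ex[OF \<phi>_append_bound[unfolded Bex_def]] unfolding subC_def by blast+

text \<open>Extending a word can raise \<open>\<phi>\<close> by at most a constant factor. So a
  lower bound known for a longer word passes to all its prefixes, in particular to the common prefix
  of two points.\<close>

lemma \<phi>_append_le: "\<phi> t (u @ v) \<le> subC * \<phi> t u"
proof -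
  have "subC * \<phi> t u * \<phi> t v \<le> subC * \<phi> t u * 1"
    using subC(1) \<phi>_nonneg[of u] \<phi>_le_1[of v] by (intro mult_left_mono) auto
  then show ?thesis using subC(2)[of u v] by simp
qed

lemma finite_words: "finite {w :: 'n list. length w = n}"
  using finite_lists_length_eq[of "UNIV :: 'n set" n] by simp

lemma Z_pos: "0 < Z t n"
  unfolding Z_def using finite_words \<phi>_pos
  by (intro sum_pos) (auto intro!: exI[of _ "replicate n undefined"])

lemma sum_words_append:
  fixes f :: "'n list \<Rightarrow> real"
  shows "(\<Sum>w | length w = m + n. f w) = (\<Sum>u | length u = m. \<Sum>v | length v = n. f (u @ v))"
proof -
  have "(\<Sum>u | length u = m. \<Sum>v | length v = n. f (u @ v)) = (\<Sum>(u, v)\<in>{u. length u = m} \<times> {v. length v = n}. f (u @ v))"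
    by (simp add: sum.cartesian_product)
  also have "\<dots> = (\<Sum>w | length w = m + n. f w)"
    by (rule sum.reindex_bij_witness[where j="\<lambda>(u, v). u @ v" and i="\<lambda>w. (take m w, drop m w)"]) auto
  finally show ?thesis ..
qed

lemma Z_add_le: "Z t (m + n) \<le> subC * Z t m * Z t n"
proof -
  have "Z t (m + n) \<le> (\<Sum>u | length u = m. \<Sum>v | length v = n. subC * \<phi> t u * \<phi> t v)"
    unfolding Z_def sum_words_append by (intro sum_mono subC)
  also have "\<dots> = subC * Z t m * Z t n"
    unfolding Z_def sum_distrib_left sum_distrib_right by (rule sum.swap)
  finally show ?thesis .
qed

text \<open>The constant of submultiplicativity is absorbed into the sequence to make its logarithm
  subadditive, and vanishes in the limit. The \<open>lim\<close> in the definition of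
  \<open>pressure\<close> is thus a genuine limit.\<close>

lemma pressure_LIMSEQ: "(\<lambda>n. ln (Z t n) / real n) \<longlonglongrightarrow> pressure A t"
proof -
  obtain \<delta> where d: "0 < \<delta>" "\<delta> \<le> 1" "\<And>w v. norm (W w *v v) \<ge> \<delta> ^ length w * norm v" using lower_contraction by blast
  define a where "a n = ln (subC * Z t n)" for n
  have sc: "subC > 0" using subC(1) by simp
  have "convergent (\<lambda>n. a n / real n)"
  proof (rule subadditive_convergent)
    fix m n
    have "subC * Z t (m + n) \<le> (subC * Z t m) * (subC * Z t n)" using Z_add_le[of m n] sc by (simp add: mult.assoc mult.left_commute)
    then have "a (m + n) \<le> ln ((subC * Z t m) * (subC * Z t n))" unfolding a_def using sc Z_pos by (intro ln_mono) auto
    then show "a (m + n) \<le> a m + a n" unfolding a_def using sc Z_pos by (simp add: ln_mult_pos)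
  next
    fix n
    \<comment> \<open>A single word is enough for a lower bound of the sum; \<open>undefined\<close>
      is just some letter.\<close>
    have "(\<delta> ^ n) powr t \<le> \<phi> t (replicate n undefined)"
      using svf_ge_powr[OF inv_W, of t "\<delta> ^ n"] d t by (metis length_replicate less_imp_le zero_less_power)
    also have "\<dots> \<le> Z t n"
      unfolding Z_def by (rule member_le_sum) (auto simp: \<phi>_nonneg finite_words)
    also have "Z t n \<le> subC * Z t n" using subC(1) Z_pos[of n] by simp
    finally have "ln ((\<delta> ^ n) powr t) \<le> a n" unfolding a_def using d(1) sc Z_pos by (intro ln_mono) auto
    then show "- (- (t * ln \<delta>)) * real n \<le> a n" using d(1) by (simp add: ln_powr ln_realpow mult_ac)
  qed
  then obtain L where L: "(\<lambda>n. a n / real n) \<longlonglongrightarrow> L" by (auto simp: convergent_def)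
  moreover have "(\<lambda>n. ln subC / real n) \<longlonglongrightarrow> 0" by (rule lim_const_over_n)
  ultimately have "(\<lambda>n. a n / real n - ln subC / real n) \<longlonglongrightarrow> L - 0" by (rule tendsto_diff)
  moreover have "a n / real n - ln subC / real n = ln (Z t n) / real n" for n
    unfolding a_def using sc Z_pos[of n] by (simp add: ln_mult_pos diff_divide_distrib[symmetric])
  ultimately have "(\<lambda>n. ln (Z t n) / real n) \<longlonglongrightarrow> L" by simp
  moreover from this have "pressure A t = L"
    unfolding pressure_def Z_def[symmetric] by (simp add: limI)
  ultimately show ?thesis by simp
qed
end

text \<open>Each word of length n loses the factor \<eta> powr (n (t - s)) when s is replaced by t.
  Because ln \<eta> is negative, the decrease of the pressure is strict.\<close>

lemma pressure_decreasing:
  assumes s: "0 < s" "s \<le> t" "t \<le> real CARD('d)"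
  shows "pressure A t \<le> pressure A s + (t - s) * ln \<eta>"
proof -
  have t: "0 < t" using s by simp
  have s': "s \<le> real CARD('d)" using s by simp
  have "ln (Z t n) / real n \<le> ln (Z s n) / real n + (t - s) * ln \<eta>" if n: "n \<ge> 1" for n
  proof -
    have "Z t n \<le> (\<Sum>w | length w = n. \<phi> s w * (\<eta> ^ n) powr (t - s))"
      unfolding Z_def using \<phi>_mult_le[OF t s(3), of s] s by (intro sum_mono) force
    also have "\<dots> = Z s n * (\<eta> ^ n) powr (t - s)" by (simp add: Z_def sum_distrib_right)
    finally have "ln (Z t n) \<le> ln (Z s n * (\<eta> ^ n) powr (t - s))"
      using Z_pos[OF t s(3)] by (intro ln_mono) auto
    also have "\<dots> = ln (Z s n) + real n * ((t - s) * ln \<eta>)"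
      using Z_pos[OF s(1) s'] eta by (simp add: ln_mult_pos ln_powr ln_realpow)
    finally show ?thesis using n by (simp add: field_simps)
  qed
  then have ev: "\<forall>\<^sub>F n in sequentially. ln (Z t n) / real n \<le> ln (Z s n) / real n + (t - s) * ln \<eta>"
    by (auto intro: eventually_sequentiallyI)
  show ?thesis
    by (rule tendsto_le[OF _ _ pressure_LIMSEQ[OF t s(3)] ev])
      (auto intro!: tendsto_add pressure_LIMSEQ s(1) s')
qed

lemma inverse_lower_pressure_mono:
  assumes s: "0 < s" "s \<le> t" "t \<le> real CARD('d)"
  shows "inverse_lower_pressure A lam s \<le> inverse_lower_pressure A lam t"
  unfolding inverse_lower_pressure_def
proof (rule Liminf_mono, rule always_eventually, rule allI)
  fix k
  have "ln (\<phi> t (lam k)) \<le> ln (\<phi> s (lam k))"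
    using \<phi>_antimono[of t s "lam k"] \<phi>_pos[of t "lam k"] s by (intro ln_mono) auto
  then show "ereal (- 1 / real k * ln (\<phi> s (lam k))) \<le> ereal (- 1 / real k * ln (\<phi> t (lam k)))"
    by (simp add: divide_right_mono)
qed

lemma inverse_lower_pressure_nonneg:
  assumes t: "0 < t" "t \<le> real CARD('d)"
  shows "0 \<le> inverse_lower_pressure A lam t"
proof -
  have "0 \<le> ereal (- 1 / real k * ln (\<phi> t (lam k)))" for k
    using \<phi>_le_1[OF t, of "lam k"] \<phi>_pos[OF t, of "lam k"] by (simp add: divide_nonpos_nonneg)
  then show ?thesis unfolding inverse_lower_pressure_def by (intro Liminf_bounded) auto
qed

end

section \<open>Covers and the upper bound\<close>

lemma hausdorff_premeasure_le_cover:
  assumes "E \<subseteq> (\<Union>n. U n)" "\<And>n. bounded (U n)" "\<And>n. diameter (U n) \<le> \<delta>"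
  shows "hausdorff_premeasure s \<delta> E \<le> (\<Sum>n. diam_pow s (U n))"
  unfolding hausdorff_premeasure_def using assms by (intro INF_lower) auto

lemma hausdorff_premeasure_coverE:
  assumes "hausdorff_premeasure s \<delta> E < c"
  obtains U where "E \<subseteq> (\<Union>n. U n)" "\<And>n. bounded (U n)" "\<And>n. diameter (U n) \<le> \<delta>" "(\<Sum>n. diam_pow s (U n)) < c"
  using assms unfolding hausdorff_premeasure_def INF_less_iff by blast

lemma hausdorff_premeasure_mono:
  "E \<subseteq> F \<Longrightarrow> hausdorff_premeasure s \<delta> E \<le> hausdorff_premeasure s \<delta> F"
  unfolding hausdorff_premeasure_def by (intro INF_superset_mono) auto

lemma hausdorff_premeasure_countable_subadditive:
  "hausdorff_premeasure s \<delta> (\<Union>n. F n) \<le> (\<Sum>n. hausdorff_premeasure s \<delta> (F n))"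
proof (rule ennreal_le_epsilon)
  fix e :: real assume fin: "(\<Sum>n. hausdorff_premeasure s \<delta> (F n)) < top" and e: "0 < e"
  have "\<exists>U. F n \<subseteq> (\<Union>k. U k) \<and> (\<forall>k. bounded (U k) \<and> diameter (U k) \<le> \<delta>) \<and>
      (\<Sum>k. diam_pow s (U k)) \<le> hausdorff_premeasure s \<delta> (F n) + ennreal (e * (1/2) ^ Suc n)" for n
  proof -
    have "hausdorff_premeasure s \<delta> (F n) < top"
      using fin by (rule ennreal_suminf_lessD)
    then have "hausdorff_premeasure s \<delta> (F n) < hausdorff_premeasure s \<delta> (F n) + ennreal (e * (1/2) ^ Suc n)"
      using e by (simp add: ennreal_add_left_cancel_less[of _ 0, simplified])
    from hausdorff_premeasure_coverE[OF this] show ?thesis by (metis less_imp_le)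
  qed
  then obtain U where U: "\<And>n. F n \<subseteq> (\<Union>k. U n k)" "\<And>n k. bounded (U n k)" "\<And>n k. diameter (U n k) \<le> \<delta>"
      "\<And>n. (\<Sum>k. diam_pow s (U n k)) \<le> hausdorff_premeasure s \<delta> (F n) + ennreal (e * (1/2) ^ Suc n)"
    by metis
  define V where "V m = (case prod_decode m of (n, k) \<Rightarrow> U n k)" for m
  have "(\<Union>n. F n) \<subseteq> (\<Union>m. V m)"
  proof
    fix x assume "x \<in> (\<Union>n. F n)"
    then obtain n k where "x \<in> U n k" using U(1) by blast
    then have "x \<in> V (prod_encode (n, k))" by (simp add: V_def)
    then show "x \<in> (\<Union>m. V m)" by blast
  qed
  then have "hausdorff_premeasure s \<delta> (\<Union>n. F n) \<le> (\<Sum>m. diam_pow s (V m))"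
    by (rule hausdorff_premeasure_le_cover) (auto simp: V_def U split: prod.split)
  also have "\<dots> = (\<Sum>m. (\<lambda>(n, k). diam_pow s (U n k)) (prod_decode m))"
    by (intro suminf_cong) (simp add: V_def split: prod.split)
  also have "\<dots> = (\<Sum>n. \<Sum>k. diam_pow s (U n k))"
    by (rule suminf_ennreal_2dimen) simp
  also have "\<dots> \<le> (\<Sum>n. hausdorff_premeasure s \<delta> (F n) + ennreal (e * (1/2) ^ Suc n))"
    by (intro suminf_le U(4)) auto
  also have "\<dots> = (\<Sum>n. hausdorff_premeasure s \<delta> (F n)) + (\<Sum>n. ennreal (e * (1/2) ^ Suc n))"
    by (rule suminf_add[symmetric]) auto
  also have "(\<Sum>n. ennreal (e * (1/2) ^ Suc n)) = ennreal e"
    using sums_mult[OF power_half_series, of e] e by (intro suminf_ennreal_eq) auto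
  finally show "hausdorff_premeasure s \<delta> (\<Union>n. F n) \<le> (\<Sum>n. hausdorff_premeasure s \<delta> (F n)) + ennreal e" .
qed

lemma hausdorff_premeasure_le_diam:
  assumes "bounded U" "diameter U \<le> \<delta>" "0 \<le> \<delta>"
  shows "hausdorff_premeasure s \<delta> U \<le> diam_pow s U"
proof -
  have "hausdorff_premeasure s \<delta> U \<le> (\<Sum>n. diam_pow s (if n = (0::nat) then U else {}))"
    using assms by (intro hausdorff_premeasure_le_cover) auto
  also have "\<dots> = (\<Sum>n\<in>{0}. diam_pow s (if n = (0::nat) then U else {}))"
    by (intro suminf_finite) (auto simp: diam_pow_def)
  finally show ?thesis by simp
qed

lemma hausdorff_premeasure_empty [simp]: "0 \<le> \<delta> \<Longrightarrow> hausdorff_premeasure s \<delta> {} = 0"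
  using hausdorff_premeasure_le_diam[of "{}" \<delta> s] by (simp add: diam_pow_def)

lemma hausdorff_premeasure_UN_finite:
  assumes "finite S" "0 \<le> \<delta>"
  shows "hausdorff_premeasure s \<delta> (\<Union>x\<in>S. F x) \<le> (\<Sum>x\<in>S. hausdorff_premeasure s \<delta> (F x))"
  using assms(1)
proof (induction S rule: finite_induct)
  case empty then show ?case using assms(2) by simp
next
  case (insert x S)
  let ?G = "\<lambda>n::nat. if n = 0 then F x else if n = 1 then (\<Union>x\<in>S. F x) else {}"
  have "hausdorff_premeasure s \<delta> (\<Union>x\<in>insert x S. F x) = hausdorff_premeasure s \<delta> (\<Union>n. ?G n)"
    by (rule arg_cong[where f="hausdorff_premeasure s \<delta>"]) (auto split: if_splits)
  also have "\<dots> \<le> (\<Sum>n. hausdorff_premeasure s \<delta> (?G n))" by (rule hausdorff_premeasure_countable_subadditive)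
  also have "\<dots> = (\<Sum>n\<in>{0, 1}. hausdorff_premeasure s \<delta> (?G n))"
    using assms(2) by (intro suminf_finite) auto
  also have "\<dots> \<le> (\<Sum>x\<in>insert x S. hausdorff_premeasure s \<delta> (F x))"
    using insert by (simp add: add_left_mono)
  finally show ?case .
qed

lemma hausdorff_measure_eq_0I:
  assumes "\<And>\<delta>. \<delta> > 0 \<Longrightarrow> hausdorff_premeasure s \<delta> E = 0"
  shows "hausdorff_measure s E = 0"
  unfolding hausdorff_measure_def using assms by (simp add: SUP_eq_const[where x=0] greaterThan_iff) 

lemma hausdorff_dim_le:
  assumes "hausdorff_measure s E = 0" "0 \<le> s"
  shows "hausdorff_dim E \<le> ereal s"
  unfolding hausdorff_dim_def using assms by (intro Inf_lower) auto

lemma diam_pow_cball: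
  fixes x :: "'a::euclidean_space"
  assumes "0 < r" "s > 0"
  shows "diam_pow s (cball x r) = ennreal ((2 * r) powr s)"
  using assms by (simp add: diam_pow_def)

text \<open>A grid with N steps per axis gives (N + 1) ^ d balls of radius of order 1 / N. Their
  total content is of order N powr (d - s) and tends to 0.\<close>

lemma hausdorff_premeasure_cball_eq_0:
  assumes s: "s > real DIM('a)" and \<delta>: "\<delta> > 0" and R: "R > 0"
  shows "hausdorff_premeasure s \<delta> (cball (0::'a::euclidean_space) R) = 0"
proof -
  let ?d = "real DIM('a)"
  define c where "c = 2 ^ DIM('a) * (4 * ?d * R) powr s"
  have s0: "s > 0" using s by (meson less_trans of_nat_0_less_iff DIM_positive)
  have bound: "hausdorff_premeasure s \<delta> (cball (0::'a) R) \<le> ennreal (c * real N powr (?d - s))"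
    if N: "N > 0" "4 * ?d * R / real N \<le> \<delta>" for N :: nat
  proof -
    let ?P = "PiE (Basis::'a set) (\<lambda>_. {..N})"
    define pt where "pt k = (\<Sum>b\<in>Basis. (R * (-1 + 2 * real (k b) / real N)) *\<^sub>R b)" for k :: "'a \<Rightarrow> nat"
    let ?r = "2 * ?d * R / real N"
    have r0: "0 < ?r" using R N by simp
    have finP: "finite ?P" by (intro finite_PiE) auto
    have "cball 0 R \<subseteq> (\<Union>k\<in>?P. cball (pt k) ?r)"
    proof
      fix y :: 'a assume y: "y \<in> cball 0 R"
      have "\<exists>k\<le>N. \<bar>(y \<bullet> b) / R - (-1 + 2 * real k / real N)\<bar> \<le> 2 / real N" if b: "b \<in> Basis" for b
        using Basis_le_norm[OF b, of y] y R N by (intro coordinate_grid) (auto simp: field_simps)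
      then obtain k where k: "\<And>b. b \<in> Basis \<Longrightarrow> k b \<le> N \<and> \<bar>(y \<bullet> b) / R - (-1 + 2 * real (k b) / real N)\<bar> \<le> 2 / real N"
        by metis
      let ?k = "restrict k Basis"
      have "norm (y - pt ?k) \<le> (\<Sum>b\<in>Basis. \<bar>(y - pt ?k) \<bullet> b\<bar>)" by (rule norm_le_l1)
      also have "\<dots> \<le> (\<Sum>b\<in>(Basis::'a set). R * (2 / real N))"
      proof (rule sum_mono)
        fix b :: 'a assume b: "b \<in> Basis"
        have "pt ?k \<bullet> b = R * (-1 + 2 * real (k b) / real N)"
          unfolding pt_def using b by (simp add: inner_sum_left_Basis)
        moreover have "R * ((y \<bullet> b) / R - X) = y \<bullet> b - R * X" for X using R by (simp add: right_diff_distrib)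
        ultimately have "(y - pt ?k) \<bullet> b = R * ((y \<bullet> b) / R - (-1 + 2 * real (k b) / real N))"
          by (simp only: inner_diff_left)
        then have "\<bar>(y - pt ?k) \<bullet> b\<bar> = R * \<bar>(y \<bullet> b) / R - (-1 + 2 * real (k b) / real N)\<bar>"
          using R by (simp add: abs_mult)
        also have "\<dots> \<le> R * (2 / real N)" using k[OF b] R by (intro mult_left_mono) auto
        finally show "\<bar>(y - pt ?k) \<bullet> b\<bar> \<le> R * (2 / real N)" .
      qed
      also have "\<dots> = ?r" by simp
      finally have "y \<in> cball (pt ?k) ?r" by (simp add: dist_norm norm_minus_commute)
      moreover have "?k \<in> ?P" using k by auto
      ultimately show "y \<in> (\<Union>k\<in>?P. cball (pt k) ?r)" by blast
    qed
    then have "hausdorff_premeasure s \<delta> (cball (0::'a) R) \<le> (\<Sum>k\<in>?P. hausdorff_premeasure s \<delta> (cball (pt k) ?r))"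
      using \<delta> finP by (intro order_trans[OF hausdorff_premeasure_mono hausdorff_premeasure_UN_finite]) auto
    also have "\<dots> \<le> (\<Sum>k\<in>?P. ennreal ((2 * ?r) powr s))"
    proof (rule sum_mono)
      fix k
      show "hausdorff_premeasure s \<delta> (cball (pt k) ?r) \<le> ennreal ((2 * ?r) powr s)"
        unfolding diam_pow_cball[OF r0 s0, of "pt k", symmetric]
        using r0 N \<delta> by (intro hausdorff_premeasure_le_diam) auto
    qed
    also have "\<dots> = ennreal (real ((N + 1) ^ DIM('a)) * (2 * ?r) powr s)"
      by (simp add: card_PiE ennreal_mult ennreal_of_nat_eq_real_of_nat)
    also have "\<dots> \<le> ennreal (c * real N powr (?d - s))"
    proof (rule ennreal_leI)
      have "real ((N + 1) ^ DIM('a)) \<le> (2 * real N) ^ DIM('a)"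
        using N by (simp only: of_nat_power) (intro power_mono, auto)
      then have "real ((N + 1) ^ DIM('a)) * (2 * ?r) powr s \<le> (2 * real N) ^ DIM('a) * (2 * ?r) powr s"
        by (intro mult_right_mono) auto
      also have eq: "2 * ?r = (4 * ?d * R) / real N" by simp
      also have "(2 * real N) ^ DIM('a) * ((4 * ?d * R) / real N) powr s = c * real N powr (?d - s)"
        using N R by (simp add: c_def powr_divide powr_diff powr_realpow power_mult_distrib)
      finally show "real ((N + 1) ^ DIM('a)) * (2 * ?r) powr s \<le> c * real N powr (?d - s)" unfolding eq .
    qed
    finally show ?thesis .
  qed
  have "(\<lambda>N. c * real N powr (?d - s)) \<longlonglongrightarrow> c * 0"
    using s by (intro tendsto_mult tendsto_const tendsto_neg_powr filterlim_real_sequentially) auto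
  from tendsto_ennrealI[OF this] have lim: "(\<lambda>N. ennreal (c * real N powr (?d - s))) \<longlonglongrightarrow> 0" by simp
  have "(\<lambda>N. 4 * ?d * R / real N) \<longlonglongrightarrow> 0" by (rule lim_const_over_n)
  then have "\<forall>\<^sub>F N in sequentially. 4 * ?d * R / real N < \<delta>" using \<delta> by (rule order_tendstoD)
  then have "\<forall>\<^sub>F N in sequentially. hausdorff_premeasure s \<delta> (cball (0::'a) R) \<le> ennreal (c * real N powr (?d - s))"
    using eventually_gt_at_top[of 0] by eventually_elim (rule bound, auto)
  then have "hausdorff_premeasure s \<delta> (cball (0::'a) R) \<le> 0"
    using lim by (intro tendsto_lowerbound[OF lim]) auto
  then show ?thesis by simp
qed

lemma hausdorff_dim_le_DIM:
  fixes E :: "'a::euclidean_space set"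
  shows "hausdorff_dim E \<le> ereal (real DIM('a))"
proof (rule ereal_le_epsilon2)
  fix e :: real assume e: "0 < e"
  have "hausdorff_measure (real DIM('a) + e) E = 0"
  proof (rule hausdorff_measure_eq_0I)
    fix \<delta> :: real assume \<delta>: "\<delta> > 0"
    have "E \<subseteq> (\<Union>n. cball 0 (real (Suc n)))"
    proof
      fix x
      obtain n where "norm x \<le> real n" using real_arch_simple by blast
      then have "x \<in> cball 0 (real (Suc n))" by simp
      then show "x \<in> (\<Union>n. cball 0 (real (Suc n)))" by blast
    qed
    then have "hausdorff_premeasure (real DIM('a) + e) \<delta> E \<le> (\<Sum>n. hausdorff_premeasure (real DIM('a) + e) \<delta> (cball (0::'a) (real (Suc n))))"
      by (rule order_trans[OF hausdorff_premeasure_mono hausdorff_premeasure_countable_subadditive])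
    also have "\<dots> = 0"
      using hausdorff_premeasure_cball_eq_0[where 'a='a, of "real DIM('a) + e" \<delta>] e \<delta> by simp
    finally show "hausdorff_premeasure (real DIM('a) + e) \<delta> E = 0" by simp
  qed
  then show "hausdorff_dim E \<le> ereal (real DIM('a)) + ereal e"
    using hausdorff_dim_le[of "real DIM('a) + e" E] e by simp
qed

lemma hausdorff_dim_nonneg: "0 \<le> hausdorff_dim E"
  unfolding hausdorff_dim_def by (rule Inf_greatest) auto

section \<open>The natural projection and covers of the target set\<close>

context contracting_matrices
begin

abbreviation f where "f T w \<equiv> foldr (affine_map A T) w"

lemma foldr_affine: "f T w x = W w *v x + f T w 0"
  by (induction w) (simp_all add: affine_map_def matrix_vector_mul_assoc[symmetric] matrix_vector_right_distrib)

lemma foldr_affine_append: "f T (u @ v) x = W u *v f T v x + f T u 0"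
  using foldr_affine[of T u "f T v x"] by simp

text \<open>The radius 2 \<rho> reproduces itself: one more map halves it at least and adds at most
  \<rho>.\<close>

lemma norm_foldr_affine_le:
  assumes "\<And>i. norm (T $ i) \<le> \<rho>"
  shows "norm (f T w 0) \<le> 2 * \<rho>"
proof (induction w)
  case Nil
  have "0 \<le> \<rho>" using assms[of undefined] norm_ge_zero order_trans by blast
  then show ?case by simp
next
  case (Cons i w)
  have r: "0 \<le> \<rho>" using assms[of undefined] norm_ge_zero order_trans by blast
  have "norm (f T (i # w) 0) \<le> norm (A i *v f T w 0) + norm (T $ i)"
    by (simp add: affine_map_def norm_triangle_ineq)
  also have "\<dots> \<le> \<eta> * norm (f T w 0) + \<rho>" using norm_A_le assms by (intro add_mono) auto
  also have "\<dots> \<le> (1/2) * (2 * \<rho>) + \<rho>" using eta Cons.IH r by (intro add_mono mult_mono) auto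
  finally show ?case by simp
qed

text \<open>Radius of a ball around 0 that contains all projections for the parameter T. The summand
  1 keeps it positive when T is 0, as the covering estimates divide by it.\<close>

definition attractor_bound :: "(real ^ 'd) ^ 'n \<Rightarrow> real" where "attractor_bound T = 2 * (\<Sum>i\<in>UNIV. norm (T $ i)) + 1"

lemma attractor_bound: "0 < attractor_bound T" "norm (f T w 0) \<le> attractor_bound T"
proof -
  have "norm (T $ i) \<le> (\<Sum>i\<in>UNIV. norm (T $ i))" for i by (rule member_le_sum) auto
  from norm_foldr_affine_le[of T, OF this] show "norm (f T w 0) \<le> attractor_bound T"
    by (simp add: attractor_bound_def add_increasing2)
  show "0 < attractor_bound T" by (simp add: attractor_bound_def add_nonneg_pos sum_nonneg)
qed

lemma tendsto_eta_power: "(\<lambda>n. \<eta> ^ n) \<longlonglongrightarrow> 0"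
  using eta by (intro LIMSEQ_realpow_zero) auto

lemma natural_proj_LIMSEQ: "(\<lambda>n. f T (stake n \<omega>) 0) \<longlonglongrightarrow> natural_proj A T \<omega>"
proof -
  have "Cauchy (\<lambda>n. f T (stake n \<omega>) 0)"
  proof (rule CauchyI')
    fix e :: real assume e: "e > 0"
    have "(\<lambda>n. \<eta> ^ n * attractor_bound T) \<longlonglongrightarrow> 0 * attractor_bound T" by (intro tendsto_mult tendsto_eta_power tendsto_const)
    then have "(\<lambda>n. \<eta> ^ n * attractor_bound T) \<longlonglongrightarrow> 0" by simp
    from order_tendstoD(2)[OF this e] obtain N where N: "\<And>n. n \<ge> N \<Longrightarrow> \<eta> ^ n * attractor_bound T < e"
      by (auto simp: eventually_sequentially)
    have "dist (f T (stake m \<omega>) 0) (f T (stake n \<omega>) 0) < e" if mn: "m \<ge> N" "m < n" for m n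
    proof -
      have "stake n \<omega> = stake m \<omega> @ stake (n - m) (sdrop m \<omega>)" using mn by (simp add: stake_add)
      then have "f T (stake n \<omega>) 0 - f T (stake m \<omega>) 0 = W (stake m \<omega>) *v f T (stake (n - m) (sdrop m \<omega>)) 0"
        by (simp only: foldr_affine_append) simp
      also have "norm \<dots> \<le> \<eta> ^ m * attractor_bound T"
      proof -
        have "norm (W (stake m \<omega>) *v f T (stake (n - m) (sdrop m \<omega>)) 0) \<le> \<eta> ^ m * norm (f T (stake (n - m) (sdrop m \<omega>)) 0)"
          using norm_W_le[of "stake m \<omega>"] by simp
        also have "\<dots> \<le> \<eta> ^ m * attractor_bound T" using eta attractor_bound(2) by (intro mult_left_mono) auto
        finally show ?thesis .
      qed
      finally show ?thesis using N[OF mn(1)] by (simp add: dist_norm norm_minus_commute)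
    qed
    then show "\<exists>M. \<forall>m\<ge>M. \<forall>n>m. dist (f T (stake m \<omega>) 0) (f T (stake n \<omega>) 0) < e" by blast
  qed
  then show ?thesis unfolding natural_proj_def using Cauchy_convergent_iff convergent_LIMSEQ_iff by blast
qed

lemma norm_natural_proj_le:
  assumes "\<And>i. norm (T $ i) \<le> \<rho>"
  shows "norm (natural_proj A T \<omega>) \<le> 2 * \<rho>"
  by (rule tendsto_upperbound[OF tendsto_norm[OF natural_proj_LIMSEQ]]) (intro always_eventually allI norm_foldr_affine_le assms, simp)

lemma norm_natural_proj_le_attractor_bound: "norm (natural_proj A T \<omega>) \<le> attractor_bound T"
  by (rule tendsto_upperbound[OF tendsto_norm[OF natural_proj_LIMSEQ]]) (intro always_eventually allI attractor_bound, simp)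

lemma natural_proj_stake:
  "natural_proj A T \<omega> = W (stake m \<omega>) *v natural_proj A T (sdrop m \<omega>) + f T (stake m \<omega>) 0"
proof -
  have "(\<lambda>n. f T (stake (n + m) \<omega>) 0) \<longlonglongrightarrow> natural_proj A T \<omega>"
    by (rule LIMSEQ_ignore_initial_segment[OF natural_proj_LIMSEQ])
  moreover have "f T (stake (n + m) \<omega>) 0 = W (stake m \<omega>) *v f T (stake n (sdrop m \<omega>)) 0 + f T (stake m \<omega>) 0" for n
    by (subst add.commute) (simp only: stake_add[symmetric] foldr_affine_append)
  moreover have "(\<lambda>n. W (stake m \<omega>) *v f T (stake n (sdrop m \<omega>)) 0 + f T (stake m \<omega>) 0) \<longlonglongrightarrow> W (stake m \<omega>) *v natural_proj A T (sdrop m \<omega>) + f T (stake m \<omega>) 0"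
    by (intro tendsto_add tendsto_const bounded_linear.tendsto[OF matrix_vector_mul_bounded_linear] natural_proj_LIMSEQ)
  ultimately show ?thesis using LIMSEQ_unique by auto
qed

lemma hausdorff_premeasure_image_le:
  assumes t: "0 < t" "t \<le> real CARD('d)" and R: "R > 0" and \<delta>: "4 * real CARD('d) * \<eta> ^ length u * R \<le> \<delta>"
  shows "hausdorff_premeasure t \<delta> ((\<lambda>x. W u *v x + p) ` cball 0 R)
    \<le> ennreal ((2 * R) powr t * (3 ^ CARD('d) * (2 * real CARD('d)) powr t) * \<phi> t u)"
proof -
  obtain X r where X: "finite X" "0 < r" "r \<le> 2 * real CARD('d) * onorm ((*v) (W u))"
      "(*v) (W u) ` cball 0 1 \<subseteq> (\<Union>x\<in>X. cball x r)"
      "real (card X) * r powr t \<le> 3 ^ CARD('d) * (2 * real CARD('d)) powr t * \<phi> t u"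
    using ellipsoid_cover[OF inv_W t] by blast
  have "r \<le> 2 * real CARD('d) * \<eta> ^ length u"
    using X(3) mult_left_mono[OF onorm_W_le, of "2 * real CARD('d)" u] by linarith
  then have "2 * (R * r) \<le> 2 * (R * (2 * real CARD('d) * \<eta> ^ length u))"
    using R by (intro mult_left_mono) auto
  then have Rr: "2 * (R * r) \<le> \<delta>" using \<delta> by (simp add: mult_ac)
  have Rr0: "0 < R * r" using R X by simp
  then have \<delta>0: "0 \<le> \<delta>" using Rr by linarith
  have "(\<lambda>x. W u *v x + p) ` cball 0 R \<subseteq> (\<Union>x\<in>X. cball (R *\<^sub>R x + p) (R * r))"
  proof clarify
    fix y :: "real^'d" assume y: "y \<in> cball 0 R"
    then have "(1/R) *\<^sub>R y \<in> cball 0 1" using R by simp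
    then obtain x where x: "x \<in> X" "dist x (W u *v ((1/R) *\<^sub>R y)) \<le> r" using X(4) by fastforce
    have "W u *v y = R *\<^sub>R (W u *v ((1/R) *\<^sub>R y))" using R by (simp add: matrix_vector_mult_scaleR)
    then have "dist (R *\<^sub>R x + p) (W u *v y + p) = R * dist x (W u *v ((1/R) *\<^sub>R y))"
      using R by (simp add: dist_norm flip: scaleR_diff_right)
    also have "\<dots> \<le> R * r" using x(2) R by (intro mult_left_mono) auto
    finally show "W u *v y + p \<in> (\<Union>x\<in>X. cball (R *\<^sub>R x + p) (R * r))" using x by auto
  qed
  then have "hausdorff_premeasure t \<delta> ((\<lambda>x. W u *v x + p) ` cball 0 R) \<le> (\<Sum>x\<in>X. hausdorff_premeasure t \<delta> (cball (R *\<^sub>R x + p) (R * r)))"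
    using \<delta>0 X(1) by (intro order_trans[OF hausdorff_premeasure_mono hausdorff_premeasure_UN_finite]) auto
  also have "\<dots> \<le> (\<Sum>x\<in>X. ennreal ((2 * (R * r)) powr t))"
  proof (rule sum_mono)
    fix x
    show "hausdorff_premeasure t \<delta> (cball (R *\<^sub>R x + p) (R * r)) \<le> ennreal ((2 * (R * r)) powr t)"
      unfolding diam_pow_cball[OF Rr0 t(1), of "R *\<^sub>R x + p", symmetric]
      using Rr Rr0 \<delta>0 by (intro hausdorff_premeasure_le_diam) auto
  qed
  also have "\<dots> = ennreal (real (card X) * (2 * (R * r)) powr t)"
    by (simp add: ennreal_mult ennreal_of_nat_eq_real_of_nat)
  also have "real (card X) * (2 * (R * r)) powr t = (2 * R) powr t * (real (card X) * r powr t)"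
    using R X by (simp add: powr_mult)
  also have "ennreal \<dots> \<le> ennreal ((2 * R) powr t * (3 ^ CARD('d) * (2 * real CARD('d)) powr t * \<phi> t u))"
    by (intro ennreal_leI mult_left_mono X(5)) auto
  finally show ?thesis by (simp add: mult.assoc)
qed

text \<open>A point of the target set hits infinitely often, so the cover may start at any level K.
  The tail sums of a convergent series then become arbitrarily small.\<close>

lemma shrinking_target_subset:
  "shrinking_target A T lam \<subseteq> (\<Union>k\<in>{K..}. \<Union>w\<in>{w. length w = k}. (\<lambda>x. W (w @ lam k) *v x + f T (w @ lam k) 0) ` cball 0 (attractor_bound T))"
proof
  fix y assume "y \<in> shrinking_target A T lam"
  then obtain \<omega> where y: "y = natural_proj A T \<omega>" and "\<exists>\<^sub>\<infinity>k. sdrop k \<omega> \<in> cylinder (lam k)"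
    unfolding shrinking_target_def by blast
  then obtain k where k: "k \<ge> K" "sdrop k \<omega> \<in> cylinder (lam k)" unfolding INFM_nat_le by blast
  have st: "stake (k + length (lam k)) \<omega> = stake k \<omega> @ lam k"
    using k(2) by (simp add: stake_add[symmetric] cylinder_def)
  have "y = (\<lambda>x. W (stake k \<omega> @ lam k) *v x + f T (stake k \<omega> @ lam k) 0) (natural_proj A T (sdrop (k + length (lam k)) \<omega>))"
    unfolding y using natural_proj_stake[of T \<omega> "k + length (lam k)"] unfolding st .
  moreover have "natural_proj A T (sdrop (k + length (lam k)) \<omega>) \<in> cball 0 (attractor_bound T)"
    using norm_natural_proj_le_attractor_bound by simp
  moreover have "stake k \<omega> \<in> {w. length w = k}" by simp
  ultimately show "y \<in> (\<Union>k\<in>{K..}. \<Union>w\<in>{w. length w = k}. (\<lambda>x. W (w @ lam k) *v x + f T (w @ lam k) 0) ` cball 0 (attractor_bound T))"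
    using k(1) by blast
qed

lemma hausdorff_measure_shrinking_target_eq_0:
  assumes t: "0 < t" "t \<le> real CARD('d)" and P: "ereal (pressure A t) < inverse_lower_pressure A lam t"
  shows "hausdorff_measure t (shrinking_target A T lam) = 0"
proof (rule hausdorff_measure_eq_0I)
  fix \<delta> :: real assume \<delta>: "\<delta> > 0"
  obtain b where b: "ereal (pressure A t) < ereal b" "ereal b < inverse_lower_pressure A lam t"
    using ereal_dense2[OF P] by blast
  \<comment> \<open>Two rates give room on both sides: eventually \<open>Z t k\<close> is at most
    exp(k b') and \<open>\<phi> t (lam k)\<close> at most exp(-k b), so level k contributes at most
    a constant times q ^ k.\<close>
  obtain b' where b': "pressure A t < b'" "b' < b" using b(1) dense by auto
  define C where "C = (2 * attractor_bound T) powr t * (3 ^ CARD('d) * (2 * real CARD('d)) powr t) * subC t"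
  have C0: "0 \<le> C" using subC(1)[OF t] by (simp add: C_def)
  define q where "q = exp (b' - b)"
  have q: "0 < q" "q < 1" using b' by (auto simp: q_def)
  have "\<forall>\<^sub>F k in sequentially. ereal b < ereal (- 1 / real k * ln (\<phi> t (lam k)))"
    using less_LiminfD[OF b(2)[unfolded inverse_lower_pressure_def]] .
  moreover have "\<forall>\<^sub>F k in sequentially. ln (Z t k) / real k < b'"
    using order_tendstoD(2)[OF pressure_LIMSEQ[OF t] b'(1)] .
  moreover have "(\<lambda>k. 4 * real CARD('d) * \<eta> ^ k * attractor_bound T) \<longlonglongrightarrow> 4 * real CARD('d) * 0 * attractor_bound T"
    by (intro tendsto_mult tendsto_eta_power tendsto_const)
  then have "\<forall>\<^sub>F k in sequentially. 4 * real CARD('d) * \<eta> ^ k * attractor_bound T < \<delta>"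
    using order_tendstoD(2)[of _ 0] \<delta> by simp
  ultimately have "\<forall>\<^sub>F k in sequentially. hausdorff_premeasure t \<delta> (\<Union>w\<in>{w. length w = k}. (\<lambda>x. W (w @ lam k) *v x + f T (w @ lam k) 0) ` cball 0 (attractor_bound T)) \<le> ennreal (C * q ^ k)"
    using eventually_gt_at_top[of 0]
  proof eventually_elim
    case (elim k)
    have "hausdorff_premeasure t \<delta> (\<Union>w\<in>{w. length w = k}. (\<lambda>x. W (w @ lam k) *v x + f T (w @ lam k) 0) ` cball 0 (attractor_bound T))
        \<le> (\<Sum>w | length w = k. hausdorff_premeasure t \<delta> ((\<lambda>x. W (w @ lam k) *v x + f T (w @ lam k) 0) ` cball 0 (attractor_bound T)))"
      using \<delta> finite_words[OF t] by (intro hausdorff_premeasure_UN_finite) auto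
    also have "\<dots> \<le> (\<Sum>w | length w = k. ennreal (C * \<phi> t w * \<phi> t (lam k)))"
    proof (rule sum_mono)
      fix w :: "'n list" assume "w \<in> {w. length w = k}"
      then have w: "length w = k" by simp
      have "4 * real CARD('d) * \<eta> ^ length (w @ lam k) * attractor_bound T \<le> 4 * real CARD('d) * \<eta> ^ k * attractor_bound T"
        using eta attractor_bound(1)[of T] w by (intro mult_right_mono mult_left_mono power_decreasing) auto
      then have le: "4 * real CARD('d) * \<eta> ^ length (w @ lam k) * attractor_bound T \<le> \<delta>" using elim(3) by linarith
      have "hausdorff_premeasure t \<delta> ((\<lambda>x. W (w @ lam k) *v x + f T (w @ lam k) 0) ` cball 0 (attractor_bound T))
          \<le> ennreal ((2 * attractor_bound T) powr t * (3 ^ CARD('d) * (2 * real CARD('d)) powr t) * \<phi> t (w @ lam k))"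
        by (rule hausdorff_premeasure_image_le[OF t attractor_bound(1) le])
      also have "\<dots> \<le> ennreal ((2 * attractor_bound T) powr t * (3 ^ CARD('d) * (2 * real CARD('d)) powr t) * (subC t * \<phi> t w * \<phi> t (lam k)))"
        by (intro ennreal_leI mult_left_mono subC t) auto
      finally show "hausdorff_premeasure t \<delta> ((\<lambda>x. W (w @ lam k) *v x + f T (w @ lam k) 0) ` cball 0 (attractor_bound T)) \<le> ennreal (C * \<phi> t w * \<phi> t (lam k))"
        by (simp add: C_def mult_ac)
    qed
    also have "\<dots> = ennreal (C * Z t k * \<phi> t (lam k))"
      unfolding Z_def sum_distrib_left sum_distrib_right
      using C0 \<phi>_nonneg[OF t] by (intro sum_ennreal) auto
    also have "\<dots> \<le> ennreal (C * q ^ k)"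
    proof (rule ennreal_leI)
      have "ln (Z t k) < real k * b'" using elim(2,4) by (simp add: field_simps)
      then have 1: "Z t k \<le> exp (real k * b')" using Z_pos[OF t, of k] by (metis less_imp_le exp_ln exp_le_cancel_iff)
      have "ln (\<phi> t (lam k)) < - (real k * b)" using elim(1,4) by (simp add: field_simps)
      then have 2: "\<phi> t (lam k) \<le> exp (- (real k * b))" using \<phi>_pos[OF t, of "lam k"] by (metis less_imp_le exp_ln exp_le_cancel_iff)
      have "Z t k * \<phi> t (lam k) \<le> exp (real k * b') * exp (- (real k * b))"
        using 1 2 Z_pos[OF t, of k] \<phi>_nonneg[OF t] by (intro mult_mono) auto
      also have "\<dots> = q ^ k" by (simp add: q_def exp_of_nat_mult[symmetric] exp_add[symmetric] algebra_simps)
      finally show "C * Z t k * \<phi> t (lam k) \<le> C * q ^ k" using C0 by (simp add: mult.assoc mult_left_mono)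
    qed
    finally show ?case .
  qed
  then obtain K0 where K0: "\<And>k. k \<ge> K0 \<Longrightarrow> hausdorff_premeasure t \<delta> (\<Union>w\<in>{w. length w = k}. (\<lambda>x. W (w @ lam k) *v x + f T (w @ lam k) 0) ` cball 0 (attractor_bound T)) \<le> ennreal (C * q ^ k)"
    by (auto simp: eventually_sequentially)
  have bound: "hausdorff_premeasure t \<delta> (shrinking_target A T lam) \<le> ennreal (C * q ^ K / (1 - q))" if K: "K \<ge> K0" for K
  proof -
    have "shrinking_target A T lam \<subseteq> (\<Union>j. \<Union>w\<in>{w. length w = j + K}. (\<lambda>x. W (w @ lam (j + K)) *v x + f T (w @ lam (j + K)) 0) ` cball 0 (attractor_bound T))"
      (is "_ \<subseteq> (\<Union>j. ?G j)")
    proof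
      fix y assume "y \<in> shrinking_target A T lam"
      then obtain k where "k \<ge> K" "y \<in> (\<Union>w\<in>{w. length w = k}. (\<lambda>x. W (w @ lam k) *v x + f T (w @ lam k) 0) ` cball 0 (attractor_bound T))"
        using shrinking_target_subset[of T lam K] by blast
      then have "y \<in> ?G (k - K)" by simp
      then show "y \<in> (\<Union>j. ?G j)" by blast
    qed
    then have "hausdorff_premeasure t \<delta> (shrinking_target A T lam) \<le> (\<Sum>j. hausdorff_premeasure t \<delta> (?G j))"
      by (rule order_trans[OF hausdorff_premeasure_mono hausdorff_premeasure_countable_subadditive])
    also have "\<dots> \<le> (\<Sum>j. ennreal (C * q ^ (j + K)))" using K by (intro suminf_le K0) auto
    also have "\<dots> = ennreal (C * q ^ K / (1 - q))"
    proof (rule suminf_ennreal_eq)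
      have "(\<lambda>j. C * q ^ K * q ^ j) sums (C * q ^ K * (1 / (1 - q)))"
        using q by (intro sums_mult geometric_sums) auto
      then show "(\<lambda>j. C * q ^ (j + K)) sums (C * q ^ K / (1 - q))" by (simp add: power_add mult_ac)
    qed (use C0 q in auto)
    finally show ?thesis .
  qed
  have "(\<lambda>K. C * q ^ K / (1 - q)) \<longlonglongrightarrow> C * 0 / (1 - q)"
    using q by (intro tendsto_intros LIMSEQ_realpow_zero) auto
  from tendsto_ennrealI[OF this] have lim: "(\<lambda>K. ennreal (C * q ^ K / (1 - q))) \<longlonglongrightarrow> ennreal 0" by simp
  have "hausdorff_premeasure t \<delta> (shrinking_target A T lam) \<le> ennreal 0"
    by (rule tendsto_lowerbound[OF lim]) (use bound in \<open>auto simp: eventually_sequentially\<close>)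
  then show "hausdorff_premeasure t \<delta> (shrinking_target A T lam) = 0" by simp
qed

text \<open>Above \<open>s\<^sub>0\<close> the inequality \<open>P \<le> \<alpha>\<close> becomes strict, because \<open>P\<close> decreases strictly.\<close>
lemma hausdorff_dim_shrinking_target_le:
  "hausdorff_dim (shrinking_target A T lam) \<le> min (ereal (real CARD('d))) (critical_exponent A lam)"
proof (rule min.boundedI)
  show dd: "hausdorff_dim (shrinking_target A T lam) \<le> ereal (real CARD('d))"
    using hausdorff_dim_le_DIM[of "shrinking_target A T lam"] by simp
  show "hausdorff_dim (shrinking_target A T lam) \<le> critical_exponent A lam"
  proof (rule dense_ge)
    fix x assume x: "critical_exponent A lam < x"
    then obtain s where s: "ereal s < x" "0 < s" "ereal (pressure A s) \<le> inverse_lower_pressure A lam s"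
      unfolding critical_exponent_def Inf_less_iff by blast
    show "hausdorff_dim (shrinking_target A T lam) \<le> x"
    proof (cases "s < real CARD('d)")
      case False
      then show ?thesis using dd s(1) by (metis ereal_less_eq(3) less_imp_le not_less order_trans)
    next
      case True
      then have "ereal s < min x (ereal (real CARD('d)))" using s(1) by simp
      then obtain t where t: "ereal s < ereal t" "ereal t < min x (ereal (real CARD('d)))" using ereal_dense2 by blast
      then have t': "0 < t" "s < t" "t \<le> real CARD('d)" using s by auto
      have "pressure A t \<le> pressure A s + (t - s) * ln \<eta>" using s t' by (intro pressure_decreasing) auto
      moreover have "(t - s) * ln \<eta> < 0" using t' eta by (simp add: mult_pos_neg)
      ultimately have "ereal (pressure A t) < ereal (pressure A s)" by simp
      also have "\<dots> \<le> inverse_lower_pressure A lam t"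
        using s(3) inverse_lower_pressure_mono[of s t lam] s t' by (meson less_imp_le order_trans)
      finally have "hausdorff_measure t (shrinking_target A T lam) = 0"
        by (rule hausdorff_measure_shrinking_target_eq_0[OF t'(1,3)])
      then have "hausdorff_dim (shrinking_target A T lam) \<le> ereal t" using t' by (intro hausdorff_dim_le) auto
      then show ?thesis using t by (metis less_imp_le min_less_iff_conj order_trans)
    qed
  qed
qed

end

section \<open>Transversality\<close>

lemma measurable_vec_lambda_lborel:
  "(\<lambda>f. \<chi> i. f i) \<in> measurable (\<Pi>\<^sub>M i\<in>UNIV. lborel) (borel :: ('a::euclidean_space ^ 'n::finite) measure)"
proof (subst borel_measurable_euclidean_space, intro ballI)
  fix b :: "'a ^ 'n" assume "b \<in> Basis"
  then obtain i u where b: "b = axis i u" "u \<in> Basis" by (auto simp: Basis_vec_def)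
  have "(\<lambda>f. f i \<bullet> u) \<in> borel_measurable (\<Pi>\<^sub>M i\<in>(UNIV::'n set). (lborel :: 'a measure))"
    by measurable
  then show "(\<lambda>f. (\<chi> i. f i) \<bullet> b) \<in> borel_measurable (\<Pi>\<^sub>M i\<in>(UNIV::'n set). (lborel :: 'a measure))"
    by (simp add: b inner_axis)
qed

text \<open>Splits the parameter measure into the measures of the single translation vectors, so
  that one of them can be integrated with the others frozen.\<close>

lemma lborel_vec_eq:
  "(lborel :: ('a::euclidean_space ^ 'n::finite) measure) = distr (\<Pi>\<^sub>M i\<in>UNIV. lborel) borel (\<lambda>f. \<chi> i. f i)"
proof (rule lborel_eqI)
  note meas = measurable_vec_lambda_lborel
  interpret product_sigma_finite "\<lambda>_::'n. lborel :: 'a measure" ..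
  fix l u :: "'a ^ 'n" assume lu: "\<And>b. b \<in> Basis \<Longrightarrow> l \<bullet> b \<le> u \<bullet> b"
  have lu': "l $ i \<bullet> b \<le> u $ i \<bullet> b" if "b \<in> Basis" for i b
    using lu[of "axis i b"] that by (simp add: inner_axis axis_in_Basis_iff)
  have vim: "(\<lambda>f. \<chi> i. f i) -` box l u \<inter> space (\<Pi>\<^sub>M i\<in>(UNIV::'n set). (lborel :: 'a measure)) = (\<Pi>\<^sub>E i\<in>UNIV. box (l $ i) (u $ i))"
    by (auto simp: space_PiM PiE_def mem_box Basis_vec_def inner_axis Pi_def)
  have "emeasure (distr (\<Pi>\<^sub>M i\<in>UNIV. lborel) borel (\<lambda>f. \<chi> i. f i)) (box l u)
      = emeasure (\<Pi>\<^sub>M i\<in>UNIV. lborel) (\<Pi>\<^sub>E i\<in>UNIV. box (l $ i) (u $ i))"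
    by (subst emeasure_distr[OF meas]) (simp, simp only: vim)
  also have "\<dots> = (\<Prod>i\<in>UNIV. emeasure lborel (box (l $ i) (u $ i)))"
    by (rule emeasure_PiM) auto
  also have "\<dots> = (\<Prod>i\<in>UNIV. ennreal (\<Prod>b\<in>Basis. (u $ i - l $ i) \<bullet> b))"
    using lu' by (intro prod.cong refl emeasure_lborel_box) auto
  also have "\<dots> = ennreal (\<Prod>i\<in>UNIV. \<Prod>b\<in>Basis. (u $ i - l $ i) \<bullet> b)"
    using lu' by (intro prod_ennreal prod_nonneg) (auto simp: inner_diff_left)
  also have "(\<Prod>i\<in>UNIV. \<Prod>b\<in>Basis. (u $ i - l $ i) \<bullet> b) = (\<Prod>(i, b)\<in>UNIV \<times> Basis. (u $ i - l $ i) \<bullet> b)"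
    by (simp add: prod.cartesian_product)
  also have "\<dots> = (\<Prod>b\<in>Basis. (u - l) \<bullet> b)"
  proof -
    have bij: "bij_betw (\<lambda>(i, b). axis i b) (UNIV \<times> Basis) (Basis :: ('a ^ 'n) set)"
      by (auto simp: bij_betw_def inj_on_def axis_eq_axis Basis_vec_def)
    show ?thesis
      using prod.reindex_bij_betw[OF bij, of "\<lambda>b. (u - l) \<bullet> b"] by (simp add: case_prod_beta inner_axis)
  qed
  finally show "emeasure (distr (\<Pi>\<^sub>M i\<in>UNIV. lborel) borel (\<lambda>f. \<chi> i. f i)) (box l u) = (\<Prod>b\<in>Basis. (u - l) \<bullet> b)" .
qed simp

section \<open>Linear dependence of the projection on the translation vectors\<close>

context contracting_matrices
begin

lemma foldr_affine_add: "f (T + T') w 0 = f T w 0 + f T' w 0"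
  by (induction w) (simp_all add: affine_map_def matrix_vector_right_distrib)

lemma foldr_affine_scaleR: "f (c *\<^sub>R T) w 0 = c *\<^sub>R f T w 0"
  by (induction w) (simp_all add: affine_map_def matrix_vector_mult_scaleR scaleR_add_right)

lemma linear_natural_proj: "linear (\<lambda>T. natural_proj A T \<omega>)"
proof (rule linearI)
  fix T T' :: "(real ^ 'd) ^ 'n" and c :: real
  have "(\<lambda>n. f (T + T') (stake n \<omega>) 0) \<longlonglongrightarrow> natural_proj A T \<omega> + natural_proj A T' \<omega>"
    unfolding foldr_affine_add by (intro tendsto_add natural_proj_LIMSEQ)
  then show "natural_proj A (T + T') \<omega> = natural_proj A T \<omega> + natural_proj A T' \<omega>"
    using natural_proj_LIMSEQ LIMSEQ_unique by blast
  have "(\<lambda>n. f (c *\<^sub>R T) (stake n \<omega>) 0) \<longlonglongrightarrow> c *\<^sub>R natural_proj A T \<omega>"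
    unfolding foldr_affine_scaleR by (intro tendsto_scaleR tendsto_const natural_proj_LIMSEQ)
  then show "natural_proj A (c *\<^sub>R T) \<omega> = c *\<^sub>R natural_proj A T \<omega>"
    using natural_proj_LIMSEQ LIMSEQ_unique by blast
qed

text \<open>Bounds the norm of the linear map that sends the translation vector of the letter a to
  the projection of \<omega>: an occurrence of a at place n passes through n matrices of norm at
  most \<eta>.\<close>

definition letter_weight :: "'n \<Rightarrow> 'n stream \<Rightarrow> real" where
  "letter_weight a \<omega> = (\<Sum>n. (if \<omega> !! n = a then 1 else 0) * \<eta> ^ n)"

lemma summable_letter_weight: "summable (\<lambda>n. (if \<omega> !! n = a then 1 else 0) * \<eta> ^ n)"
  by (rule summable_comparison_test[OF _ summable_geometric[of \<eta>]]) (use eta in auto)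

lemma letter_weight_unfold: "letter_weight a \<omega> = (if shd \<omega> = a then 1 else 0) + \<eta> * letter_weight a (stl \<omega>)"
proof -
  have "letter_weight a \<omega> = (\<Sum>n. (if \<omega> !! Suc n = a then 1 else 0) * \<eta> ^ Suc n) + (if \<omega> !! 0 = a then 1 else 0) * \<eta> ^ 0"
    unfolding letter_weight_def using suminf_split_head[OF summable_letter_weight[of \<omega> a]] by linarith
  also have "(\<Sum>n. (if \<omega> !! Suc n = a then 1 else 0) * \<eta> ^ Suc n) = \<eta> * letter_weight a (stl \<omega>)"
    unfolding letter_weight_def suminf_mult[OF summable_letter_weight, symmetric] by (intro suminf_cong) simp
  finally show ?thesis by simp
qed

lemma letter_weight_nonneg: "0 \<le> letter_weight a \<omega>"
  unfolding letter_weight_def using eta by (intro suminf_nonneg summable_letter_weight) auto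

text \<open>Each place of \<omega> carries at most one of the two letters, so both series together
  stay below one geometric series.\<close>

lemma letter_weight_add_le: "a \<noteq> b \<Longrightarrow> letter_weight a \<omega> + letter_weight b \<omega> \<le> 1 / (1 - \<eta>)"
proof -
  assume ab: "a \<noteq> b"
  have "letter_weight a \<omega> + letter_weight b \<omega> = (\<Sum>n. (if \<omega> !! n = a then 1 else 0) * \<eta> ^ n + (if \<omega> !! n = b then 1 else 0) * \<eta> ^ n)"
    unfolding letter_weight_def by (rule suminf_add[OF summable_letter_weight summable_letter_weight])
  also have "\<dots> \<le> (\<Sum>n. \<eta> ^ n)"
    using eta ab by (intro suminf_le summable_add summable_letter_weight summable_geometric) auto
  also have "\<dots> = 1 / (1 - \<eta>)" using eta by (intro suminf_geometric) auto
  finally show ?thesis .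
qed

lemma norm_foldr_axis_le: "norm (f (axis a v) (stake n \<omega>) 0) \<le> letter_weight a \<omega> * norm v"
proof (induction n arbitrary: \<omega>)
  case 0 then show ?case using letter_weight_nonneg by simp
next
  case (Suc n)
  have "norm (f (axis a v) (stake (Suc n) \<omega>) 0) \<le> norm (A (shd \<omega>) *v f (axis a v) (stake n (stl \<omega>)) 0) + norm (axis a v $ shd \<omega>)"
    by (simp add: affine_map_def norm_triangle_ineq)
  also have "\<dots> \<le> \<eta> * (letter_weight a (stl \<omega>) * norm v) + (if shd \<omega> = a then 1 else 0) * norm v"
    using norm_A_le[of "shd \<omega>" "f (axis a v) (stake n (stl \<omega>)) 0"] Suc.IH[of "stl \<omega>"] eta
    by (intro add_mono order_trans[OF norm_A_le] mult_left_mono) (auto simp: axis_def)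
  also have "\<dots> = letter_weight a \<omega> * norm v" unfolding letter_weight_unfold[of a \<omega>] by (simp add: algebra_simps)
  finally show ?case .
qed

lemma norm_natural_proj_axis_le: "norm (natural_proj A (axis a v) \<omega>) \<le> letter_weight a \<omega> * norm v"
  by (rule tendsto_upperbound[OF tendsto_norm[OF natural_proj_LIMSEQ]])
    (intro always_eventually allI norm_foldr_axis_le, simp)

lemma natural_proj_unfold: "natural_proj A T \<omega> = A (shd \<omega>) *v natural_proj A T (stl \<omega>) + T $ shd \<omega>"
  using natural_proj_stake[of T \<omega> 1] by (simp add: affine_map_def)

text \<open>This is where the norm bound \<open>1/2\<close> enters: the two perturbations of the identity
  that come from the letters \<open>a\<close> and \<open>b\<close> have total norm at most \<open>2 \<eta> / (1 - \<eta>) < 2\<close>, so one of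
  them has norm below \<open>1\<close>.\<close>
lemma transversal_coordinate:
  assumes ne: "shd x \<noteq> shd y"
  shows "\<exists>c. \<forall>v. norm (natural_proj A (axis c v) x - natural_proj A (axis c v) y) \<ge> (1 - \<eta> / (1 - \<eta>)) * norm v"
proof -
  define a b where "a = shd x" and "b = shd y"
  have est: "norm (natural_proj A (axis c v) x - natural_proj A (axis c v) y) \<ge> (1 - \<eta> * (letter_weight c (stl x) + letter_weight c (stl y))) * norm v"
    if c: "c = a \<or> c = b" for c v
  proof -
    let ?x = "A a *v natural_proj A (axis c v) (stl x)" and ?y = "A b *v natural_proj A (axis c v) (stl y)"
    have "norm ?x \<le> \<eta> * (letter_weight c (stl x) * norm v)" "norm ?y \<le> \<eta> * (letter_weight c (stl y) * norm v)"
      using eta by (auto intro!: order_trans[OF norm_A_le] mult_left_mono norm_natural_proj_axis_le)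
    then have xy: "norm (?x - ?y) \<le> \<eta> * (letter_weight c (stl x) + letter_weight c (stl y)) * norm v"
      using norm_triangle_ineq4[of ?x ?y] by (simp add: algebra_simps)
    have "natural_proj A (axis c v) x - natural_proj A (axis c v) y = (?x - ?y) + (axis c v $ a - axis c v $ b)"
      using natural_proj_unfold[of "axis c v" x] natural_proj_unfold[of "axis c v" y] by (simp add: a_def b_def)
    \<comment> \<open>Exactly one of the two sequences starts with c, so the difference is v or -v
      and does not cancel.\<close>
    moreover have "norm (axis c v $ a - axis c v $ b) = norm v"
      using c ne by (auto simp: axis_def a_def b_def)
    ultimately have "norm (natural_proj A (axis c v) x - natural_proj A (axis c v) y) \<ge> norm v - norm (?x - ?y)"
      using norm_diff_ineq[of "axis c v $ a - axis c v $ b" "?x - ?y"] by (simp add: add.commute)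
    then show ?thesis using xy by (simp add: algebra_simps)
  qed
  have sum: "(letter_weight a (stl x) + letter_weight a (stl y)) + (letter_weight b (stl x) + letter_weight b (stl y)) \<le> 2 * (1 / (1 - \<eta>))"
    using letter_weight_add_le[of a b "stl x"] letter_weight_add_le[of a b "stl y"] ne unfolding a_def b_def by linarith
  then have "letter_weight a (stl x) + letter_weight a (stl y) \<le> 1 / (1 - \<eta>) \<or> letter_weight b (stl x) + letter_weight b (stl y) \<le> 1 / (1 - \<eta>)"
    by linarith
  then obtain c where c: "c = a \<or> c = b" "letter_weight c (stl x) + letter_weight c (stl y) \<le> 1 / (1 - \<eta>)" by blast
  have h: "\<eta> * (letter_weight c (stl x) + letter_weight c (stl y)) \<le> \<eta> / (1 - \<eta>)"
    using mult_left_mono[OF c(2), of \<eta>] eta by simp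
  have "(1 - \<eta> / (1 - \<eta>)) * norm v \<le> norm (natural_proj A (axis c v) x - natural_proj A (axis c v) y)" for v
    by (intro order_trans[OF mult_right_mono[OF _ norm_ge_zero] est[OF c(1)]]) (use h in linarith)
  then show ?thesis by blast
qed

text \<open>A product of balls, one for each translation vector. Such sets exhaust the parameter
  space as \<rho> grows and are adapted to integration over one vector at a time.\<close>

definition cube :: "real \<Rightarrow> ((real ^ 'd) ^ 'n) set" where "cube \<rho> = {T. \<forall>i. norm (T $ i) \<le> \<rho>}"

lemma cube_borel [measurable]: "cube \<rho> \<in> sets borel"
proof -
  have "closed (cube \<rho>)"
    unfolding cube_def by (intro closed_Collect_all closed_Collect_le continuous_intros)
  then show ?thesis by (rule borel_closed)
qed

lemma continuous_natural_proj: "continuous_on UNIV (\<lambda>T. natural_proj A T \<omega>)"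
  using linear_natural_proj by (simp add: linear_continuous_on linear_linear)

text \<open>The first factor is the distortion in the transversal direction, the second comes from
  \<open>emeasure_small_image_le\<close> for differences of norm at most 4 \<rho>, and the third is
  the volume of the balls of all other translation vectors.\<close>

definition trans_const :: "real \<Rightarrow> real" where
  "trans_const \<rho> = (1 / (1 - \<eta> / (1 - \<eta>))) ^ CARD('d) * (8 * \<rho>) ^ CARD('d) * (unit_ball_vol CARD('d) * \<rho> ^ CARD('d)) ^ (CARD('n) - 1)"

text \<open>With all translation vectors but the c-th frozen, the difference of the projections is
  an affine expanding function of the c-th one. The slice is thus a preimage of the set of short
  vectors with small image under \<open>W u\<close>, whose measure is already known; Fubini
  integrates over the slices. The matrix of the common prefix is carried along because it shapes
  that set.\<close>

lemma transversality_first_letter: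
  fixes x y :: "'n stream"
  assumes s: "0 < s" "s \<le> real CARD('d)" and \<rho>: "\<rho> \<ge> 1" and r: "r > 0" and ne: "shd x \<noteq> shd y"
  shows "emeasure lborel {T \<in> cube \<rho>. norm (W u *v (natural_proj A T x - natural_proj A T y)) \<le> r}
    \<le> ennreal (trans_const \<rho> * (r powr s / \<phi> s u))"
proof -
  define D where "D T = natural_proj A T x - natural_proj A T y" for T
  define G where "G = {T \<in> cube \<rho>. norm (W u *v D T) \<le> r}"
  define \<kappa> where "\<kappa> = 1 - \<eta> / (1 - \<eta>)"
  have \<kappa>: "\<kappa> > 0" using eta by (simp add: \<kappa>_def field_simps)
  obtain c where c: "\<And>v. norm (D (axis c v)) \<ge> \<kappa> * norm v"
    using transversal_coordinate[OF ne] unfolding \<kappa>_def D_def by blast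
  have linD: "linear D" unfolding D_def by (intro linear_compose_sub linear_natural_proj)
  have contD: "continuous_on UNIV D" using linD by (simp add: linear_continuous_on linear_linear)
  have D_le: "norm (D T) \<le> 4 * \<rho>" if "T \<in> cube \<rho>" for T
    using norm_natural_proj_le[of T \<rho> x] norm_natural_proj_le[of T \<rho> y] norm_triangle_ineq4[of "natural_proj A T x" "natural_proj A T y"] that
    by (force simp: D_def cube_def)
  have "closed {T. norm (W u *v D T) \<le> r}"
    by (intro closed_Collect_le continuous_intros continuous_on_compose2[OF matrix_vector_mult_linear_continuous_on contD]) auto
  then have G[measurable]: "G \<in> sets borel"
    unfolding G_def Collect_conj_eq by (intro sets.Int) (auto simp: cube_borel)
  let ?I = "UNIV - {c}" and ?M = "\<lambda>_::'n. lborel :: (real^'d) measure"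
  interpret product_sigma_finite ?M ..
  have ins: "insert c ?I = UNIV" by auto
  note meas = measurable_vec_lambda_lborel[where 'a="real^'d" and 'n='n]
  define Y where "Y = {z. norm z \<le> 4 * \<rho> \<and> norm (W u *v z) \<le> r}"
  have Y: "Y \<in> sets borel" unfolding Y_def by (rule borel_closed[OF closed_small_image])
  define q where "q = (1/\<kappa>) ^ CARD('d) * ((8 * \<rho>) ^ CARD('d) * (r powr s / \<phi> s u))"
  have q0: "0 \<le> q" using \<kappa> \<rho> \<phi>_pos[OF s, of u] by (simp add: q_def)
  have inner: "(\<integral>\<^sup>+z. indicator G (\<chi> i. (h(c := z)) i) \<partial>lborel) \<le> ennreal q * indicator (\<Pi>\<^sub>E i\<in>?I. cball 0 \<rho>) h"
    if h: "h \<in> space (Pi\<^sub>M ?I ?M)" for h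
  proof (cases "h \<in> (\<Pi>\<^sub>E i\<in>?I. cball 0 \<rho>)")
    case False
    then obtain i where i: "i \<noteq> c" "h i \<notin> cball 0 \<rho>" using h unfolding space_PiM PiE_iff by blast
    then have "(\<chi> i. (h(c := z)) i) \<notin> G" for z
      by (auto simp: G_def cube_def intro!: exI[of _ i])
    then show ?thesis by simp
  next
    case True
    define T0 where "T0 = (\<chi> i. (h(c := 0)) i)"
    have T: "(\<chi> i. (h(c := z)) i) = T0 + axis c z" for z
      by (simp add: T0_def vec_eq_iff axis_def)
    have "indicator G (\<chi> i. (h(c := z)) i) \<le> (indicator {z. D (axis c z) + D T0 \<in> Y} z :: ennreal)" for z
    proof (cases "(\<chi> i. (h(c := z)) i) \<in> G")
      case True
      then have "T0 + axis c z \<in> G" by (simp only: T)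
      then have "D (T0 + axis c z) \<in> Y" using D_le by (auto simp: G_def Y_def)
      then have "D (axis c z) + D T0 \<in> Y" by (simp add: linear_add[OF linD] add.commute)
      then show ?thesis by (simp split: split_indicator)
    qed simp
    then have mono: "(\<integral>\<^sup>+z. indicator G (\<chi> i. (h(c := z)) i) \<partial>lborel) \<le> (\<integral>\<^sup>+z. indicator {z. D (axis c z) + D T0 \<in> Y} z \<partial>lborel)"
      by (rule nn_integral_mono)
    have linc: "linear (\<lambda>z. D (axis c z))"
    proof (rule linearI)
      fix v w :: "real^'d" and k :: real
      have "axis c (v + w) = axis c v + axis c w" "axis c (k *\<^sub>R v) = k *\<^sub>R axis c v"
        by (auto simp: axis_def vec_eq_iff)
      then show "D (axis c (v + w)) = D (axis c v) + D (axis c w)" "D (axis c (k *\<^sub>R v)) = k *\<^sub>R D (axis c v)"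
        by (auto simp: linear_add[OF linD] linear_scale[OF linD])
    qed
    have mY: "{z. D (axis c z) + D T0 \<in> Y} \<in> sets lborel"
    proof -
      have "(\<lambda>z. D (axis c z) + D T0) \<in> borel_measurable borel"
        using linc by (intro borel_measurable_continuous_onI continuous_intros) (simp add: linear_continuous_on linear_linear)
      from measurable_sets[OF this Y] show ?thesis by (simp add: vimage_def)
    qed
    note mono
    also have "(\<integral>\<^sup>+z. indicator {z. D (axis c z) + D T0 \<in> Y} z \<partial>lborel) = emeasure lborel {z. D (axis c z) + D T0 \<in> Y}"
      by (rule nn_integral_indicator[OF mY])
    also have "\<dots> \<le> ennreal ((1/\<kappa>) ^ CARD('d)) * emeasure lborel Y"
      using emeasure_expanding_vimage_le[OF linc \<kappa> c Y] by simp
    also have "\<dots> \<le> ennreal ((1/\<kappa>) ^ CARD('d)) * ennreal ((2 * (4 * \<rho>)) ^ CARD('d) * (r powr s / \<phi> s u))"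
      unfolding Y_def using s \<rho> r by (intro mult_left_mono emeasure_small_image_le inv_W) auto
    also have "\<dots> = ennreal q"
    proof -
      have e: "2 * (4 * \<rho>) = 8 * \<rho>" by simp
      show ?thesis unfolding q_def e
        by (rule ennreal_mult[symmetric]) (use \<kappa> \<rho> \<phi>_pos[OF s, of u] in auto)
    qed
    finally show ?thesis using True by simp
  qed
  have "emeasure lborel G = (\<integral>\<^sup>+h. indicator G (\<chi> i. h i) \<partial>Pi\<^sub>M UNIV ?M)"
    by (subst lborel_vec_eq) (simp add: nn_integral_indicator[symmetric] nn_integral_distr meas del: nn_integral_indicator)
  also have "\<dots> = (\<integral>\<^sup>+h. indicator G (\<chi> i. h i) \<partial>Pi\<^sub>M (insert c ?I) ?M)" by (simp only: ins)
  also have "\<dots> = (\<integral>\<^sup>+h. (\<integral>\<^sup>+z. indicator G (\<chi> i. (h(c := z)) i) \<partial>lborel) \<partial>Pi\<^sub>M ?I ?M)"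
    using measurable_compose[OF meas, of "indicator G :: _ \<Rightarrow> ennreal" borel] by (intro product_nn_integral_insert) (auto simp: ins)
  also have "\<dots> \<le> (\<integral>\<^sup>+h. ennreal q * indicator (\<Pi>\<^sub>E i\<in>?I. cball 0 \<rho>) h \<partial>Pi\<^sub>M ?I ?M)"
    by (rule nn_integral_mono) (rule inner)
  also have "\<dots> = ennreal q * emeasure (Pi\<^sub>M ?I ?M) (\<Pi>\<^sub>E i\<in>?I. cball 0 \<rho>)"
    by (rule nn_integral_cmult_indicator) (auto intro!: sets_PiM_I_finite)
  also have "emeasure (Pi\<^sub>M ?I ?M) (\<Pi>\<^sub>E i\<in>?I. cball 0 \<rho>) = (\<Prod>i\<in>?I. emeasure lborel (cball (0::real^'d) \<rho>))"
    by (rule emeasure_PiM) auto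
  also have "\<dots> = ennreal ((unit_ball_vol CARD('d) * \<rho> ^ CARD('d)) ^ (CARD('n) - 1))"
    using \<rho> by (simp add: emeasure_cball ennreal_power card_Diff_singleton)
  also have "ennreal q * \<dots> = ennreal (trans_const \<rho> * (r powr s / \<phi> s u))"
    using q0 \<rho> by (simp add: ennreal_mult[symmetric] q_def trans_const_def \<kappa>_def mult_ac)
  finally show ?thesis unfolding G_def D_def .
qed

lemma trans_const_nonneg: "\<rho> \<ge> 1 \<Longrightarrow> 0 \<le> trans_const \<rho>"
  unfolding trans_const_def using eta by (intro mult_nonneg_nonneg zero_le_power) (auto simp: field_simps)

lemma transversality:
  fixes x y :: "'n stream"
  assumes s: "0 < s" "s \<le> real CARD('d)" and \<rho>: "\<rho> \<ge> 1" and r: "r > 0"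
    and xy: "stake k x = stake k y" "x !! k \<noteq> y !! k"
  shows "emeasure lborel {T \<in> cube \<rho>. dist (natural_proj A T x) (natural_proj A T y) \<le> r}
    \<le> ennreal (trans_const \<rho> * (r powr s / \<phi> s (stake k x)))"
proof -
  have "natural_proj A T x - natural_proj A T y = W (stake k x) *v (natural_proj A T (sdrop k x) - natural_proj A T (sdrop k y))" for T
    using natural_proj_stake[of T x k] natural_proj_stake[of T y k] xy(1) by (simp add: matrix_vector_mult_diff_distrib)
  then have "{T \<in> cube \<rho>. dist (natural_proj A T x) (natural_proj A T y) \<le> r}
     = {T \<in> cube \<rho>. norm (W (stake k x) *v (natural_proj A T (sdrop k x) - natural_proj A T (sdrop k y))) \<le> r}"
    by (simp add: dist_norm)
  moreover have "shd (sdrop k x) \<noteq> shd (sdrop k y)" using xy(2) by (simp add: sdrop_simps)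
  ultimately show ?thesis using transversality_first_letter[OF s \<rho> r, of "sdrop k x" "sdrop k y" "stake k x"] by simp
qed

end

section \<open>A random point of the target set\<close>

lemma snth_fromN: "fromN k !! n = k + n"
  by (induction n arbitrary: k) auto

text \<open>In the application b lies strictly between \<alpha>(s) and the pressure. The first
  inequality yields \<open>good\<close>, the second yields \<open>growth\<close> for all large m, as
  \<open>Z s m\<close> grows at the rate of the pressure while \<open>C\<close> and \<open>K\<close>
  are fixed.\<close>

locale target_construction = contracting_matrices A \<eta>
  for A :: "'n::finite \<Rightarrow> real ^ 'd ^ 'd" and \<eta> :: real +
  fixes s C b :: real and K m :: nat and conn :: "'n list \<Rightarrow> 'n list \<Rightarrow> 'n list" and lam :: "nat \<Rightarrow> 'n list"
  assumes s: "0 < s" "s \<le> real CARD('d)"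
    and C: "0 < C"
    and length_conn: "\<And>u v. length (conn u v) = K"
    and conn: "\<And>u v. C * \<phi> s u * \<phi> s v \<le> \<phi> s (u @ conn u v @ v)"
    and b: "0 < b"
    and good: "\<exists>\<^sub>\<infinity>k. exp (- (real k * b)) \<le> \<phi> s (lam k)"
    and m: "m \<ge> 1"
    and growth: "exp (b * real (m + K)) < C * Z s m"
begin

definition join :: "'n list \<Rightarrow> 'n list \<Rightarrow> 'n list" where "join u v = u @ conn u v @ v"

definition block_len where "block_len = m + K"
definition padding :: "nat \<Rightarrow> 'n list" where "padding r = replicate r undefined"
text \<open>An insertion needs padding and two additional connecting words, whence \<open>C\<close>
  appears twice. The sum over all possible lengths bounds the loss for each of them.\<close>

definition pad_cost where "pad_cost = (\<Sum>r<block_len. 1 / (C * C * \<phi> s (padding r)))"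
definition \<theta> where "\<theta> = C * Z s m"
text \<open>The geometric mean of exp(b \<open>block_len\<close>) and \<theta>, hence strictly
  between them. Exceeding the first makes insertions affordable again and again; staying below the
  second makes the energy converge.\<close>

definition \<theta>' where "\<theta>' = sqrt (exp (b * real block_len) * \<theta>)"

text \<open>After the \<open>q\<close>-th free block the target word \<open>lam k\<close> is inserted at position \<open>k\<close> whenever
  this position is within reach and the total cost \<open>F\<close> of all insertions stays below \<open>\<theta>' ^ Suc q\<close>.\<close>
definition admissible :: "nat \<Rightarrow> real \<Rightarrow> nat \<Rightarrow> nat \<Rightarrow> bool" where
  "admissible l F q k \<longleftrightarrow> exp (- (real k * b)) \<le> \<phi> s (lam k) \<and> l + block_len + 2 * K \<le> k \<and> k < l + 2 * block_len + 2 * K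
     \<and> F * pad_cost * exp (real k * b) \<le> \<theta>' ^ Suc q"

definition pick :: "nat \<Rightarrow> real \<Rightarrow> nat \<Rightarrow> nat option" where
  "pick l F q = (if \<exists>k. admissible l F q k then Some (SOME k. admissible l F q k) else None)"

text \<open>Length of the word built so far and accumulated price of its insertions. Neither depends
  on the chosen blocks, so the schedule is the same for all random points.\<close>

primrec state :: "nat \<Rightarrow> nat \<times> real" where
  "state 0 = (0, 1)"
| "state (Suc q) = (case pick (fst (state q)) (snd (state q)) q of
      None \<Rightarrow> (fst (state q) + block_len, snd (state q))
    | Some k \<Rightarrow> (k + length (lam k), snd (state q) * pad_cost * exp (real k * b)))"

abbreviation len where "len q \<equiv> fst (state q)"
abbreviation cost where "cost q \<equiv> snd (state q)"
abbreviation choice where "choice q \<equiv> pick (len q) (cost q) q"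

text \<open>The inserted word must begin exactly at position k. Before it stand
  \<open>len q + block_len\<close> letters, two connecting words of length K and the padding;
  admissibility makes the remaining length for the padding nonnegative and less than
  \<open>block_len\<close>.\<close>

primrec prefix_word :: "(nat \<Rightarrow> 'n list) \<Rightarrow> nat \<Rightarrow> 'n list" where
  "prefix_word \<omega> 0 = []"
| "prefix_word \<omega> (Suc q) = (case choice q of
      None \<Rightarrow> join (prefix_word \<omega> q) (\<omega> q)
    | Some k \<Rightarrow> join (join (join (prefix_word \<omega> q) (\<omega> q)) (padding (k - 2 * K - (len q + block_len)))) (lam k))"

text \<open>Diagonal reading of the nested prefixes: after n + 1 blocks the prefix has more than n
  letters, so the letter n exists there and is final.\<close>

definition point :: "(nat \<Rightarrow> 'n list) \<Rightarrow> 'n stream" where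
  "point \<omega> = smap (\<lambda>n. prefix_word \<omega> (Suc n) ! n) nats"

section \<open>The insertion schedule and the resulting words\<close>

lemma block_len_pos: "block_len \<ge> 1" using m by (simp add: block_len_def)

lemma length_join: "length (join u v) = length u + K + length v"
  by (simp add: join_def length_conn)

lemma \<phi>_join: "C * \<phi> s u * \<phi> s v \<le> \<phi> s (join u v)"
  unfolding join_def by (rule conn)

lemma \<phi>_s_pos: "0 < \<phi> s w" using \<phi>_pos[OF s] .

lemma theta_bounds: "1 \<le> \<theta>'" "exp (b * real block_len) < \<theta>'" "\<theta>' < \<theta>" "0 < \<theta>"
proof -
  have g: "exp (b * real block_len) < \<theta>" using growth by (simp add: \<theta>_def block_len_def)
  have e: "1 \<le> exp (b * real block_len)" using b by simp
  then show t0: "0 < \<theta>" using g by linarith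
  have "sqrt (exp (b * real block_len) * exp (b * real block_len)) < \<theta>'"
    unfolding \<theta>'_def using g by (intro real_sqrt_less_mono mult_strict_left_mono) auto
  then show 1: "exp (b * real block_len) < \<theta>'" by simp
  then show "1 \<le> \<theta>'" using e by linarith
  have "\<theta>' < sqrt (\<theta> * \<theta>)"
    unfolding \<theta>'_def using g t0 by (intro real_sqrt_less_mono mult_strict_right_mono) auto
  then show "\<theta>' < \<theta>" using t0 by simp
qed

lemma pad_cost_ge: "r < block_len \<Longrightarrow> 1 \<le> pad_cost * (C * C * \<phi> s (padding r))"
proof -
  assume r: "r < block_len"
  have "1 / (C * C * \<phi> s (padding r)) \<le> pad_cost"
    unfolding pad_cost_def by (rule member_le_sum) (use r C \<phi>_s_pos[THEN less_imp_le] in auto)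
  then show ?thesis using C \<phi>_s_pos[of "padding r"] by (simp add: field_simps)
qed

lemma pad_cost_pos: "0 < pad_cost"
proof -
  have "0 < pad_cost * (C * C * \<phi> s (padding 0))" using pad_cost_ge[of 0] block_len_pos by linarith
  moreover have "0 < C * C * \<phi> s (padding 0)" using C \<phi>_s_pos by simp
  ultimately show ?thesis by (rule zero_less_mult_pos2)
qed

lemma pick_SomeD: "pick l F q = Some k \<Longrightarrow> admissible l F q k"
  unfolding pick_def by (metis option.inject option.simps(3) someI_ex)

lemma cost_pos: "0 < cost q"
  using pad_cost_pos by (induction q) (auto split: option.split)

lemma cost_le: "cost q \<le> \<theta>' ^ q"
proof (induction q)
  case (Suc q)
  have "\<theta>' ^ q \<le> \<theta>' ^ Suc q" using theta_bounds(1) by (intro power_increasing) auto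
  then show ?case using Suc.IH pick_SomeD[of "len q" "cost q" q] by (auto split: option.split simp: admissible_def)
qed simp

definition block_seq :: "(nat \<Rightarrow> 'n list) \<Rightarrow> bool" where "block_seq \<omega> \<longleftrightarrow> (\<forall>q. length (\<omega> q) = m)"

context
  fixes \<omega> :: "nat \<Rightarrow> 'n list" assumes block_seq: "block_seq \<omega>"
begin

lemma length_block: "length (\<omega> q) = m" using block_seq by (simp add: block_seq_def)

lemma length_prefix_word: "length (prefix_word \<omega> q) = len q"
proof (induction q)
  case (Suc q)
  show ?case
  proof (cases "choice q")
    case None then show ?thesis using Suc.IH by (simp add: length_join length_block block_len_def)
  next
    case (Some k)
    then show ?thesis using Suc.IH pick_SomeD[OF Some] by (simp add: length_join length_block block_len_def admissible_def padding_def)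
  qed
qed simp

text \<open>The invariant of the construction. Up to the recorded cost, the word weighs at least the
  product of its free blocks with one factor \<open>C\<close> each: the price of an insertion was
  set to compensate for padding, extra connecting words and the target word.\<close>

lemma \<phi>_prefix_word: "(\<Prod>i<q. C * \<phi> s (\<omega> i)) \<le> cost q * \<phi> s (prefix_word \<omega> q)"
proof (induction q)
  case 0 then show ?case using \<phi>_Nil[OF s] by simp
next
  case (Suc q)
  let ?p = "join (prefix_word \<omega> q) (\<omega> q)"
  have "(\<Prod>i<Suc q. C * \<phi> s (\<omega> i)) \<le> (cost q * \<phi> s (prefix_word \<omega> q)) * (C * \<phi> s (\<omega> q))"
    using Suc.IH C \<phi>_s_pos[of "\<omega> q"] by (simp add: mult_right_mono)
  also have "\<dots> = cost q * (C * \<phi> s (prefix_word \<omega> q) * \<phi> s (\<omega> q))" by simp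
  also have "\<dots> \<le> cost q * \<phi> s ?p" using cost_pos[of q] by (intro mult_left_mono \<phi>_join) auto
  finally have 1: "(\<Prod>i<Suc q. C * \<phi> s (\<omega> i)) \<le> cost q * \<phi> s ?p" .
  show ?case
  proof (cases "choice q")
    case None then show ?thesis using 1 by simp
  next
    case (Some k)
    let ?r = "k - 2 * K - (len q + block_len)"
    have ad: "admissible (len q) (cost q) q k" by (rule pick_SomeD[OF Some])
    then have "?r < block_len" using block_len_pos by (auto simp: admissible_def)
    note Dr = pad_cost_ge[OF this]
    \<comment> \<open>Only target words with \<open>\<phi>\<close> at least exp(-k b) are inserted,
      so the factor exp(k b) in the cost pays for them.\<close>
    have lam: "1 \<le> exp (real k * b) * \<phi> s (lam k)"
      using ad mult_left_mono[of "exp (- (real k * b))" "\<phi> s (lam k)" "exp (real k * b)"]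
      by (simp add: admissible_def exp_add[symmetric])
    have "1 * 1 \<le> (pad_cost * (C * C * \<phi> s (padding ?r))) * (exp (real k * b) * \<phi> s (lam k))"
      using Dr lam by (intro mult_mono) auto
    then have "cost q * \<phi> s ?p * 1 \<le> cost q * \<phi> s ?p * ((pad_cost * (C * C * \<phi> s (padding ?r))) * (exp (real k * b) * \<phi> s (lam k)))"
      using cost_pos[of q] \<phi>_s_pos[of ?p] by (intro mult_left_mono) auto
    also have "\<dots> = cost (Suc q) * (C * (C * \<phi> s ?p * \<phi> s (padding ?r)) * \<phi> s (lam k))"
      using Some by simp
    also have "\<dots> \<le> cost (Suc q) * (C * \<phi> s (join ?p (padding ?r)) * \<phi> s (lam k))"
      using cost_pos[of "Suc q"] C \<phi>_s_pos[of "lam k"] by (intro mult_left_mono mult_right_mono \<phi>_join) auto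
    also have "\<dots> \<le> cost (Suc q) * \<phi> s (join (join ?p (padding ?r)) (lam k))"
      using cost_pos[of "Suc q"] by (intro mult_left_mono \<phi>_join) auto
    finally have "cost q * \<phi> s ?p \<le> cost (Suc q) * \<phi> s (prefix_word \<omega> (Suc q))" using Some by simp
    then show ?thesis using 1 by linarith
  qed
qed

lemma prefix_word_Suc: "\<exists>v. prefix_word \<omega> (Suc q) = join (prefix_word \<omega> q) (\<omega> q) @ v"
proof (cases "choice q")
  case (Some k)
  then show ?thesis by (simp add: join_def[of "join _ _"] join_def[of "_ @ _"])
qed simp

lemma prefix_word_mono: "q \<le> q' \<Longrightarrow> \<exists>v. prefix_word \<omega> q' = prefix_word \<omega> q @ v"
proof (induction q' rule: dec_induct)
  case (step n)
  then show ?case using prefix_word_Suc[of n] by (auto simp: join_def)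
qed simp

lemma len_Suc_ge: "len q + block_len \<le> len (Suc q)"
  using length_prefix_word[of q] length_prefix_word[of "Suc q"] prefix_word_Suc[of q] by (auto simp: length_join length_block block_len_def)

lemma len_ge: "q \<le> len q"
proof (induction q)
  case (Suc q) then show ?case using len_Suc_ge[of q] block_len_pos by linarith
qed simp

lemma point_nth:
  assumes n: "n < len q" shows "point \<omega> !! n = prefix_word \<omega> q ! n"
proof -
  have 1: "n < len (Suc n)" using len_ge[of "Suc n"] by simp
  have "prefix_word \<omega> (Suc n) ! n = prefix_word \<omega> q ! n"
  proof (cases "q \<le> Suc n")
    case True
    then show ?thesis using prefix_word_mono[OF True] n by (auto simp: nth_append length_prefix_word)
  next
    case False
    then have "Suc n \<le> q" by simp
    from prefix_word_mono[OF this] show ?thesis using 1 length_prefix_word[of "Suc n"] by (metis nth_append)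
  qed
  then show ?thesis by (simp add: point_def snth_fromN del: prefix_word.simps)
qed

lemma stake_point: "n \<le> len q \<Longrightarrow> stake n (point \<omega>) = take n (prefix_word \<omega> q)"
  by (rule nth_equalityI) (auto simp: length_prefix_word point_nth)

lemma stake_len_point: "stake (len q) (point \<omega>) = prefix_word \<omega> q"
  using stake_point[of "len q" q] length_prefix_word[of q] by simp

lemma point_hits: 
  assumes "choice q = Some k" shows "sdrop k (point \<omega>) \<in> cylinder (lam k)"
proof -
  let ?p = "join (join (prefix_word \<omega> q) (\<omega> q)) (padding (k - 2 * K - (len q + block_len)))"
  let ?u = "?p @ conn ?p (lam k)"
  have ad: "admissible (len q) (cost q) q k" by (rule pick_SomeD[OF assms])
  have pw: "prefix_word \<omega> (Suc q) = ?u @ lam k" using assms by (simp add: join_def[of _ "lam k"])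
  have lu: "length ?u = k" using ad by (simp add: length_join length_conn length_prefix_word length_block block_len_def admissible_def padding_def)
  have ls: "len (Suc q) = k + length (lam k)" using assms by simp
  have "stake k (point \<omega>) @ stake (length (lam k)) (sdrop k (point \<omega>)) = ?u @ lam k"
    unfolding stake_add pw[symmetric] ls[symmetric] by (rule stake_len_point)
  then have "stake (length (lam k)) (sdrop k (point \<omega>)) = lam k"
    by (subst (asm) append_eq_append_conv) (auto simp: lu)
  then show ?thesis by (simp add: cylinder_def)
qed

end

text \<open>If insertions stopped, the cost would stay constant while the budget kept growing at a
  rate per letter above b. A sufficiently late good position would then be affordable at the stage
  that reaches it.\<close>

lemma choice_frequently: "\<exists>q\<ge>q0. choice q \<noteq> None"
proof (rule ccontr)
  assume "\<not> ?thesis"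
  then have none: "\<And>q. q \<ge> q0 \<Longrightarrow> choice q = None" by blast
  have st: "len (q0 + i) = len q0 + i * block_len \<and> cost (q0 + i) = cost q0" for i
  proof (induction i)
    case (Suc i)
    have "state (Suc (q0 + i)) = (len (q0 + i) + block_len, cost (q0 + i))" using none[of "q0 + i"] by simp
    then show ?case using Suc.IH by (simp del: state.simps)
  qed simp
  \<comment> \<open>The growth rate of the budget per letter; it exceeds b by the choice of
    \<open>\<theta>'\<close>.\<close>
  define \<tau> where "\<tau> = ln \<theta>' / real block_len"
  have M0: "real block_len > 0" using block_len_pos by simp
  have t0: "\<theta>' > 0" using theta_bounds(1) by linarith
  have "ln (exp (b * real block_len)) < ln \<theta>'" using theta_bounds(2) t0 by (subst ln_less_cancel_iff) auto
  then have \<tau>: "b < \<tau>" using M0 by (simp add: \<tau>_def field_simps)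
  define c where "c = len q0 + block_len + 2 * K"
  obtain N :: nat where N: "real N > (ln (cost q0 * pad_cost) + \<tau> * real c) / (\<tau> - b)" using reals_Archimedean2 by blast
  obtain k where k: "k \<ge> max N c" "exp (- (real k * b)) \<le> \<phi> s (lam k)" using good unfolding INFM_nat_le by blast
  \<comment> \<open>Without insertions the windows of successive stages are adjacent intervals of
    length \<open>block_len\<close> starting at c. This is the index of the one that contains
    k.\<close>
  define i where "i = (k - c) div block_len"
  have i: "i * block_len \<le> k - c" "k - c < i * block_len + block_len"
    using block_len_pos dividend_less_div_times[of block_len "k - c"] by (auto simp: i_def)
  have "cost q0 * pad_cost * exp (real k * b) \<le> \<theta>' ^ Suc (q0 + i)"
  proof -
    have "real k > (ln (cost q0 * pad_cost) + \<tau> * real c) / (\<tau> - b)" using N k(1) by (smt (verit) max.boundedE of_nat_le_iff)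
    then have "ln (cost q0 * pad_cost) + \<tau> * real c < real k * (\<tau> - b)" using \<tau> by (simp add: field_simps)
    then have "ln (cost q0 * pad_cost) + real k * b \<le> \<tau> * (real k - real c)" by (simp add: algebra_simps)
    also have "\<dots> \<le> \<tau> * (real (Suc (q0 + i)) * real block_len)"
    proof (intro mult_left_mono)
      have "real (k - c) < real (i * block_len + block_len)" using i(2) by (simp only: of_nat_less_iff)
      then have "real k - real c < real i * real block_len + real block_len" using k(1) by simp
      also have "\<dots> \<le> real (Suc (q0 + i)) * real block_len" by (simp add: algebra_simps)
      finally show "real k - real c \<le> real (Suc (q0 + i)) * real block_len" by simp
    qed (use \<tau> b in auto)
    also have "\<dots> = real (Suc (q0 + i)) * ln \<theta>'" using M0 by (simp add: \<tau>_def)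
    finally have "exp (ln (cost q0 * pad_cost) + real k * b) \<le> exp (real (Suc (q0 + i)) * ln \<theta>')" by simp
    then show ?thesis
      using cost_pos[of q0] pad_cost_pos t0 by (simp only: exp_add exp_of_nat_mult exp_ln mult_pos_pos)
  qed
  then have "admissible (len (q0 + i)) (cost (q0 + i)) (q0 + i) k"
    unfolding admissible_def using st[of i] k i by (auto simp: c_def)
  then have "choice (q0 + i) \<noteq> None" unfolding pick_def by auto
  then show False using none[of "q0 + i"] by simp
qed

lemma point_in_target:
  assumes \<omega>: "block_seq \<omega>"
  shows "\<exists>\<^sub>\<infinity>k. sdrop k (point \<omega>) \<in> cylinder (lam k)"
  unfolding INFM_nat_le
proof
  fix n
  obtain q k where q: "q \<ge> n" "choice q = Some k" using choice_frequently[of n] by blast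
  have "q \<le> len q" by (rule len_ge[OF \<omega>])
  also have "len q \<le> k" using pick_SomeD[OF q(2)] by (simp add: admissible_def)
  finally show "\<exists>k\<ge>n. sdrop k (point \<omega>) \<in> cylinder (lam k)"
    using point_hits[OF \<omega> q(2)] q(1) by (intro exI[of _ k]) simp
qed

text \<open>An upper bound for the inverse of \<open>\<phi>\<close> at the common prefix of two
  points that first differ in block q. The insertion that may follow block q comes after the
  difference, so the cost is taken at q, while block q itself is counted.\<close>

definition kernel :: "(nat \<Rightarrow> 'n list) \<Rightarrow> nat \<Rightarrow> real" where
  "kernel \<omega> q = subC s * cost q / (\<Prod>i<Suc q. C * \<phi> s (\<omega> i))"

text \<open>The terms of the energy series stay away from 0, so the series diverges on the diagonal,
  where the bound by the series has to hold trivially.\<close>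

lemma kernel_ge: 
  assumes \<omega>: "block_seq \<omega>"
  shows "subC s / C \<le> kernel \<omega> q"
proof -
  have "(\<Prod>i<q. C * \<phi> s (\<omega> i)) \<le> cost q * \<phi> s (prefix_word \<omega> q)" by (rule \<phi>_prefix_word[OF \<omega>])
  also have "\<dots> \<le> cost q * 1" using cost_pos[of q] \<phi>_le_1[OF s] by (intro mult_left_mono) auto
  finally have "(\<Prod>i<q. C * \<phi> s (\<omega> i)) * (C * \<phi> s (\<omega> q)) \<le> cost q * (C * 1)"
    using C \<phi>_s_pos[of "\<omega> q"] \<phi>_le_1[OF s, of "\<omega> q"] cost_pos[of q] by (intro mult_mono mult_left_mono) auto
  then have le: "(\<Prod>i<Suc q. C * \<phi> s (\<omega> i)) \<le> cost q * C" by simp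
  have p: "0 < (\<Prod>i<Suc q. C * \<phi> s (\<omega> i))" using C \<phi>_s_pos by (intro prod_pos) auto
  have "subC s / C = subC s * cost q / (cost q * C)" using cost_pos[of q] by simp
  also have "\<dots> \<le> kernel \<omega> q"
    unfolding kernel_def using le p C cost_pos[of q] subC(1)[OF s] by (intro divide_left_mono mult_pos_pos mult_nonneg_nonneg) auto
  finally show ?thesis .
qed

text \<open>The first differing letter may lie before block q itself, since a connecting word
  depends also on the block after it. The weight is therefore estimated at the end of block q, where
  the words certainly differ, and passed to the shorter common prefix by
  \<open>\<phi>_append_le\<close>.\<close>

lemma first_difference:
  assumes \<omega>: "block_seq \<omega>" and \<omega>': "block_seq \<omega>'"
    and agree: "\<And>i. i < q \<Longrightarrow> \<omega> i = \<omega>' i" and diff: "\<omega> q \<noteq> \<omega>' q"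
  shows "\<exists>k. stake k (point \<omega>) = stake k (point \<omega>') \<and> point \<omega> !! k \<noteq> point \<omega>' !! k \<and> 1 / \<phi> s (stake k (point \<omega>)) \<le> kernel \<omega> q"
proof -
  let ?p = "\<lambda>\<omega>. join (prefix_word \<omega> q) (\<omega> q)"
  have pref: "stake (len q + block_len) (point \<omega>) = ?p \<omega>" if \<omega>: "block_seq \<omega>" for \<omega>
  proof -
    obtain v where v: "prefix_word \<omega> (Suc q) = ?p \<omega> @ v" using prefix_word_Suc[OF \<omega>] by blast
    have "length (?p \<omega>) = len q + block_len" by (simp add: length_join length_prefix_word[OF \<omega>] length_block[OF \<omega>] block_len_def)
    then show ?thesis unfolding stake_point[OF \<omega> len_Suc_ge[OF \<omega>]] v by simp
  qed
  have "?p \<omega> \<noteq> ?p \<omega>'"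
  proof
    assume "?p \<omega> = ?p \<omega>'"
    \<comment> \<open>Removing the old prefix and the connecting word leaves precisely the block
      q.\<close>
    then have "drop (len q + K) (?p \<omega>) = drop (len q + K) (?p \<omega>')" by simp
    then show False using diff
      by (simp add: join_def length_conn length_prefix_word[OF \<omega>] length_prefix_word[OF \<omega>'])
  qed
  then have ne: "stake (len q + block_len) (point \<omega>) \<noteq> stake (len q + block_len) (point \<omega>')" by (simp add: pref \<omega> \<omega>')
  have ex: "\<exists>k<len q + block_len. point \<omega> !! k \<noteq> point \<omega>' !! k"
  proof (rule ccontr)
    assume "\<not> ?thesis"
    then have "stake (len q + block_len) (point \<omega>) = stake (len q + block_len) (point \<omega>')" by (intro nth_equalityI) auto
    then show False using ne by simp
  qed
  define k where "k = (LEAST k. point \<omega> !! k \<noteq> point \<omega>' !! k)"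
  have k1: "point \<omega> !! k \<noteq> point \<omega>' !! k" unfolding k_def using ex by (metis (mono_tags) LeastI_ex)
  have kl: "j < k \<Longrightarrow> point \<omega> !! j = point \<omega>' !! j" for j unfolding k_def using not_less_Least by blast
  have k2: "k < len q + block_len" 
  proof -
    obtain k0 where k0: "k0 < len q + block_len" "point \<omega> !! k0 \<noteq> point \<omega>' !! k0" using ex by blast
    have "k \<le> k0" unfolding k_def by (rule Least_le) (rule k0(2))
    then show ?thesis using k0(1) by simp
  qed
  have k3: "stake k (point \<omega>) = stake k (point \<omega>')" by (intro nth_equalityI) (auto simp: kl)
  let ?u = "stake k (point \<omega>)"
  have "?p \<omega> = ?u @ stake (len q + block_len - k) (sdrop k (point \<omega>))"
    unfolding pref[OF \<omega>, symmetric] using k2 by (simp add: stake_add)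
  then have "\<phi> s (?p \<omega>) \<le> subC s * \<phi> s ?u"
    using \<phi>_append_le[OF s, of ?u "stake (len q + block_len - k) (sdrop k (point \<omega>))"] by (simp only:)
  have "(\<Prod>i<Suc q. C * \<phi> s (\<omega> i)) \<le> (cost q * \<phi> s (prefix_word \<omega> q)) * (C * \<phi> s (\<omega> q))"
    using \<phi>_prefix_word[OF \<omega>, of q] C \<phi>_s_pos[of "\<omega> q"] by (simp add: mult_right_mono)
  also have "\<dots> = cost q * (C * \<phi> s (prefix_word \<omega> q) * \<phi> s (\<omega> q))" by simp
  also have "\<dots> \<le> cost q * \<phi> s (?p \<omega>)" using cost_pos[of q] by (intro mult_left_mono \<phi>_join) auto
  also have "\<dots> \<le> cost q * (subC s * \<phi> s ?u)"
    using \<open>\<phi> s (?p \<omega>) \<le> subC s * \<phi> s ?u\<close> cost_pos[of q] by (intro mult_left_mono) auto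
  finally have "(\<Prod>i<Suc q. C * \<phi> s (\<omega> i)) \<le> subC s * cost q * \<phi> s ?u" by (simp add: mult_ac)
  moreover have "0 < (\<Prod>i<Suc q. C * \<phi> s (\<omega> i))" using C \<phi>_s_pos by (intro prod_pos) auto
  ultimately have "1 / \<phi> s ?u \<le> kernel \<omega> q" unfolding kernel_def using \<phi>_s_pos[of ?u] by (simp add: field_simps)
  then show ?thesis using k1 k3 by blast
qed

section \<open>The law of the random block sequence and its energy\<close>

definition block_measure :: "'n list measure" where
  "block_measure = point_measure {w. length w = m} (\<lambda>w. ennreal (\<phi> s w / Z s m))"

definition prob_M :: "(nat \<Rightarrow> 'n list) measure" where
  "prob_M = (\<Pi>\<^sub>M i\<in>UNIV. block_measure)"

lemma emeasure_block: "length w = m \<Longrightarrow> emeasure block_measure {w} = ennreal (\<phi> s w / Z s m)"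
  unfolding block_measure_def using finite_words[OF s] by (subst emeasure_point_measure_finite) auto

lemma prob_space_block: "prob_space block_measure"
proof
  have "emeasure block_measure (space block_measure) = (\<Sum>w | length w = m. ennreal (\<phi> s w / Z s m))"
    unfolding block_measure_def using finite_words[OF s] by (subst emeasure_point_measure_finite) (auto simp: space_point_measure)
  also have "\<dots> = ennreal (\<Sum>w | length w = m. \<phi> s w / Z s m)"
    using \<phi>_s_pos[THEN less_imp_le] Z_pos[OF s, of m] by (intro sum_ennreal) auto
  also have "(\<Sum>w | length w = m. \<phi> s w / Z s m) = 1"
    unfolding sum_divide_distrib[symmetric] Z_def[symmetric] using Z_pos[OF s, of m] by simp
  finally show "emeasure block_measure (space block_measure) = 1" by simp
qed

lemma product_prob_block: "product_prob_space (\<lambda>_::nat. block_measure)"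
  by (intro product_prob_spaceI prob_space_block)

lemma prob_space_M: "prob_space prob_M"
  unfolding prob_M_def by (intro prob_space_PiM prob_space_block)

lemma space_M: "\<omega> \<in> space prob_M \<Longrightarrow> length (\<omega> q) = m"
  by (auto simp: prob_M_def space_PiM block_measure_def space_point_measure PiE_iff)

lemma block_seq_space_M: "\<omega> \<in> space prob_M \<Longrightarrow> block_seq \<omega>"
  by (simp add: block_seq_def space_M)

lemma measurable_component: "(\<lambda>\<omega>. \<omega> q) \<in> measurable prob_M (count_space UNIV)"
proof -
  have "(\<lambda>\<omega>. \<omega> q) \<in> measurable prob_M block_measure"
    unfolding prob_M_def by (rule measurable_component_singleton) simp
  moreover have "(\<lambda>w. w) \<in> measurable block_measure (count_space UNIV)"
    by (auto simp: measurable_def block_measure_def sets_point_measure space_point_measure)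
  ultimately show ?thesis by (rule measurable_compose)
qed

lemma agree_sets: "{\<omega>'\<in>space prob_M. \<forall>i<q. \<omega>' i = \<omega> i} \<in> sets prob_M"
proof -
  have "{\<omega>'\<in>space prob_M. \<omega>' i = \<omega> i} \<in> sets prob_M" for i
    using measurable_sets[OF measurable_component[of i], of "{\<omega> i}"] by (simp add: vimage_def Int_def conj_commute)
  then have "{\<omega>'\<in>space prob_M. \<forall>i\<in>{..<q}. \<omega>' i = \<omega> i} \<in> sets prob_M"
    by (intro sets.sets_Collect_finite_All) simp_all
  then show ?thesis by (simp only: Ball_def lessThan_iff)
qed

lemma emeasure_agree:
  assumes \<omega>: "\<omega> \<in> space prob_M"
  shows "emeasure prob_M {\<omega>'\<in>space prob_M. \<forall>i<q. \<omega>' i = \<omega> i} = ennreal (\<Prod>i<q. \<phi> s (\<omega> i) / Z s m)"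
proof -
  interpret product_prob_space "\<lambda>_::nat. block_measure" UNIV by (rule product_prob_block)
  have "{\<omega>'\<in>space prob_M. \<forall>i<q. \<omega>' i = \<omega> i} = {\<omega>'\<in>space (PiM UNIV (\<lambda>_. block_measure)). \<forall>i\<in>{..<q}. \<omega>' i \<in> {\<omega> i}}"
    by (auto simp: prob_M_def)
  moreover have "emeasure (PiM UNIV (\<lambda>_. block_measure)) {\<omega>'\<in>space (PiM UNIV (\<lambda>_. block_measure)). \<forall>i\<in>{..<q}. \<omega>' i \<in> {\<omega> i}} = (\<Prod>i<q. emeasure block_measure {\<omega> i})"
    using space_M[OF \<omega>] by (intro emeasure_PiM_Collect) (auto simp: block_measure_def sets_point_measure)
  moreover have "(\<Prod>i<q. emeasure block_measure {\<omega> i}) = (\<Prod>i<q. ennreal (\<phi> s (\<omega> i) / Z s m))"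
    using space_M[OF \<omega>] by (intro prod.cong refl emeasure_block) auto
  moreover have "\<dots> = ennreal (\<Prod>i<q. \<phi> s (\<omega> i) / Z s m)"
    using \<phi>_s_pos[THEN less_imp_le] Z_pos[OF s, of m] by (intro prod_ennreal) auto
  ultimately show ?thesis by (simp add: prob_M_def)
qed

text \<open>Value of a geometric series of ratio \<open>\<theta>'\<close> / \<theta>. The sum over w
  bounds the inverse weight of block q, the one block in the kernel that agreement of the first q
  blocks does not compensate.\<close>

definition energy_bound where "energy_bound = subC s * (\<Sum>w | length w = m. 1 / (C * \<phi> s w)) / (1 - \<theta>' / \<theta>)"

lemma energy_bound_nonneg: "0 \<le> energy_bound"
  unfolding energy_bound_def using subC(1)[OF s] C \<phi>_s_pos[THEN less_imp_le] theta_bounds by (intro divide_nonneg_nonneg mult_nonneg_nonneg sum_nonneg) auto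

text \<open>The probability that the first q blocks agree is the product of their normalised weights
  and cancels the same weights in the kernel. What remains is \<open>cost q\<close> / \<theta> ^ q
  times a constant, and the budget bounds the cost by \<open>\<theta>'\<close> ^ q.\<close>

lemma energy_le:
  assumes \<omega>: "\<omega> \<in> space prob_M"
  shows "(\<integral>\<^sup>+\<omega>'. (\<Sum>q. ennreal (kernel \<omega> q) * indicator {\<omega>'\<in>space prob_M. \<forall>i<q. \<omega>' i = \<omega> i} \<omega>') \<partial>prob_M) \<le> ennreal energy_bound"
proof -
  let ?B = "\<Sum>w | length w = m. 1 / (C * \<phi> s w)"
  have q: "0 \<le> \<theta>' / \<theta>" "\<theta>' / \<theta> < 1" using theta_bounds by auto
  have B0: "0 \<le> ?B" using C \<phi>_s_pos[THEN less_imp_le] by (intro sum_nonneg) auto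
  have "(\<integral>\<^sup>+\<omega>'. (\<Sum>q. ennreal (kernel \<omega> q) * indicator {\<omega>'\<in>space prob_M. \<forall>i<q. \<omega>' i = \<omega> i} \<omega>') \<partial>prob_M)
      = (\<Sum>q. \<integral>\<^sup>+\<omega>'. ennreal (kernel \<omega> q) * indicator {\<omega>'\<in>space prob_M. \<forall>i<q. \<omega>' i = \<omega> i} \<omega>' \<partial>prob_M)"
    by (intro nn_integral_suminf borel_measurable_times_ennreal borel_measurable_const borel_measurable_indicator agree_sets)
  also have "\<dots> = (\<Sum>q. ennreal (\<Prod>i<q. \<phi> s (\<omega> i) / Z s m) * ennreal (kernel \<omega> q))"
    unfolding nn_integral_cmult_indicator[OF agree_sets] emeasure_agree[OF \<omega>] by (simp only: mult.commute)
  also have "\<dots> \<le> (\<Sum>q. ennreal (subC s * ?B * (\<theta>' / \<theta>) ^ q))"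
  proof (intro suminf_le)
    fix q
    have pp: "0 < (\<Prod>i<q. \<phi> s (\<omega> i))" using \<phi>_s_pos by (intro prod_pos) auto
    have Bq: "1 / (C * \<phi> s (\<omega> q)) \<le> ?B"
      using finite_words[OF s] space_M[OF \<omega>] C \<phi>_s_pos[THEN less_imp_le] by (intro member_le_sum) auto
    have zp: "0 < Z s m" using Z_pos[OF s] .
    have "(\<Prod>i<q. \<phi> s (\<omega> i) / Z s m) * kernel \<omega> q = subC s * (1 / (C * \<phi> s (\<omega> q))) * (cost q / \<theta> ^ q)"
    proof -
      define p where "p = (\<Prod>i<q. \<phi> s (\<omega> i))"
      have k: "kernel \<omega> q = subC s * cost q / ((C ^ q * p) * (C * \<phi> s (\<omega> q)))"
        by (simp add: kernel_def p_def prod.distrib)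
      have z: "(\<Prod>i<q. \<phi> s (\<omega> i) / Z s m) = p / Z s m ^ q" by (simp add: prod_dividef p_def)
      show ?thesis unfolding k z \<theta>_def using pp[folded p_def] zp C \<phi>_s_pos[of "\<omega> q"]
        by (simp add: power_mult_distrib field_simps)
    qed
    also have "\<dots> \<le> subC s * ?B * (\<theta>' / \<theta>) ^ q"
    proof (rule mult_mono)
      show "subC s * (1 / (C * \<phi> s (\<omega> q))) \<le> subC s * ?B" using Bq subC(1)[OF s] by (intro mult_left_mono) auto
      show "0 \<le> subC s * ?B" using B0 subC(1)[OF s] by (intro mult_nonneg_nonneg) auto
      show "0 \<le> cost q / \<theta> ^ q" using cost_pos[of q] theta_bounds(4) by simp
      show "cost q / \<theta> ^ q \<le> (\<theta>' / \<theta>) ^ q"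
        unfolding power_divide using theta_bounds cost_le[of q] by (intro divide_right_mono) auto
    qed
    finally have "(\<Prod>i<q. \<phi> s (\<omega> i) / Z s m) * kernel \<omega> q \<le> subC s * ?B * (\<theta>' / \<theta>) ^ q" .
    moreover have "0 \<le> (\<Prod>i<q. \<phi> s (\<omega> i) / Z s m)" using \<phi>_s_pos[THEN less_imp_le] zp by (intro prod_nonneg) auto
    ultimately show "ennreal (\<Prod>i<q. \<phi> s (\<omega> i) / Z s m) * ennreal (kernel \<omega> q) \<le> ennreal (subC s * ?B * (\<theta>' / \<theta>) ^ q)"
      by (subst ennreal_mult'[symmetric]) (auto intro: ennreal_leI)
  qed auto
  also have "\<dots> = ennreal energy_bound"
  proof (rule suminf_ennreal_eq)
    show "(\<lambda>q. subC s * ?B * (\<theta>' / \<theta>) ^ q) sums energy_bound"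
      using sums_mult[OF geometric_sums[of "\<theta>' / \<theta>"], of "subC s * ?B"] q by (simp add: energy_bound_def)
    show "0 \<le> subC s * ?B * (\<theta>' / \<theta>) ^ q" for q
      using subC(1)[OF s] B0 theta_bounds by (intro mult_nonneg_nonneg zero_le_power) auto
  qed
  finally show ?thesis .
qed

text \<open>The one relevant term, at the first difference, is replaced by the sum over all q up to
  it. The sum is an upper bound built from indicators of agreement, whose integrals are known
  explicitly.\<close>

lemma transversality_kernel:
  assumes \<rho>: "\<rho> \<ge> 1" and r: "r > 0" and \<omega>: "\<omega> \<in> space prob_M" and \<omega>': "\<omega>' \<in> space prob_M" and pc: "0 < trans_const \<rho>"
  shows "emeasure lborel {T \<in> cube \<rho>. dist (natural_proj A T (point \<omega>)) (natural_proj A T (point \<omega>')) \<le> r}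
    \<le> ennreal (trans_const \<rho> * r powr s) * (\<Sum>q. ennreal (kernel \<omega> q) * indicator {\<omega>'\<in>space prob_M. \<forall>i<q. \<omega>' i = \<omega> i} \<omega>')"
    (is "_ \<le> _ * (\<Sum>q. ?t q)")
proof (cases "\<omega> = \<omega>'")
  case True
  have "(\<Sum>q. ?t q) = (\<Sum>q. ennreal (kernel \<omega> q))" using \<omega> by (simp add: True)
  \<comment> \<open>Equal block sequences give distance 0, for which transversality says nothing;
    the right-hand side is infinite there.\<close>
  moreover have "(\<Sum>q. ennreal (kernel \<omega> q)) = top"
  proof (rule ccontr)
    have k0: "0 < subC s / C" using subC(1)[OF s] C by simp
    have kge: "subC s / C \<le> kernel \<omega> q" for q by (rule kernel_ge[OF block_seq_space_M[OF \<omega>]])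
    assume "(\<Sum>q. ennreal (kernel \<omega> q)) \<noteq> top"
    then have "summable (kernel \<omega>)" using k0 kge by (intro summable_suminf_not_top) (auto intro: order_trans less_imp_le)
    then have "kernel \<omega> \<longlonglongrightarrow> 0" by (rule summable_LIMSEQ_zero)
    then have "subC s / C \<le> 0" by (rule tendsto_lowerbound) (auto simp: kge)
    then show False using k0 by simp
  qed
  ultimately show ?thesis using pc r by (simp add: ennreal_mult_top)
next
  case False
  then obtain q0 where "\<omega> q0 \<noteq> \<omega>' q0" by blast
  define q where "q = (LEAST q. \<omega> q \<noteq> \<omega>' q)"
  have q: "\<omega> q \<noteq> \<omega>' q" unfolding q_def using \<open>\<omega> q0 \<noteq> \<omega>' q0\<close> by (rule LeastI)
  have q': "\<omega> i = \<omega>' i" if "i < q" for i using not_less_Least that unfolding q_def by blast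
  obtain k where k: "stake k (point \<omega>) = stake k (point \<omega>')" "point \<omega> !! k \<noteq> point \<omega>' !! k" "1 / \<phi> s (stake k (point \<omega>)) \<le> kernel \<omega> q"
    using first_difference[OF block_seq_space_M[OF \<omega>] block_seq_space_M[OF \<omega>'] q' q] by blast
  have "emeasure lborel {T \<in> cube \<rho>. dist (natural_proj A T (point \<omega>)) (natural_proj A T (point \<omega>')) \<le> r}
      \<le> ennreal (trans_const \<rho> * (r powr s / \<phi> s (stake k (point \<omega>))))"
    by (rule transversality[OF s \<rho> r k(1,2)])
  also have "\<dots> \<le> ennreal (trans_const \<rho> * r powr s * kernel \<omega> q)"
    using mult_left_mono[OF k(3), of "trans_const \<rho> * r powr s"] pc by (intro ennreal_leI) simp
  also have "\<dots> = ennreal (trans_const \<rho> * r powr s) * ?t q"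
    using pc q' \<omega>' by (simp add: ennreal_mult')
  also have "\<dots> \<le> ennreal (trans_const \<rho> * r powr s) * (\<Sum>q. ?t q)"
  proof (rule mult_left_mono)
    define g where "g = ?t"
    have "sum g {q} \<le> suminf g" by (rule sum_le_suminf) simp_all
    then have "g q \<le> suminf g" by simp
    then show "?t q \<le> (\<Sum>q. ?t q)" unfolding g_def .
  qed simp
  finally show ?thesis .
qed

lemma measurable_prefix_word: "(\<lambda>\<omega>. prefix_word \<omega> q) \<in> measurable prob_M (count_space UNIV)"
proof (induction q)
  case (Suc q)
  define g where "g = (\<lambda>(u, w). case choice q of None \<Rightarrow> join u w
    | Some k \<Rightarrow> join (join (join u w) (padding (k - 2 * K - (len q + block_len)))) (lam k))"
  have "(\<lambda>\<omega>. (prefix_word \<omega> q, \<omega> q)) \<in> measurable prob_M (count_space UNIV \<Otimes>\<^sub>M count_space UNIV)"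
    by (intro measurable_Pair Suc.IH measurable_component)
  then have "(\<lambda>\<omega>. (prefix_word \<omega> q, \<omega> q)) \<in> measurable prob_M (count_space UNIV)"
    by (simp add: pair_measure_countable)
  then have "(\<lambda>\<omega>. g (prefix_word \<omega> q, \<omega> q)) \<in> measurable prob_M (count_space UNIV)"
    by (rule measurable_compose) simp
  then show ?case by (simp add: g_def cong: option.case_cong)
qed simp

text \<open>The projection is a limit of maps that are continuous in T and see the block sequence
  only through a prefix, which takes countably many values.\<close>

lemma measurable_natural_proj_point:
  "(\<lambda>p. natural_proj A (fst p) (point (snd p))) \<in> borel_measurable (lborel \<Otimes>\<^sub>M prob_M)"
proof (rule borel_measurable_LIMSEQ_metric)
  fix n
  have cont: "continuous_on UNIV (\<lambda>T. f T w 0)" for w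
    by (induction w) (auto simp: affine_map_def intro!: continuous_intros continuous_on_compose2[OF matrix_vector_mult_linear_continuous_on])
  have 1: "(\<lambda>p. f (fst p) (take n w) 0) \<in> borel_measurable (lborel \<Otimes>\<^sub>M prob_M)" for w
    using borel_measurable_continuous_onI[OF cont[of "take n w"]] by (intro measurable_compose[OF measurable_fst]) simp
  have 2: "(\<lambda>p. prefix_word (snd p) n) \<in> measurable (lborel \<Otimes>\<^sub>M prob_M) (count_space UNIV)"
    by (rule measurable_compose[OF measurable_snd measurable_prefix_word])
  show "(\<lambda>p. f (fst p) (take n (prefix_word (snd p) n)) 0) \<in> borel_measurable (lborel \<Otimes>\<^sub>M prob_M)"
    by (rule measurable_compose_countable[OF 1 2])
next
  fix p :: "((real ^ 'd) ^ 'n) \<times> (nat \<Rightarrow> 'n list)" assume "p \<in> space (lborel \<Otimes>\<^sub>M prob_M)"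
  then have "snd p \<in> space prob_M" by (auto simp: space_pair_measure)
  then have "take n (prefix_word (snd p) n) = stake n (point (snd p))" for n
    using stake_point[OF block_seq_space_M len_ge[OF block_seq_space_M]] by simp
  then show "(\<lambda>n. f (fst p) (take n (prefix_word (snd p) n)) 0) \<longlonglongrightarrow> natural_proj A (fst p) (point (snd p))"
    using natural_proj_LIMSEQ by simp
qed

text \<open>The order of integration is reversed: for a fixed pair of points the parameter is
  integrated first, where transversality applies, and the result is then averaged over the pair by
  the energy estimate.\<close>

lemma correlation_le:
  assumes \<rho>: "\<rho> \<ge> 1" and r: "r > 0"
  shows "(\<integral>\<^sup>+T. indicator (cube \<rho>) T * emeasure (prob_M \<Otimes>\<^sub>M prob_M)
      {p \<in> space (prob_M \<Otimes>\<^sub>M prob_M). dist (natural_proj A T (point (fst p))) (natural_proj A T (point (snd p))) \<le> r} \<partial>lborel)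
    \<le> ennreal (trans_const \<rho> * energy_bound * r powr s)"
proof -
  interpret M: prob_space prob_M by (rule prob_space_M)
  interpret MM: pair_prob_space prob_M prob_M ..
  interpret Q: pair_sigma_finite "lborel :: ((real^'d)^'n) measure" "prob_M \<Otimes>\<^sub>M prob_M" ..
  let ?X = "\<lambda>T \<omega>. natural_proj A T (point \<omega>)"
  note [measurable] = measurable_natural_proj_point
  define S where "S T = {p \<in> space (prob_M \<Otimes>\<^sub>M prob_M). dist (?X T (fst p)) (?X T (snd p)) \<le> r}" for T
  have X1: "(\<lambda>(T, p). ?X T (fst p)) \<in> borel_measurable (lborel \<Otimes>\<^sub>M (prob_M \<Otimes>\<^sub>M prob_M))"
    using measurable_compose[of "\<lambda>(T, p). (T, fst p)" "lborel \<Otimes>\<^sub>M (prob_M \<Otimes>\<^sub>M prob_M)" "lborel \<Otimes>\<^sub>M prob_M", OF _ measurable_natural_proj_point]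
    by (simp add: case_prod_beta')
  have X2: "(\<lambda>(T, p). ?X T (snd p)) \<in> borel_measurable (lborel \<Otimes>\<^sub>M (prob_M \<Otimes>\<^sub>M prob_M))"
    using measurable_compose[of "\<lambda>(T, p). (T, snd p)" "lborel \<Otimes>\<^sub>M (prob_M \<Otimes>\<^sub>M prob_M)" "lborel \<Otimes>\<^sub>M prob_M", OF _ measurable_natural_proj_point]
    by (simp add: case_prod_beta')
  have XT: "?X T \<in> borel_measurable prob_M" for T
    using measurable_compose[OF measurable_Pair1', OF _ measurable_natural_proj_point, of T] by simp
  have S[measurable]: "S T \<in> sets (prob_M \<Otimes>\<^sub>M prob_M)" for T
  proof -
    have [measurable]: "?X T \<in> borel_measurable prob_M" by (rule XT)
    show ?thesis unfolding S_def by measurable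
  qed
  define g :: "(real^'d)^'n \<Rightarrow> (nat \<Rightarrow> 'n list) \<times> (nat \<Rightarrow> 'n list) \<Rightarrow> ennreal" where
    "g T p = indicator (cube \<rho>) T * indicator {x. x \<le> r} (dist (?X T (fst p)) (?X T (snd p)))" for T p
  have g[measurable]: "case_prod g \<in> borel_measurable (lborel \<Otimes>\<^sub>M (prob_M \<Otimes>\<^sub>M prob_M))"
  proof -
    have "(\<lambda>(T, p). dist (?X T (fst p)) (?X T (snd p))) \<in> borel_measurable (lborel \<Otimes>\<^sub>M (prob_M \<Otimes>\<^sub>M prob_M))"
      using borel_measurable_dist[OF X1 X2] by (simp add: case_prod_beta')
    then show ?thesis unfolding g_def by (simp add: case_prod_beta') measurable
  qed
  have sec: "(\<integral>\<^sup>+T. g T (\<omega>, \<omega>') \<partial>lborel) = emeasure lborel {T \<in> cube \<rho>. dist (?X T \<omega>) (?X T \<omega>') \<le> r}" for \<omega> \<omega>'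
  proof -
    have "continuous_on UNIV (\<lambda>T. dist (?X T \<omega>) (?X T \<omega>'))"
      by (intro continuous_on_dist continuous_natural_proj)
    then have "closed {T. dist (?X T \<omega>) (?X T \<omega>') \<le> r}" by (rule closed_Collect_le) (rule continuous_on_const)
    then have "cube \<rho> \<inter> {T. dist (?X T \<omega>) (?X T \<omega>') \<le> r} \<in> sets borel" by (intro sets.Int cube_borel borel_closed)
    moreover have "cube \<rho> \<inter> {T. dist (?X T \<omega>) (?X T \<omega>') \<le> r} = {T \<in> cube \<rho>. dist (?X T \<omega>) (?X T \<omega>') \<le> r}" by blast
    ultimately have "emeasure lborel {T \<in> cube \<rho>. dist (?X T \<omega>) (?X T \<omega>') \<le> r} = (\<integral>\<^sup>+T. indicator {T \<in> cube \<rho>. dist (?X T \<omega>) (?X T \<omega>') \<le> r} T \<partial>lborel)"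
      by simp
    also have "\<dots> = (\<integral>\<^sup>+T. g T (\<omega>, \<omega>') \<partial>lborel)"
      by (intro nn_integral_cong) (auto simp: g_def split: split_indicator)
    finally show ?thesis ..
  qed
  have pc: "0 < trans_const \<rho>" unfolding trans_const_def using eta \<rho> unit_ball_vol_pos[of "CARD('d)"]
    by (intro mult_pos_pos zero_less_power) (auto simp: field_simps)
  have "(\<integral>\<^sup>+T. indicator (cube \<rho>) T * emeasure (prob_M \<Otimes>\<^sub>M prob_M) (S T) \<partial>lborel)
      = (\<integral>\<^sup>+T. (\<integral>\<^sup>+p. g T p \<partial>(prob_M \<Otimes>\<^sub>M prob_M)) \<partial>lborel)"
  proof (intro nn_integral_cong)
    fix T
    have "(\<integral>\<^sup>+p. g T p \<partial>(prob_M \<Otimes>\<^sub>M prob_M)) = (\<integral>\<^sup>+p. indicator (cube \<rho>) T * indicator (S T) p \<partial>(prob_M \<Otimes>\<^sub>M prob_M))"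
      by (intro nn_integral_cong) (auto simp: g_def S_def split: split_indicator)
    also have "\<dots> = indicator (cube \<rho>) T * emeasure (prob_M \<Otimes>\<^sub>M prob_M) (S T)"
      by (rule nn_integral_cmult_indicator[OF S])
    finally show "indicator (cube \<rho>) T * emeasure (prob_M \<Otimes>\<^sub>M prob_M) (S T) = (\<integral>\<^sup>+p. g T p \<partial>(prob_M \<Otimes>\<^sub>M prob_M))" ..
  qed
  also have "\<dots> = (\<integral>\<^sup>+p. (\<integral>\<^sup>+T. g T p \<partial>lborel) \<partial>(prob_M \<Otimes>\<^sub>M prob_M))"
    by (rule Q.Fubini'[symmetric, OF g])
  also have "\<dots> = (\<integral>\<^sup>+\<omega>. \<integral>\<^sup>+\<omega>'. (\<integral>\<^sup>+T. g T (\<omega>, \<omega>') \<partial>lborel) \<partial>prob_M \<partial>prob_M)"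
    by (rule M.nn_integral_fst[symmetric]) measurable
  also have "\<dots> \<le> (\<integral>\<^sup>+\<omega>. ennreal (trans_const \<rho> * r powr s) * ennreal energy_bound \<partial>prob_M)"
  proof (rule nn_integral_mono)
    fix \<omega> assume \<omega>: "\<omega> \<in> space prob_M"
    have "(\<integral>\<^sup>+\<omega>'. (\<integral>\<^sup>+T. g T (\<omega>, \<omega>') \<partial>lborel) \<partial>prob_M)
        \<le> (\<integral>\<^sup>+\<omega>'. ennreal (trans_const \<rho> * r powr s) * (\<Sum>q. ennreal (kernel \<omega> q) * indicator {\<omega>'\<in>space prob_M. \<forall>i<q. \<omega>' i = \<omega> i} \<omega>') \<partial>prob_M)"
      unfolding sec by (intro nn_integral_mono transversality_kernel \<rho> r \<omega> pc)
    also have "\<dots> = ennreal (trans_const \<rho> * r powr s) * (\<integral>\<^sup>+\<omega>'. (\<Sum>q. ennreal (kernel \<omega> q) * indicator {\<omega>'\<in>space prob_M. \<forall>i<q. \<omega>' i = \<omega> i} \<omega>') \<partial>prob_M)"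
      by (rule nn_integral_cmult) (intro borel_measurable_suminf_order borel_measurable_times_ennreal borel_measurable_const borel_measurable_indicator agree_sets)
    also have "\<dots> \<le> ennreal (trans_const \<rho> * r powr s) * ennreal energy_bound"
      by (intro mult_left_mono energy_le \<omega>) auto
    finally show "(\<integral>\<^sup>+\<omega>'. (\<integral>\<^sup>+T. g T (\<omega>, \<omega>') \<partial>lborel) \<partial>prob_M) \<le> ennreal (trans_const \<rho> * r powr s) * ennreal energy_bound" .
  qed
  also have "\<dots> = ennreal (trans_const \<rho> * energy_bound * r powr s)"
    using pc energy_bound_nonneg by (simp add: M.emeasure_space_1 ennreal_mult[symmetric] mult_ac)
  finally show ?thesis unfolding S_def .
qed

end

context contracting_matrices
begin

text \<open>All that the sequel uses of the construction: random points of the target set whose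
  averaged correlation integral is of order r powr s. The dimension bound and positive measure both
  follow from it.\<close>

lemma random_points_exist:
  fixes lam :: "nat \<Rightarrow> 'n list"
  assumes s: "0 < s" "s \<le> real CARD('d)"
    and qm: "\<exists>C>0. \<exists>K. \<forall>u v. \<exists>w. length w = K \<and> C * \<phi> s u * \<phi> s v \<le> \<phi> s (u @ w @ v)"
    and P: "inverse_lower_pressure A lam s < ereal (pressure A s)"
  shows "\<exists>(M :: (nat \<Rightarrow> 'n list) measure) X I. prob_space M
    \<and> (\<forall>\<omega>\<in>space M. \<exists>\<^sub>\<infinity>k. sdrop k (X \<omega>) \<in> cylinder (lam k))
    \<and> (\<lambda>p. natural_proj A (fst p) (X (snd p))) \<in> borel_measurable (lborel \<Otimes>\<^sub>M M)
    \<and> 0 \<le> I \<and> (\<forall>\<rho>\<ge>1. \<forall>r>0. (\<integral>\<^sup>+T. indicator (cube \<rho>) T * emeasure (M \<Otimes>\<^sub>M M)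
      {p \<in> space (M \<Otimes>\<^sub>M M). dist (natural_proj A T (X (fst p))) (natural_proj A T (X (snd p))) \<le> r} \<partial>lborel)
    \<le> ennreal (trans_const \<rho> * I * r powr s))"
proof -
  obtain C K where C: "C > 0" and CK: "\<And>u v. \<exists>w. length w = K \<and> C * \<phi> s u * \<phi> s v \<le> \<phi> s (u @ w @ v)"
    using qm by blast
  define conn where "conn u v = (SOME w. length w = K \<and> C * \<phi> s u * \<phi> s v \<le> \<phi> s (u @ w @ v))" for u v
  have conn: "length (conn u v) = K \<and> C * \<phi> s u * \<phi> s v \<le> \<phi> s (u @ conn u v @ v)" for u v
    unfolding conn_def by (rule someI_ex[OF CK])
  obtain b where b: "inverse_lower_pressure A lam s < ereal b" "ereal b < ereal (pressure A s)"
    using ereal_dense2[OF P] by blast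
  have b0: "0 < b" using inverse_lower_pressure_nonneg[OF s, of lam] b(1) by (metis ereal_less(2) order_le_less_trans)
  obtain b' where b': "b < b'" "b' < pressure A s" using b(2) dense by auto
  have "\<exists>\<^sub>\<infinity>k. exp (- (real k * b)) \<le> \<phi> s (lam k)"
  proof (rule ccontr)
    assume "\<not> ?thesis"
    then have "\<forall>\<^sub>F k in sequentially. \<phi> s (lam k) < exp (- (real k * b))"
      by (simp add: not_INFM not_frequently not_le cofinite_eq_sequentially)
    then have "\<forall>\<^sub>F k in sequentially. ereal b \<le> ereal (- 1 / real k * ln (\<phi> s (lam k)))"
      using eventually_gt_at_top[of 0]
    proof eventually_elim
      case (elim k)
      have "ln (\<phi> s (lam k)) < ln (exp (- (real k * b)))"
        using elim(1) \<phi>_pos[OF s, of "lam k"] by (subst ln_less_cancel_iff) auto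
      then show ?case using elim(2) by (simp add: field_simps)
    qed
    then have "ereal b \<le> inverse_lower_pressure A lam s" unfolding inverse_lower_pressure_def by (rule Liminf_bounded)
    then show False using b(1) by simp
  qed
  moreover have "\<forall>\<^sub>F m in sequentially. b' < ln (Z s m) / real m"
    by (rule order_tendstoD(1)[OF pressure_LIMSEQ[OF s] b'(2)])
  then obtain N where N: "\<And>m. m \<ge> N \<Longrightarrow> b' < ln (Z s m) / real m" by (auto simp: eventually_sequentially)
  \<comment> \<open>The fixed losses b K - ln \<open>C\<close> are absorbed once m times the gap
    between b' and b exceeds them.\<close>
  obtain N' :: nat where N': "real N' > (b * real K - ln C) / (b' - b)" using reals_Archimedean2 by blast
  define m where "m = max 1 (max N N')"
  have m: "m \<ge> 1" "m \<ge> N" "m \<ge> N'" by (auto simp: m_def)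
  have "exp (b * real (m + K)) < C * Z s m"
  proof -
    have "real m > (b * real K - ln C) / (b' - b)" using N' m(3) by (smt (verit) of_nat_le_iff)
    then have "b * real K - ln C < real m * (b' - b)" using b'(1) by (simp add: field_simps)
    moreover have "b' * real m < ln (Z s m)" using N[OF m(2)] m(1) by (simp add: field_simps)
    ultimately have "b * real (m + K) < ln C + ln (Z s m)" by (simp add: algebra_simps)
    also have "\<dots> = ln (C * Z s m)" using C Z_pos[OF s, of m] by (simp add: ln_mult_pos)
    finally have "exp (b * real (m + K)) < exp (ln (C * Z s m))" by simp
    then show ?thesis using C Z_pos[OF s, of m] by simp
  qed
  ultimately interpret target_construction A \<eta> s C b K m conn lam
    by unfold_locales (use s C conn b0 m in auto)
  show ?thesis
    by (intro exI[of _ prob_M] exI[of _ point] exI[of _ energy_bound] conjI ballI allI impI prob_space_M point_in_target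
        measurable_natural_proj_point energy_bound_nonneg correlation_le block_seq_space_M)
qed

end

section \<open>Energy, dimension and Lebesgue measure\<close>

lemma ennreal_linear_combination:
  "0 \<le> a \<Longrightarrow> 0 \<le> b \<Longrightarrow> 0 \<le> x \<Longrightarrow> 0 \<le> y \<Longrightarrow> ennreal a * ennreal x + ennreal b * ennreal y = ennreal (a * x + b * y)"
  by (simp add: ennreal_mult ennreal_plus)

text \<open>The correlation integral of the law of Y: two independent copies are compared.\<close>

definition corr :: "'w measure \<Rightarrow> ('w \<Rightarrow> 'a::metric_space) \<Rightarrow> real \<Rightarrow> ennreal" where
  "corr M Y r = emeasure (M \<Otimes>\<^sub>M M) {p \<in> space (M \<Otimes>\<^sub>M M). dist (Y (fst p)) (Y (snd p)) \<le> r}"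

lemma corr_sets [measurable]:
  fixes Y :: "'w \<Rightarrow> 'a::euclidean_space"
  assumes [measurable]: "Y \<in> borel_measurable M"
  shows "{p \<in> space (M \<Otimes>\<^sub>M M). dist (Y (fst p)) (Y (snd p)) \<le> r} \<in> sets (M \<Otimes>\<^sub>M M)"
  by measurable

text \<open>The energy kernel is taken dyadic, \<open>\<Sum>j. 2 powr ((j + 1) s) 1{dist \<le> 2\<^sup>-\<^sup>j}\<close>, and dominates \<open>dist powr (- s)\<close>.\<close>
lemma content_ge_energy:
  fixes Y :: "'w \<Rightarrow> 'a::euclidean_space"
  assumes M: "prob_space M" and Y[measurable]: "Y \<in> borel_measurable M" and s: "0 < s"
    and E: "\<And>\<omega>. \<omega> \<in> space M \<Longrightarrow> Y \<omega> \<in> (\<Union>n. U n)"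
    and U: "\<And>n. bounded (U n)" "\<And>n. diameter (U n) \<le> 1"
    and I: "(\<Sum>j. ennreal (2 powr (real (Suc j) * s)) * corr M Y (1 / 2 ^ j)) \<le> ennreal I" "0 \<le> I"
  shows "ennreal (3 / (4 * (I + 1))) \<le> (\<Sum>n. diam_pow s (U n))"
proof -
  interpret M: prob_space M by fact
  interpret MM: pair_prob_space M M ..
  define S where "S j = {p \<in> space (M \<Otimes>\<^sub>M M). dist (Y (fst p)) (Y (snd p)) \<le> 1 / 2 ^ j}" for j :: nat
  have S[measurable]: "S j \<in> sets (M \<Otimes>\<^sub>M M)" for j unfolding S_def by measurable
  define G :: "'w \<times> 'w \<Rightarrow> ennreal" where "G p = (\<Sum>j. ennreal (2 powr (real (Suc j) * s)) * indicator (S j) p)" for p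
  have G[measurable]: "G \<in> borel_measurable (M \<Otimes>\<^sub>M M)" unfolding G_def by measurable
  have "(\<integral>\<^sup>+p. G p \<partial>(M \<Otimes>\<^sub>M M)) = (\<Sum>j. \<integral>\<^sup>+p. ennreal (2 powr (real (Suc j) * s)) * indicator (S j) p \<partial>(M \<Otimes>\<^sub>M M))"
    unfolding G_def by (rule nn_integral_suminf) measurable
  also have "\<dots> = (\<Sum>j. ennreal (2 powr (real (Suc j) * s)) * corr M Y (1 / 2 ^ j))"
    by (intro suminf_cong) (unfold corr_def S_def[symmetric], rule nn_integral_cmult_indicator[OF S])
  finally have GI: "(\<integral>\<^sup>+p. G p \<partial>(M \<Otimes>\<^sub>M M)) \<le> ennreal I" using I by simp
  define d where "d n = diameter (U n)" for n
  have d0: "0 \<le> d n" for n unfolding d_def by (rule diameter_ge_0[OF U(1)])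
  have d1: "d n \<le> 1" for n unfolding d_def by (rule U(2))
  define C where "C n = Y -` closure (U n) \<inter> space M" for n
  \<comment> \<open>Disjoint pieces have disjoint squares, so the energies on the squares add up to
    at most the total energy.\<close>
  define V where "V = disjointed C"
  have C: "C n \<in> sets M" for n unfolding C_def by (rule measurable_sets[OF Y]) simp
  have V: "V n \<in> sets M" for n using sets.range_disjointed_sets[of C M] C unfolding V_def by blast
  have VC: "V n \<subseteq> C n" for n unfolding V_def by (rule disjointed_subset)
  have disj: "disjoint_family V" unfolding V_def by (rule disjoint_family_disjointed)
  have UV: "(\<Union>n. V n) = space M"
  proof -
    have "(\<Union>n. C n) = space M" using E closure_subset unfolding C_def by fastforce
    then show ?thesis unfolding V_def by (simp add: UN_disjointed_eq)
  qed
  have VV: "V n \<times> V n \<in> sets (M \<Otimes>\<^sub>M M)" for n using V by simp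
  define a where "a n = (\<integral>\<^sup>+p. G p * indicator (V n \<times> V n) p \<partial>(M \<Otimes>\<^sub>M M))" for n
  have "(\<Sum>n. a n) = (\<integral>\<^sup>+p. (\<Sum>n. G p * indicator (V n \<times> V n) p) \<partial>(M \<Otimes>\<^sub>M M))"
    unfolding a_def by (intro nn_integral_suminf[symmetric] borel_measurable_times_ennreal G borel_measurable_indicator VV)
  also have "\<dots> \<le> (\<integral>\<^sup>+p. G p \<partial>(M \<Otimes>\<^sub>M M))"
  proof (rule nn_integral_mono)
    fix p
    have "disjoint_family (\<lambda>n. V n \<times> V n)" using disj unfolding disjoint_family_on_def by blast
    from suminf_indicator[OF this, of p]
    have "(\<Sum>n. indicator (V n \<times> V n) p :: ennreal) = indicator (\<Union>n. V n \<times> V n) p" by simp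
    then show "(\<Sum>n. G p * indicator (V n \<times> V n) p) \<le> G p" by (simp split: split_indicator)
  qed
  also note GI
  finally have aI: "(\<Sum>n. a n) \<le> ennreal I" .
  have dist: "dist (Y \<omega>) (Y \<omega>') \<le> d n" if "\<omega> \<in> V n" "\<omega>' \<in> V n" for \<omega> \<omega>' n
  proof -
    have "Y \<omega> \<in> closure (U n)" "Y \<omega>' \<in> closure (U n)" using that VC[of n] by (auto simp: C_def)
    then have "dist (Y \<omega>) (Y \<omega>') \<le> diameter (closure (U n))"
      using U(1) by (intro diameter_bounded_bound) (auto simp: bounded_closure)
    then show ?thesis using U(1) by (simp add: d_def diameter_closure)
  qed
  have afin: "a n \<noteq> top" for n
  proof -
    have "a n < top" by (rule ennreal_suminf_lessD[OF le_less_trans[OF aI ennreal_less_top]])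
    then show ?thesis by simp
  qed
  have sq: "emeasure M (V n) * emeasure M (V n) \<le> ennreal (d n powr s) * a n" for n
  proof -
    have e: "emeasure M (V n) * emeasure M (V n) = emeasure (M \<Otimes>\<^sub>M M) (V n \<times> V n)"
      by (rule M.emeasure_pair_measure_Times[OF V V, symmetric])
    show ?thesis
    proof (cases "d n = 0")
      \<comment> \<open>On a piece of diameter 0 the energy kernel is infinite, so finite energy
        forces the piece to have measure 0. Atoms are excluded in this way.\<close>
      case True
      have "G p = top" if "p \<in> V n \<times> V n" for p
      proof -
        have "p \<in> S j" for j
          using that dist[of "fst p" n "snd p"] sets.sets_into_space[OF VV[of n]] True by (auto simp: S_def)
        then have "G p = (\<Sum>j. ennreal (2 powr (real (Suc j) * s)))" by (simp add: G_def)
        also have "\<dots> = top"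
        proof (rule ccontr)
          assume "\<dots> \<noteq> top"
          then have "summable (\<lambda>j. 2 powr (real (Suc j) * s))" by (intro summable_suminf_not_top) auto
          then have "(\<lambda>j. 2 powr (real (Suc j) * s)) \<longlonglongrightarrow> 0" by (rule summable_LIMSEQ_zero)
          moreover have "1 \<le> 2 powr (real (Suc j) * s)" for j using s by (intro ge_one_powr_ge_zero) auto
          ultimately have "(1::real) \<le> 0" by (intro tendsto_lowerbound) auto
          then show False by simp
        qed
        finally show ?thesis .
      qed
      then have "a n = (\<integral>\<^sup>+p. top * indicator (V n \<times> V n) p \<partial>(M \<Otimes>\<^sub>M M))"
        unfolding a_def by (intro nn_integral_cong) (auto split: split_indicator)
      also have "\<dots> = top * emeasure (M \<Otimes>\<^sub>M M) (V n \<times> V n)" by (rule nn_integral_cmult_indicator[OF VV])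
      finally have "emeasure (M \<Otimes>\<^sub>M M) (V n \<times> V n) = 0" using afin[of n] by (metis ennreal_top_mult_right)
      then show ?thesis using e by simp
    next
      case False
      then have dp: "0 < d n" using d0[of n] by simp
      \<comment> \<open>The dyadic scale of the piece: its diameter is at most 2 powr (-j) and above
        2 powr (-j - 1).\<close>
      define j where "j = nat \<lfloor>- log 2 (d n)\<rfloor>"
      have l0: "0 \<le> - log 2 (d n)" using dp d1[of n] by (simp add: log_le_zero_cancel_iff)
      have j: "real j \<le> - log 2 (d n)" "- log 2 (d n) < real j + 1"
        using l0 by (auto simp: j_def)
      have "d n = 2 powr (log 2 (d n))" using dp by simp
      also have "\<dots> \<le> 2 powr (- real j)" using j(1) by (intro powr_mono) auto
      also have "\<dots> = 1 / 2 ^ j" by (simp add: powr_minus powr_realpow divide_inverse)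
      finally have dj: "d n \<le> 1 / 2 ^ j" .
      have "1 = d n powr s * d n powr (- s)" using dp by (simp add: powr_minus)
      also have "d n powr (- s) = 2 powr (- log 2 (d n) * s)" using dp by (simp add: powr_def log_def)
      also have "d n powr s * \<dots> \<le> d n powr s * 2 powr (real (Suc j) * s)"
        using j(2) s by (intro mult_left_mono powr_mono mult_right_mono) auto
      finally have one: "1 \<le> d n powr s * 2 powr (real (Suc j) * s)" .
      have Gp: "1 \<le> ennreal (d n powr s) * G p" if "p \<in> V n \<times> V n" for p
      proof -
        have "p \<in> S j" using that dist[of "fst p" n "snd p"] sets.sets_into_space[OF VV[of n]] dj
          by (auto simp: S_def)
        have "1 \<le> ennreal (d n powr s) * ennreal (2 powr (real (Suc j) * s))"
          using one by (simp add: ennreal_mult'[symmetric] ennreal_1[symmetric] del: ennreal_1)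
        also have "ennreal (2 powr (real (Suc j) * s)) \<le> G p"
        proof -
          define g where "g = (\<lambda>j. ennreal (2 powr (real (Suc j) * s)) * indicator (S j) p)"
          have "sum g {j} \<le> suminf g" by (rule sum_le_suminf) simp_all
          then show ?thesis using \<open>p \<in> S j\<close> by (simp add: g_def G_def)
        qed
        finally show ?thesis by (simp add: mult_left_mono)
      qed
      have "emeasure (M \<Otimes>\<^sub>M M) (V n \<times> V n) = (\<integral>\<^sup>+p. indicator (V n \<times> V n) p \<partial>(M \<Otimes>\<^sub>M M))"
        using VV by simp
      also have "\<dots> \<le> (\<integral>\<^sup>+p. ennreal (d n powr s) * (G p * indicator (V n \<times> V n) p) \<partial>(M \<Otimes>\<^sub>M M))"
        using Gp by (intro nn_integral_mono) (auto split: split_indicator)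
      also have "\<dots> = ennreal (d n powr s) * a n"
        unfolding a_def by (intro nn_integral_cmult borel_measurable_times_ennreal G borel_measurable_indicator VV)
      finally show ?thesis using e by simp
    qed
  qed
  \<comment> \<open>Cauchy-Schwarz over the cover is replaced by the inequality y z <= (c y + z / (4
    c))^2. This weight leaves at most 1/4 for the energy term, hence the constant 3/4; adding 1
    makes c positive also for I = 0.\<close>
  define c where "c = I + 1"
  have c: "c > 0" using I by (simp add: c_def)
  have am: "emeasure M (V n) \<le> ennreal c * ennreal (d n powr s) + ennreal (1 / (4 * c)) * a n" for n
  proof -
    define x y z where "x = measure M (V n)" and "y = d n powr s" and "z = enn2real (a n)"
    have x: "emeasure M (V n) = ennreal x" by (simp add: x_def M.emeasure_eq_measure)
    have z: "a n = ennreal z" using afin[of n] by (simp add: z_def less_top)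
    have nn: "0 \<le> x" "0 \<le> y" "0 \<le> z" by (auto simp: x_def y_def z_def)
    have "x * x \<le> y * z" using sq[of n] nn unfolding x z y_def[symmetric] by (simp add: ennreal_mult[symmetric])
    then have "x\<^sup>2 \<le> y * z" by (simp only: power2_eq_square)
    also have "y * z \<le> (c * y + 1 / (4 * c) * z)\<^sup>2"
    proof -
      define w where "w = 1 / (4 * c) * z"
      have z4: "z = 4 * c * w" using c by (simp add: w_def)
      have "(c * y + w)\<^sup>2 - y * (4 * c * w) = (c * y - w)\<^sup>2"
        by (simp add: power2_eq_square algebra_simps)
      then have "0 \<le> (c * y + w)\<^sup>2 - y * (4 * c * w)" by (simp only: zero_le_power2)
      then have "y * (4 * c * w) \<le> (c * y + w)\<^sup>2" by simp
      then show ?thesis by (simp only: w_def[symmetric] z4[symmetric])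
    qed
    finally have "x\<^sup>2 \<le> (c * y + 1 / (4 * c) * z)\<^sup>2" .
    moreover have "0 \<le> c * y + 1 / (4 * c) * z" using nn c by (intro add_nonneg_nonneg mult_nonneg_nonneg) auto
    ultimately have "x \<le> c * y + 1 / (4 * c) * z" by (rule power2_le_imp_le)
    then have "ennreal x \<le> ennreal (c * y + 1 / (4 * c) * z)" by (rule ennreal_leI)
    also have "\<dots> = ennreal c * ennreal y + ennreal (1 / (4 * c)) * ennreal z"
      by (rule ennreal_linear_combination[symmetric]) (use nn c in auto)
    finally show ?thesis unfolding x z y_def .
  qed
  have dps: "diam_pow s (U n) = ennreal (d n powr s)" for n
    using s by (simp add: diam_pow_def d_def)
  have "1 = emeasure M (space M)" by (simp add: M.emeasure_space_1)
  also have "\<dots> = (\<Sum>n. emeasure M (V n))" unfolding UV[symmetric] using V disj by (intro suminf_emeasure[symmetric]) auto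
  also have "\<dots> \<le> (\<Sum>n. ennreal c * ennreal (d n powr s) + ennreal (1 / (4 * c)) * a n)" by (intro suminf_le am) auto
  also have "\<dots> = ennreal c * (\<Sum>n. ennreal (d n powr s)) + ennreal (1 / (4 * c)) * (\<Sum>n. a n)"
    by (simp add: suminf_add[symmetric])
  also have "\<dots> \<le> ennreal c * (\<Sum>n. ennreal (d n powr s)) + ennreal (1 / (4 * c)) * ennreal I"
    by (intro add_left_mono mult_left_mono aI) auto
  also have "\<dots> \<le> ennreal c * (\<Sum>n. ennreal (d n powr s)) + ennreal (1/4)"
  proof (rule add_left_mono)
    have "ennreal (1 / (4 * c)) * ennreal I = ennreal (1 / (4 * c) * I)" by (rule ennreal_mult[symmetric]) (use I c in auto)
    also have "1 / (4 * c) * I \<le> 1/4" using I c by (simp add: c_def field_simps)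
    finally show "ennreal (1 / (4 * c)) * ennreal I \<le> ennreal (1/4)" by (simp add: ennreal_leI)
  qed
  finally have main: "1 \<le> ennreal c * (\<Sum>n. ennreal (d n powr s)) + ennreal (1/4)" .
  show ?thesis
  proof (cases "(\<Sum>n. ennreal (d n powr s)) = top")
    case True then show ?thesis by (simp add: dps)
  next
    case False
    then obtain w where w: "(\<Sum>n. ennreal (d n powr s)) = ennreal w" "0 \<le> w" by (metis ennreal_cases infinity_ennreal_def)
    have "ennreal 1 \<le> ennreal c * ennreal w + ennreal 1 * ennreal (1/4)"
      using main unfolding w(1) ennreal_1 mult_1_left .
    also have "\<dots> = ennreal (c * w + 1 * (1/4))" by (rule ennreal_linear_combination) (use w c in auto)
    finally have "1 \<le> c * w + 1 * (1/4)" by (subst (asm) ennreal_le_iff) (use w c in auto)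
    then have "3 / (4 * c) \<le> w" using c by (simp add: field_simps)
    then show ?thesis unfolding dps w(1) c_def by (rule ennreal_leI)
  qed
qed

text \<open>Finite s-energy bounds the s-content at scale 1 from below. For u < s and sets of
  diameter at most 1 the u-content is no smaller, so the u-dimensional measure cannot
  vanish.\<close>

lemma hausdorff_dim_ge_energy:
  fixes Y :: "'w \<Rightarrow> 'a::euclidean_space"
  assumes M: "prob_space M" and Y: "Y \<in> borel_measurable M" and s: "0 < s"
    and E: "\<And>\<omega>. \<omega> \<in> space M \<Longrightarrow> Y \<omega> \<in> E"
    and I: "(\<Sum>j. ennreal (2 powr (real (Suc j) * s)) * corr M Y (1 / 2 ^ j)) \<noteq> top"
  shows "ereal s \<le> hausdorff_dim E"
  unfolding hausdorff_dim_def
proof (rule Inf_greatest, safe)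
  fix u assume u: "0 \<le> u" "hausdorff_measure u E = 0"
  show "ereal s \<le> ereal u"
  proof (rule ccontr)
    assume "\<not> ereal s \<le> ereal u"
    then have us: "u < s" by simp
    obtain I where I': "(\<Sum>j. ennreal (2 powr (real (Suc j) * s)) * corr M Y (1 / 2 ^ j)) = ennreal I" "0 \<le> I"
      
      using I by (cases rule: ennreal_cases) auto
    have "hausdorff_premeasure u 1 E \<le> hausdorff_measure u E"
      unfolding hausdorff_measure_def by (intro SUP_upper) auto
    also have "\<dots> < ennreal (3 / (4 * (I + 1)))" using u(2) I'(2) by simp
    finally have lt: "hausdorff_premeasure u 1 E < ennreal (3 / (4 * (I + 1)))" .
    obtain U where U: "E \<subseteq> (\<Union>n. U n)" "\<And>n. bounded (U n)" "\<And>n. diameter (U n) \<le> 1" "(\<Sum>n. diam_pow u (U n)) < ennreal (3 / (4 * (I + 1)))"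
      by (rule hausdorff_premeasure_coverE[OF lt]) (rule that)
    have "ennreal (3 / (4 * (I + 1))) \<le> (\<Sum>n. diam_pow s (U n))"
      using E U(1) I' by (intro content_ge_energy[OF M Y s _ U(2,3)]) auto
    also have "\<dots> \<le> (\<Sum>n. diam_pow u (U n))"
    proof (intro suminf_le)
      fix n
      have d: "0 \<le> diameter (U n)" "diameter (U n) \<le> 1" using U diameter_ge_0 by auto
      have "diameter (U n) powr s \<le> 1" using d s by (intro powr_le1) auto
      moreover have "diameter (U n) powr s \<le> diameter (U n) powr u" if "u \<noteq> 0" using d us by (intro powr_mono') auto
      ultimately show "diam_pow s (U n) \<le> diam_pow u (U n)"
        using s by (auto simp: diam_pow_def intro!: ennreal_leI)
    qed auto
    finally show False using U(4) by simp
  qed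
qed

text \<open>Smoothing the law of Y at scale r gives a function h whose squared L2 norm is controlled
  by the correlation integral at 2 r. If E were null, an open set of tiny measure would contain
  nearly all of h, which Cauchy-Schwarz forbids. A bound at infinitely many scales suffices, because
  only one fine enough scale is used.\<close>

lemma not_null_of_correlation:
  fixes Y :: "'w \<Rightarrow> 'a::euclidean_space"
  assumes M: "prob_space M" and Y[measurable]: "Y \<in> borel_measurable M"
    and E: "\<And>\<omega>. \<omega> \<in> space M \<Longrightarrow> Y \<omega> \<in> E"
    and lim: "liminf (\<lambda>n. ennreal (2 ^ (n * DIM('a))) * corr M Y (1 / 2 ^ n)) < top"
  shows "E \<notin> null_sets lebesgue"
proof
  assume null: "E \<in> null_sets lebesgue"
  interpret M: prob_space M by fact
  interpret MM: pair_prob_space M M ..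
  interpret LM: pair_sigma_finite "lborel :: 'a measure" M ..
  interpret LMM: pair_sigma_finite "lborel :: 'a measure" "M \<Otimes>\<^sub>M M" ..
  obtain c0 where c0: "liminf (\<lambda>n. ennreal (2 ^ (n * DIM('a))) * corr M Y (1 / 2 ^ n)) < c0" "c0 < top" using lim dense by blast
  define c where "c = enn2real c0 + 1"
  have c: "c > 0" by (simp add: c_def add_nonneg_pos)
  have "c0 = ennreal (enn2real c0)" using c0(2) by simp
  also have "\<dots> \<le> ennreal c" unfolding c_def by (intro ennreal_leI) simp
  finally have c0c: "c0 \<le> ennreal c" .
  have freq: "\<exists>\<^sub>F n in sequentially. ennreal (2 ^ (n * DIM('a))) * corr M Y (1 / 2 ^ n) \<le> ennreal c"
  proof (rule ccontr)
    assume "\<not> ?thesis"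
    then have "\<forall>\<^sub>F n in sequentially. ennreal c \<le> ennreal (2 ^ (n * DIM('a))) * corr M Y (1 / 2 ^ n)"
      unfolding not_frequently by eventually_elim simp
    then have "ennreal c \<le> liminf (\<lambda>n. ennreal (2 ^ (n * DIM('a))) * corr M Y (1 / 2 ^ n))" by (rule Liminf_bounded)
    then show False using c0(1) c0c by simp
  qed
  define \<kappa> where "\<kappa> = unit_ball_vol (real DIM('a)) / 2 ^ DIM('a)"
  have \<kappa>: "\<kappa> > 0" unfolding \<kappa>_def by (simp add: unit_ball_vol_pos)
  \<comment> \<open>Chosen to contradict the final inequality, which reads \<kappa> / 4 <= c
    \<epsilon>.\<close>
  define \<epsilon> where "\<epsilon> = \<kappa> / (8 * c)"
  have \<epsilon>: "\<epsilon> > 0" using \<kappa> c by (simp add: \<epsilon>_def)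
  obtain O' where O': "open O'" "E \<subseteq> O'" "emeasure lborel O' \<le> ennreal \<epsilon>"
  proof -
    have "E \<in> sets lebesgue" by (rule null_setsD2[OF null])
    from sets_lebesgue_outer_open[OF this \<epsilon>] obtain T where T: "open T" "E \<subseteq> T" "emeasure lebesgue (T - E) < ennreal \<epsilon>" .
    have Tb: "T \<in> sets lborel" using T(1) by simp
    then have Tl: "T \<in> sets lebesgue" by (rule sets_completionI_sets)
    have "emeasure lebesgue T \<le> emeasure lebesgue ((T - E) \<union> E)"
      by (rule emeasure_mono) (use Tl null_setsD2[OF null] in \<open>auto intro: sets.Un sets.Diff\<close>)
    also have "\<dots> = emeasure lebesgue (T - E)"
      by (rule emeasure_Un_null_set[OF sets.Diff[OF Tl null_setsD2[OF null]] null])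
    finally have "emeasure lebesgue T \<le> ennreal \<epsilon>" using T(3) by (meson less_imp_le order_trans)
    then have "emeasure lborel T \<le> ennreal \<epsilon>" using Tb by simp
    then show ?thesis by (rule that[OF T(1,2)])
  qed
  have O[measurable]: "O' \<in> sets borel" using O'(1) by simp
  \<comment> \<open>Those points keep a whole ball inside the open set; they fill the probability
    space as the radius shrinks.\<close>
  define H where "H n = {\<omega> \<in> space M. ball (Y \<omega>) (1 / 2 ^ n) \<subseteq> O'}" for n :: nat
  have Hm: "H n \<in> sets M" for n
  proof -
    have "closed (- (\<Union>y\<in>- O'. ball y (1 / 2 ^ n)))" by (intro closed_Compl open_UN ballI open_ball)
    also have "- (\<Union>y\<in>- O'. ball y (1 / 2 ^ n)) = {x. ball x (1 / 2 ^ n) \<subseteq> O'}"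
      by (auto simp: dist_commute subset_iff)
    finally have "closed {x. ball x (1 / 2 ^ n) \<subseteq> O'}" .
    then have "Y -` {x. ball x (1 / 2 ^ n) \<subseteq> O'} \<inter> space M \<in> sets M" by (intro measurable_sets[OF Y] borel_closed)
    then show ?thesis by (simp add: H_def vimage_def Int_def conj_commute)
  qed
  have Hinc: "incseq H"
  proof (rule incseq_SucI)
    fix n
    have "ball (Y \<omega>) (1 / 2 ^ Suc n) \<subseteq> ball (Y \<omega>) (1 / 2 ^ n)" for \<omega> by (rule subset_ball) (simp add: field_simps)
    then show "H n \<subseteq> H (Suc n)" unfolding H_def by blast
  qed
  have HU: "(\<Union>n. H n) = space M"
  proof safe
    fix \<omega> assume \<omega>: "\<omega> \<in> space M"
    then obtain e where e: "e > 0" "ball (Y \<omega>) e \<subseteq> O'" using E O'(1,2) openE by blast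
    obtain n :: nat where "(1/2) ^ n < e" using real_arch_pow_inv[OF e(1), of "1/2"] by auto
    then have "1 / 2 ^ n < e" by (simp add: power_divide)
    then have "ball (Y \<omega>) (1 / 2 ^ n) \<subseteq> O'" using subset_ball[of "1 / 2 ^ n" e "Y \<omega>"] e(2) by auto
    then show "\<omega> \<in> (\<Union>n. H n)" using \<omega> by (auto simp: H_def)
  qed (auto simp: H_def)
  have "(\<lambda>n. emeasure M (H n)) \<longlonglongrightarrow> emeasure M (\<Union>n. H n)"
    using Hm Hinc by (intro Lim_emeasure_incseq) auto
  moreover have "ennreal (1/2) < ennreal 1" by (rule ennreal_lessI) auto
  then have "ennreal (1/2) < emeasure M (\<Union>n. H n)" by (simp only: HU M.emeasure_space_1 ennreal_1)
  ultimately have "\<forall>\<^sub>F n in sequentially. ennreal (1/2) < emeasure M (H n)" by (rule order_tendstoD)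
  with freq have "\<exists>\<^sub>F n in sequentially. ennreal (2 ^ (n * DIM('a))) * corr M Y (1 / 2 ^ n) \<le> ennreal c \<and> ennreal (1/2) < emeasure M (H n)"
    by (rule frequently_eventually_frequently)
  then obtain n where n: "ennreal (2 ^ (n * DIM('a))) * corr M Y (1 / 2 ^ n) \<le> ennreal c" "ennreal (1/2) < emeasure M (H n)"
    by (auto dest: frequently_ex)
  \<comment> \<open>Half of the correlation scale: balls of radius r meet only if their centres are
    within 1 / 2 ^ n.\<close>
  define r :: real where "r = 1 / 2 ^ Suc n"
  have r: "r > 0" "2 * r = 1 / 2 ^ n" by (auto simp: r_def)
  define v where "v = unit_ball_vol (real DIM('a)) * r ^ DIM('a)"
  have v: "v > 0" using r by (simp add: v_def unit_ball_vol_pos)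
  have ballv: "emeasure lborel (ball x r) = ennreal v" for x :: 'a using r by (simp add: emeasure_ball v_def)
  define k where "k = (\<lambda>(x::'a) \<omega>. indicator {z. z < r} (dist x (Y \<omega>)) :: ennreal)"
  have km[measurable]: "case_prod k \<in> borel_measurable (lborel \<Otimes>\<^sub>M M)"
    unfolding k_def by measurable
  have kx: "(\<integral>\<^sup>+x. k x \<omega> \<partial>lborel) = ennreal v" for \<omega>
  proof -
    have "(\<integral>\<^sup>+x. k x \<omega> \<partial>lborel) = (\<integral>\<^sup>+x. indicator (ball (Y \<omega>) r) x \<partial>lborel)"
      unfolding k_def by (intro nn_integral_cong) (auto simp: dist_commute split: split_indicator)
    then show ?thesis by (simp add: ballv)
  qed
  define h where "h x = (\<integral>\<^sup>+\<omega>. k x \<omega> \<partial>M)" for x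
  have hm[measurable]: "h \<in> borel_measurable lborel" unfolding h_def by measurable
  have kM: "k x \<in> borel_measurable M" for x unfolding k_def by measurable
  define q where "q = c / 2 ^ (n * DIM('a))"
  have q: "q > 0" using c by (simp add: q_def)
  have corr_le: "corr M Y (1 / 2 ^ n) \<le> ennreal q"
  proof -
    have "ennreal (1 / 2 ^ (n * DIM('a))) * (ennreal (2 ^ (n * DIM('a))) * corr M Y (1 / 2 ^ n)) \<le> ennreal (1 / 2 ^ (n * DIM('a))) * ennreal c"
      by (intro mult_left_mono n(1)) auto
    moreover have "ennreal (1 / 2 ^ (n * DIM('a))) * ennreal (2 ^ (n * DIM('a))) = 1"
      by (subst ennreal_mult[symmetric]) auto
    moreover have "ennreal (1 / 2 ^ (n * DIM('a))) * ennreal c = ennreal q"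
      using c by (subst ennreal_mult[symmetric]) (auto simp: q_def)
    ultimately show ?thesis by (simp add: mult.assoc[symmetric])
  qed
  have "ennreal v * ennreal (1/2) \<le> ennreal v * emeasure M (H n)" using n(2) by (intro mult_left_mono) auto
  also have "\<dots> = (\<integral>\<^sup>+\<omega>. ennreal v * indicator (H n) \<omega> \<partial>M)" by (rule nn_integral_cmult_indicator[OF Hm, symmetric])
  also have "\<dots> \<le> (\<integral>\<^sup>+\<omega>. (\<integral>\<^sup>+x. indicator O' x * k x \<omega> \<partial>lborel) \<partial>M)"
  proof (rule nn_integral_mono)
    fix \<omega>
    show "ennreal v * indicator (H n) \<omega> \<le> (\<integral>\<^sup>+x. indicator O' x * k x \<omega> \<partial>lborel)"
    proof (cases "\<omega> \<in> H n")
      case True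
      have "k x \<omega> = indicator O' x * k x \<omega>" for x
      proof (cases "dist x (Y \<omega>) < r")
        case True
        then have "dist (Y \<omega>) x < 1 / 2 ^ n" using r by (simp add: dist_commute)
        then have "x \<in> O'" using \<open>\<omega> \<in> H n\<close> by (auto simp: H_def subset_iff)
        then show ?thesis by simp
      qed (simp add: k_def)
      then have "(\<integral>\<^sup>+x. k x \<omega> \<partial>lborel) = (\<integral>\<^sup>+x. indicator O' x * k x \<omega> \<partial>lborel)" by (rule nn_integral_cong)
      then show ?thesis using True by (simp add: kx)
    qed simp
  qed
  also have "\<dots> = (\<integral>\<^sup>+x. (\<integral>\<^sup>+\<omega>. indicator O' x * k x \<omega> \<partial>M) \<partial>lborel)"
    by (rule LM.Fubini') measurable
  also have "\<dots> = (\<integral>\<^sup>+x. indicator O' x * h x \<partial>lborel)"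
    unfolding h_def by (intro nn_integral_cong nn_integral_cmult kM)
  also have "\<dots> \<le> (\<integral>\<^sup>+x. ennreal q * indicator O' x + ennreal (1 / (4 * q)) * (h x * h x) \<partial>lborel)"
  proof (rule nn_integral_mono)
    fix x
    have "h x \<le> (\<integral>\<^sup>+\<omega>. 1 \<partial>M)" unfolding h_def k_def by (intro nn_integral_mono) (auto split: split_indicator)
    then have "h x \<noteq> top" by (simp add: M.emeasure_space_1) (metis ennreal_one_less_top le_less_trans less_irrefl)
    then obtain y where y: "h x = ennreal y" "0 \<le> y" by (metis ennreal_cases infinity_ennreal_def)
    \<comment> \<open>Pointwise substitute for Cauchy-Schwarz on O', with the weight q taken from
      the correlation bound.\<close>
    have "y \<le> q + 1 / (4 * q) * (y * y)"
    proof -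
      define w where "w = y / (2 * q)"
      have yw: "y = 2 * q * w" using q by (simp add: w_def)
      have "0 \<le> q * (1 - w)\<^sup>2" using q by simp
      also have "q * (1 - w)\<^sup>2 = q + q * (w * w) - 2 * q * w" by (simp add: power2_eq_square algebra_simps)
      also have "q * (w * w) = 1 / (4 * q) * (y * y)" unfolding yw using q by simp
      finally show ?thesis by (simp add: yw[symmetric])
    qed
    then have "ennreal y \<le> ennreal (q * 1 + 1 / (4 * q) * (y * y))" by (intro ennreal_leI) simp
    also have "\<dots> = ennreal q * ennreal 1 + ennreal (1 / (4 * q)) * ennreal (y * y)"
      by (rule ennreal_linear_combination[symmetric]) (use q y in auto)
    also have "ennreal (y * y) = h x * h x" using y by (simp add: ennreal_mult)
    finally have "h x \<le> ennreal q + ennreal (1 / (4 * q)) * (h x * h x)" by (simp add: y(1))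
    then show "indicator O' x * h x \<le> ennreal q * indicator O' x + ennreal (1 / (4 * q)) * (h x * h x)"
      by (auto split: split_indicator)
  qed
  also have "\<dots> = ennreal q * emeasure lborel O' + ennreal (1 / (4 * q)) * (\<integral>\<^sup>+x. h x * h x \<partial>lborel)"
    by (simp add: nn_integral_add nn_integral_cmult)
  also have "(\<integral>\<^sup>+x. h x * h x \<partial>lborel) \<le> ennreal v * corr M Y (1 / 2 ^ n)"
  proof -
    have hh: "h x * h x = (\<integral>\<^sup>+p. k x (fst p) * k x (snd p) \<partial>(M \<Otimes>\<^sub>M M))" for x
    proof -
      have [measurable]: "k x \<in> borel_measurable M" by (rule kM)
      have "(\<integral>\<^sup>+p. k x (fst p) * k x (snd p) \<partial>(M \<Otimes>\<^sub>M M)) = (\<integral>\<^sup>+\<omega>. \<integral>\<^sup>+\<omega>'. k x \<omega> * k x \<omega>' \<partial>M \<partial>M)"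
        by (subst M.nn_integral_fst[symmetric]) simp_all
      also have "\<dots> = h x * h x" by (simp add: nn_integral_cmult nn_integral_multc h_def)
      finally show ?thesis ..
    qed
    have k2: "(\<lambda>(x, p). k x (fst p) * k x (snd p)) \<in> borel_measurable (lborel \<Otimes>\<^sub>M (M \<Otimes>\<^sub>M M))"
      unfolding k_def by measurable
    have "(\<integral>\<^sup>+x. h x * h x \<partial>lborel) = (\<integral>\<^sup>+p. (\<integral>\<^sup>+x. k x (fst p) * k x (snd p) \<partial>lborel) \<partial>(M \<Otimes>\<^sub>M M))"
      unfolding hh by (rule LMM.Fubini'[symmetric, OF k2])
    also have "\<dots> \<le> (\<integral>\<^sup>+p. ennreal v * indicator {p \<in> space (M \<Otimes>\<^sub>M M). dist (Y (fst p)) (Y (snd p)) \<le> 1 / 2 ^ n} p \<partial>(M \<Otimes>\<^sub>M M))"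
    proof (rule nn_integral_mono)
      fix p assume p: "p \<in> space (M \<Otimes>\<^sub>M M)"
      show "(\<integral>\<^sup>+x. k x (fst p) * k x (snd p) \<partial>lborel) \<le> ennreal v * indicator {p \<in> space (M \<Otimes>\<^sub>M M). dist (Y (fst p)) (Y (snd p)) \<le> 1 / 2 ^ n} p"
      proof (cases "dist (Y (fst p)) (Y (snd p)) \<le> 1 / 2 ^ n")
        case True
        have "(\<integral>\<^sup>+x. k x (fst p) * k x (snd p) \<partial>lborel) \<le> (\<integral>\<^sup>+x. k x (fst p) \<partial>lborel)"
          unfolding k_def by (intro nn_integral_mono) (auto split: split_indicator)
        then show ?thesis using True p by (simp add: kx)
      next
        case False
        have "k x (fst p) * k x (snd p) = 0" for x
          using False dist_triangle2[of "Y (fst p)" "Y (snd p)" x] r by (auto simp: k_def dist_commute split: split_indicator)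
        then have "(\<lambda>x. k x (fst p) * k x (snd p)) = (\<lambda>x. 0)" by (rule ext)
        then show ?thesis by (simp only: nn_integral_const mult_zero_left zero_le)
      qed
    qed
    also have "\<dots> = ennreal v * corr M Y (1 / 2 ^ n)"
      unfolding corr_def by (rule nn_integral_cmult_indicator[OF corr_sets[OF Y]])
    finally show ?thesis .
  qed
  finally have "ennreal v * ennreal (1/2) \<le> ennreal q * emeasure lborel O' + ennreal (1 / (4 * q)) * (ennreal v * corr M Y (1 / 2 ^ n))"
    by (simp add: add_left_mono mult_left_mono)
  also have "\<dots> \<le> ennreal q * ennreal \<epsilon> + ennreal (1 / (4 * q)) * (ennreal v * ennreal q)"
    by (intro add_mono mult_left_mono O'(3) corr_le) auto
  also have "ennreal v * ennreal q = ennreal (v * q)" by (rule ennreal_mult[symmetric]) (use v q in auto)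
  also have "ennreal q * ennreal \<epsilon> + ennreal (1 / (4 * q)) * ennreal (v * q) = ennreal (q * \<epsilon> + 1 / (4 * q) * (v * q))"
    by (rule ennreal_linear_combination) (use q v \<epsilon> in auto)
  also have "ennreal v * ennreal (1/2) = ennreal (v * (1/2))" by (rule ennreal_mult[symmetric]) (use v in auto)
  finally have "v * (1/2) \<le> q * \<epsilon> + 1 / (4 * q) * (v * q)"
    by (subst (asm) ennreal_le_iff) (use q v \<epsilon> in auto)
  then have "v / 4 \<le> q * \<epsilon>" using q by simp
  moreover have "v = \<kappa> / 2 ^ (n * DIM('a))"
    by (simp add: v_def \<kappa>_def r_def power_divide power_mult_distrib power_mult)
  ultimately have "\<kappa> / 4 \<le> c * \<epsilon>" by (simp add: q_def field_simps)
  then show False using c \<kappa> by (simp add: \<epsilon>_def field_simps)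
qed

section \<open>Measurability of the target set\<close>

text \<open>Countably many compact subsets whose measures approach the outer measure have a union
  that differs from a measurable hull by a null set. What the union misses of S lies in this null
  set and is measurable by completeness.\<close>

lemma outer_measure_lebesgue_approximable:
  fixes S :: "'a::euclidean_space set"
  assumes S: "bounded S"
    and approx: "\<And>c. c < outer_measure_of lebesgue S \<Longrightarrow> \<exists>K. compact K \<and> K \<subseteq> S \<and> c \<le> emeasure lebesgue K"
  shows "S \<in> sets lebesgue"
proof -
  obtain H where H: "H \<in> sets lebesgue" "S \<subseteq> H" "outer_measure_of lebesgue S = emeasure lebesgue H"
    using outer_measure_of_attain[of S lebesgue] by auto
  obtain B where "\<And>x. x \<in> S \<Longrightarrow> norm x \<le> B" using S unfolding bounded_iff by blast
  then have B: "S \<subseteq> cball 0 B" by auto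
  have "outer_measure_of lebesgue S \<le> outer_measure_of lebesgue (cball (0::'a) B)" by (rule outer_measure_of_mono[OF B])
  also have "\<dots> = emeasure lebesgue (cball (0::'a) B)" by (rule outer_measure_of_eq) simp
  also have "\<dots> < top" using emeasure_lborel_cball_finite[of "0::'a" B] by simp
  finally have fin: "emeasure lebesgue H < top" using H(3) by simp
  have sub_null: "S - U \<in> sets lebesgue" if U: "U \<in> sets lebesgue" "U \<subseteq> H" "emeasure lebesgue H \<le> emeasure lebesgue U" for U
  proof -
    have "emeasure lebesgue U < top" by (rule le_less_trans[OF emeasure_mono[OF U(2) H(1)] fin])
    then have "emeasure lebesgue U \<noteq> \<infinity>" unfolding infinity_ennreal_def by (rule less_imp_neq)
    then have "emeasure lebesgue (H - U) = emeasure lebesgue H - emeasure lebesgue U"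
      by (rule emeasure_Diff[OF _ H(1) U(1) U(2)])
    also have "\<dots> = 0" using U(3) fin by (simp add: diff_eq_0_iff_ennreal)
    finally have "H - U \<in> null_sets lebesgue" using H(1) U(1) by (intro null_setsI) auto
    then have "negligible (H - U)" by (simp add: negligible_iff_null_sets)
    then have "negligible (S - U)" by (rule negligible_subset) (use H(2) in blast)
    then show ?thesis by (simp add: negligible_imp_sets)
  qed
  obtain h where h: "emeasure lebesgue H = ennreal h" "0 \<le> h"
    using fin by (cases "emeasure lebesgue H" rule: ennreal_cases) auto
  show ?thesis
  proof (cases "h = 0")
    case True
    then show ?thesis using sub_null[of "{}"] h by simp
  next
    case False
    have "\<exists>K. compact K \<and> K \<subseteq> S \<and> ennreal (h * (1 - 1 / real (n + 2))) \<le> emeasure lebesgue K" for n :: nat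
    proof (rule approx)
      have "h * (1 - 1 / real (n + 2)) < h * 1" using False h(2) by (intro mult_strict_left_mono) auto
      then have "ennreal (h * (1 - 1 / real (n + 2))) < ennreal h" using False h(2) by (intro ennreal_lessI) auto
      then show "ennreal (h * (1 - 1 / real (n + 2))) < outer_measure_of lebesgue S" by (simp only: H(3) h(1))
    qed
    then obtain K where K: "\<And>n. compact (K n)" "\<And>n. K n \<subseteq> S" "\<And>n. ennreal (h * (1 - 1 / real (n + 2))) \<le> emeasure lebesgue (K n)"
      by metis
    have Km: "K n \<in> sets lebesgue" for n using K(1)[of n] by (intro sets_completionI_sets) (simp add: compact_imp_closed borel_closed)
    define U where "U = (\<Union>n. K n)"
    have Um: "U \<in> sets lebesgue" unfolding U_def using Km by blast
    have US: "U \<subseteq> S" unfolding U_def using K(2) by blast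
    have le: "ennreal (h * (1 - 1 / real (n + 2))) \<le> emeasure lebesgue U" for n
      by (rule order_trans[OF K(3)[of n] emeasure_mono[OF _ Um]]) (auto simp: U_def)
    have "(\<lambda>n. h * (1 - 1 / real (n + 2))) \<longlonglongrightarrow> h * (1 - 0)"
      by (intro tendsto_mult tendsto_diff tendsto_const LIMSEQ_ignore_initial_segment[OF lim_const_over_n])
    from tendsto_ennrealI[OF this] have lim: "(\<lambda>n. ennreal (h * (1 - 1 / real (n + 2)))) \<longlonglongrightarrow> ennreal h" by simp
    have "ennreal h \<le> emeasure lebesgue U" by (rule tendsto_upperbound[OF lim]) (intro always_eventually allI le, simp)
    then have "S - U \<in> sets lebesgue" using h(1) US H(2) by (intro sub_null Um) auto
    then have "U \<union> (S - U) \<in> sets lebesgue" using Um by (intro sets.Un)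
    then show ?thesis using US by (simp add: Un_absorb1)
  qed
qed

text \<open>Koenig's lemma: a prefix shared by infinitely many indices has a one-letter extension
  shared by infinitely many, as the alphabet is finite. It provides cluster points in the space of
  sequences.\<close>

lemma koenig_cluster_point:
  fixes z :: "nat \<Rightarrow> 'n::finite stream"
  shows "\<exists>\<omega>. \<forall>n. \<exists>\<^sub>\<infinity>M. stake n (z M) = stake n \<omega>"
proof -
  define good where "good u \<longleftrightarrow> (\<exists>\<^sub>\<infinity>M. stake (length u) (z M) = u)" for u
  have step: "\<exists>a. good (u @ [a])" if "good u" for u
  proof (rule ccontr)
    assume "\<nexists>a. good (u @ [a])"
    then have "finite (\<Union>a. {M. stake (length (u @ [a])) (z M) = u @ [a]})"
      unfolding good_def frequently_cofinite by auto
    moreover have "{M. stake (length u) (z M) = u} \<subseteq> (\<Union>a. {M. stake (length (u @ [a])) (z M) = u @ [a]})"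
    proof
      fix M assume "M \<in> {M. stake (length u) (z M) = u}"
      then have "stake (length (u @ [z M !! length u])) (z M) = u @ [z M !! length u]"
        by (simp add: stake_Suc del: stake.simps)
      then show "M \<in> (\<Union>a. {M. stake (length (u @ [a])) (z M) = u @ [a]})" by blast
    qed
    ultimately have "finite {M. stake (length u) (z M) = u}" by (rule rev_finite_subset)
    then show False using that by (simp add: good_def frequently_cofinite)
  qed
  define g where "g = rec_nat [] (\<lambda>_ u. u @ [SOME a. good (u @ [a])])"
  have g: "g 0 = []" "g (Suc n) = g n @ [SOME a. good (g n @ [a])]" for n by (simp_all add: g_def)
  have good_g: "good (g n)" for n
  proof (induction n)
    case 0 show ?case by (simp add: g good_def)
  next
    case (Suc n)
    then show ?case unfolding g(2) using someI_ex[OF step] by blast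
  qed
  have len: "length (g n) = n" for n by (induction n) (simp_all add: g)
  define \<omega> where "\<omega> = smap (\<lambda>n. g (Suc n) ! n) nats"
  have "stake n \<omega> = g n" for n
  proof (induction n)
    case (Suc n)
    have "\<omega> !! n = (SOME a. good (g n @ [a]))" by (simp add: \<omega>_def snth_fromN g nth_append len)
    then show ?case using Suc.IH by (simp add: stake_Suc g del: stake.simps)
  qed (simp add: g)
  then have "\<exists>\<^sub>\<infinity>M. stake n (z M) = stake n \<omega>" for n using good_g[of n] by (simp add: good_def len)
  then show ?thesis by blast
qed

text \<open>The clopen sets of the sequence space, that is, finite unions of cylinders.\<close>

definition finitely_determined :: "'n stream set \<Rightarrow> bool" where
  "finitely_determined D \<longleftrightarrow> (\<exists>L. \<forall>\<omega> \<omega>'. stake L \<omega> = stake L \<omega>' \<longrightarrow> \<omega> \<in> D \<longrightarrow> \<omega>' \<in> D)"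

lemma stake_eq_le: "stake n \<omega> = stake n \<omega>' \<Longrightarrow> m \<le> n \<Longrightarrow> stake m \<omega> = stake m \<omega>'"
  by (metis min.absorb1 take_stake)

lemma finitely_determined_Int:
  assumes "finitely_determined D" "finitely_determined D'"
  shows "finitely_determined (D \<inter> D')"
proof -
  obtain L where L: "\<And>\<omega> \<omega>'. stake L \<omega> = stake L \<omega>' \<Longrightarrow> \<omega> \<in> D \<Longrightarrow> \<omega>' \<in> D" using assms(1) unfolding finitely_determined_def by blast
  obtain L' where L': "\<And>\<omega> \<omega>'. stake L' \<omega> = stake L' \<omega>' \<Longrightarrow> \<omega> \<in> D' \<Longrightarrow> \<omega>' \<in> D'" using assms(2) unfolding finitely_determined_def by blast
  show ?thesis unfolding finitely_determined_def
  proof (intro exI[of _ "max L L'"] allI impI)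
    fix \<omega> \<omega>' assume "stake (max L L') \<omega> = stake (max L L') \<omega>'" "\<omega> \<in> D \<inter> D'"
    then show "\<omega>' \<in> D \<inter> D'" using L[of \<omega> \<omega>'] L'[of \<omega> \<omega>'] stake_eq_le[of "max L L'" \<omega> \<omega>'] by auto
  qed
qed

section \<open>Compactness and measurability of projections\<close>

context contracting_matrices
begin

lemma dist_natural_proj_le:
  assumes "stake n \<omega> = stake n \<omega>'"
  shows "dist (natural_proj A T \<omega>) (natural_proj A T \<omega>') \<le> \<eta> ^ n * (2 * attractor_bound T)"
proof -
  have "natural_proj A T \<omega> - natural_proj A T \<omega>' = W (stake n \<omega>) *v (natural_proj A T (sdrop n \<omega>) - natural_proj A T (sdrop n \<omega>'))"
    using natural_proj_stake[of T \<omega> n] natural_proj_stake[of T \<omega>' n] assms by (simp add: matrix_vector_mult_diff_distrib)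
  then have "dist (natural_proj A T \<omega>) (natural_proj A T \<omega>') \<le> \<eta> ^ n * norm (natural_proj A T (sdrop n \<omega>) - natural_proj A T (sdrop n \<omega>'))"
    using norm_W_le[of "stake n \<omega>"] by (simp add: dist_norm)
  also have "\<dots> \<le> \<eta> ^ n * (2 * attractor_bound T)"
    using eta norm_triangle_ineq4[of "natural_proj A T (sdrop n \<omega>)" "natural_proj A T (sdrop n \<omega>')"]
      norm_natural_proj_le_attractor_bound[of T "sdrop n \<omega>"] norm_natural_proj_le_attractor_bound[of T "sdrop n \<omega>'"]
    by (intro mult_left_mono) auto
  finally show ?thesis .
qed

text \<open>Lifts a limit of projected points back to a sequence: long common prefixes force
  projections to be close.\<close>

lemma natural_proj_cluster_point:
  assumes y: "(\<lambda>M. natural_proj A T (z M)) \<longlonglongrightarrow> y"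
  shows "\<exists>\<omega>. natural_proj A T \<omega> = y \<and> (\<forall>n. \<exists>\<^sub>\<infinity>M. stake n (z M) = stake n \<omega>)"
proof -
  obtain \<omega> where \<omega>: "\<And>n. \<exists>\<^sub>\<infinity>M. stake n (z M) = stake n \<omega>" using koenig_cluster_point[of z] by blast
  have "natural_proj A T \<omega> = y"
  proof (rule ccontr)
    assume "natural_proj A T \<omega> \<noteq> y"
    then have e: "dist (natural_proj A T \<omega>) y / 2 > 0" (is "?e > 0") by simp
    have "(\<lambda>n. \<eta> ^ n * (2 * attractor_bound T)) \<longlonglongrightarrow> 0 * (2 * attractor_bound T)" by (intro tendsto_mult tendsto_eta_power tendsto_const)
    then have "(\<lambda>n. \<eta> ^ n * (2 * attractor_bound T)) \<longlonglongrightarrow> 0" by simp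
    from order_tendstoD(2)[OF this e] obtain n where n: "\<eta> ^ n * (2 * attractor_bound T) < ?e" by (auto simp: eventually_sequentially)
    obtain N where N: "\<And>M. M \<ge> N \<Longrightarrow> dist (natural_proj A T (z M)) y < ?e"
      using tendstoD[OF y e] by (auto simp: eventually_sequentially)
    obtain M where M: "M \<ge> N" "stake n (z M) = stake n \<omega>" using \<omega>[of n] unfolding INFM_nat_le by blast
    have "dist (natural_proj A T (z M)) (natural_proj A T \<omega>) < ?e" using dist_natural_proj_le[OF M(2), of T] n by linarith
    then show False using N[OF M(1)] dist_triangle2[of "natural_proj A T \<omega>" y "natural_proj A T (z M)"] by (simp add: dist_commute)
  qed
  then show ?thesis using \<omega> by blast
qed

lemma compact_natural_proj_image:
  assumes D: "finitely_determined D"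
  shows "compact (natural_proj A T ` D)"
proof (rule compact_eq_bounded_closed[THEN iffD2], intro conjI)
  show "bounded (natural_proj A T ` D)"
    unfolding bounded_iff using norm_natural_proj_le_attractor_bound by blast
  show "closed (natural_proj A T ` D)"
    unfolding closed_sequential_limits
  proof (intro allI impI)
    fix x y assume xy: "(\<forall>n. x n \<in> natural_proj A T ` D) \<and> x \<longlonglongrightarrow> y"
    then have "\<forall>n. \<exists>\<omega>. \<omega> \<in> D \<and> x n = natural_proj A T \<omega>" by blast
    then obtain z where z: "\<And>n. z n \<in> D" "\<And>n. x n = natural_proj A T (z n)" by metis
    have "x = (\<lambda>n. natural_proj A T (z n))" using z(2) by blast
    then have "(\<lambda>M. natural_proj A T (z M)) \<longlonglongrightarrow> y" using xy by simp
    then obtain \<omega> where \<omega>: "natural_proj A T \<omega> = y" "\<And>n. \<exists>\<^sub>\<infinity>M. stake n (z M) = stake n \<omega>"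
      using natural_proj_cluster_point by blast
    obtain L where L: "\<And>\<omega> \<omega>'. stake L \<omega> = stake L \<omega>' \<Longrightarrow> \<omega> \<in> D \<Longrightarrow> \<omega>' \<in> D" using D unfolding finitely_determined_def by blast
    obtain M where "stake L (z M) = stake L \<omega>" using \<omega>(2)[of L] by (auto dest: frequently_ex)
    then have "\<omega> \<in> D" using L z(1) by blast
    then show "y \<in> natural_proj A T ` D" using \<omega>(1) by blast
  qed
qed

text \<open>Images of intersections are delicate because each \<open>D m\<close> may need its own
  preimage of y. A cluster point of these preimages shares a determining prefix with late members of
  the decreasing family, so it lies in all \<open>D m\<close>.\<close>

lemma natural_proj_INT:
  assumes D: "\<And>m. finitely_determined (D m)" and dec: "decseq D"
  shows "natural_proj A T ` (\<Inter>m. D m) = (\<Inter>m. natural_proj A T ` D m)"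
proof
  show "(\<Inter>m. natural_proj A T ` D m) \<subseteq> natural_proj A T ` (\<Inter>m. D m)"
  proof
    fix y assume "y \<in> (\<Inter>m. natural_proj A T ` D m)"
    then have "\<forall>m. \<exists>\<omega>. \<omega> \<in> D m \<and> natural_proj A T \<omega> = y" by blast
    then obtain z where z: "\<And>m. z m \<in> D m" "\<And>m. natural_proj A T (z m) = y" by metis
    have "(\<lambda>M. natural_proj A T (z M)) \<longlonglongrightarrow> y" by (simp add: z(2))
    then obtain \<omega> where \<omega>: "natural_proj A T \<omega> = y" "\<And>n. \<exists>\<^sub>\<infinity>M. stake n (z M) = stake n \<omega>"
      using natural_proj_cluster_point by blast
    have "\<omega> \<in> D m" for m
    proof -
      obtain L where L: "\<And>\<omega> \<omega>'. stake L \<omega> = stake L \<omega>' \<Longrightarrow> \<omega> \<in> D m \<Longrightarrow> \<omega>' \<in> D m" using D[of m] unfolding finitely_determined_def by blast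
      obtain M where M: "M \<ge> m" "stake L (z M) = stake L \<omega>" using \<omega>(2)[of L] unfolding INFM_nat_le by blast
      have "z M \<in> D m" using z(1)[of M] decseqD[OF dec M(1)] by blast
      then show ?thesis using L M(2) by blast
    qed
    then show "y \<in> natural_proj A T ` (\<Inter>m. D m)" using \<omega>(1) by blast
  qed
qed blast

text \<open>The target set is the continuous image of a \<open>G\<^sub>\<delta>\<close> set of sequences. Such an image is analytic;
  its Lebesgue measurability is proved as in Choquet's capacitability theorem.\<close>
lemma shrinking_target_lebesgue_measurable:
  "shrinking_target A T lam \<in> sets lebesgue"
proof (rule outer_measure_lebesgue_approximable)
  let ?\<pi> = "natural_proj A T"
  show "bounded (shrinking_target A T lam)"
    unfolding bounded_iff shrinking_target_def using norm_natural_proj_le_attractor_bound by blast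
  fix c assume c: "c < outer_measure_of lebesgue (shrinking_target A T lam)"
  define E where "E = {\<omega>. \<exists>\<^sub>\<infinity>k. sdrop k \<omega> \<in> cylinder (lam k)}"
  have RE: "shrinking_target A T lam = ?\<pi> ` E" by (simp add: shrinking_target_def E_def)
  \<comment> \<open>A hit at some time between m and m + k. The set E is the intersection over m of
    the increasing unions over k.\<close>
  define V where "V m k = {\<omega>. \<exists>j\<in>{m..m+k}. sdrop j \<omega> \<in> cylinder (lam j)}" for m k :: nat
  have Vfd: "finitely_determined (V m k)" for m k
    unfolding finitely_determined_def
  proof (intro exI[of _ "\<Sum>j\<in>{m..m+k}. j + length (lam j)"] allI impI)
    fix \<omega> \<omega>' :: "'n stream"
    assume st: "stake (\<Sum>j\<in>{m..m+k}. j + length (lam j)) \<omega> = stake (\<Sum>j\<in>{m..m+k}. j + length (lam j)) \<omega>'" and "\<omega> \<in> V m k"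
    then obtain j where j: "j \<in> {m..m+k}" "stake (length (lam j)) (sdrop j \<omega>) = lam j" by (auto simp: V_def cylinder_def)
    have "j + length (lam j) \<le> (\<Sum>j\<in>{m..m+k}. j + length (lam j))"
      using j(1) member_le_sum[of j "{m..m+k}" "\<lambda>j. j + length (lam j)"] by simp
    from stake_eq_le[OF st this] have "stake j \<omega> @ stake (length (lam j)) (sdrop j \<omega>) = stake j \<omega>' @ stake (length (lam j)) (sdrop j \<omega>')"
      by (simp add: stake_add)
    then have "stake (length (lam j)) (sdrop j \<omega>) = stake (length (lam j)) (sdrop j \<omega>')"
      by (subst (asm) append_eq_append_conv) auto
    then have "sdrop j \<omega>' \<in> cylinder (lam j)" using j(2) by (simp add: cylinder_def)
    then show "\<omega>' \<in> V m k" using j(1) unfolding V_def by blast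
  qed
  define P where "P m D \<longleftrightarrow> finitely_determined D \<and> c < outer_measure_of lebesgue (?\<pi> ` (E \<inter> D))" for m :: nat and D
  define Q where "Q m D D' \<longleftrightarrow> (\<exists>k. D' = D \<inter> V m k)" for m D D'
  \<comment> \<open>At stage m the union over all k is truncated at a k so large that the outer
    measure stays above c. This is possible because outer measure is continuous along increasing
    sequences of arbitrary sets.\<close>
  have "\<exists>D. \<forall>m. P m (D m) \<and> Q m (D m) (D (Suc m))"
  proof (rule dependent_nat_choice)
    show "\<exists>D. P 0 D" using c by (intro exI[of _ UNIV]) (simp add: P_def RE finitely_determined_def)
  next
    fix D m assume PD: "P m D"
    have "?\<pi> ` (E \<inter> D) = (\<Union>k. ?\<pi> ` (E \<inter> (D \<inter> V m k)))"
    proof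
      show "?\<pi> ` (E \<inter> D) \<subseteq> (\<Union>k. ?\<pi> ` (E \<inter> (D \<inter> V m k)))"
      proof
        fix y assume "y \<in> ?\<pi> ` (E \<inter> D)"
        then obtain \<omega> where \<omega>: "\<omega> \<in> E" "\<omega> \<in> D" "y = ?\<pi> \<omega>" by blast
        then obtain j where j: "j \<ge> m" "sdrop j \<omega> \<in> cylinder (lam j)" unfolding E_def mem_Collect_eq INFM_nat_le by blast
        then have "\<omega> \<in> V m (j - m)" unfolding V_def by (auto intro!: bexI[of _ j])
        then show "y \<in> (\<Union>k. ?\<pi> ` (E \<inter> (D \<inter> V m k)))" using \<omega> by blast
      qed
    qed blast
    moreover have "V m k \<subseteq> V m (Suc k)" for k by (force simp: V_def)
    then have "incseq (\<lambda>k. ?\<pi> ` (E \<inter> (D \<inter> V m k)))" by (intro incseq_SucI image_mono Int_mono) auto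
    then have "(SUP k. outer_measure_of lebesgue (?\<pi> ` (E \<inter> (D \<inter> V m k)))) = outer_measure_of lebesgue (\<Union>k. ?\<pi> ` (E \<inter> (D \<inter> V m k)))"
      by (intro SUP_outer_measure_of_incseq) auto
    ultimately have "c < (SUP k. outer_measure_of lebesgue (?\<pi> ` (E \<inter> (D \<inter> V m k))))" using PD by (simp add: P_def)
    then obtain k where "c < outer_measure_of lebesgue (?\<pi> ` (E \<inter> (D \<inter> V m k)))" unfolding less_SUP_iff by blast
    then show "\<exists>D'. P (Suc m) D' \<and> Q m D D'"
      using PD finitely_determined_Int[OF _ Vfd] by (intro exI[of _ "D \<inter> V m k"]) (auto simp: P_def Q_def)
  qed
  then obtain D where PD: "\<And>m. P m (D m)" and QD: "\<And>m. Q m (D m) (D (Suc m))" by blast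
  have fd: "finitely_determined (D m)" for m using PD[of m] by (simp add: P_def)
  have dec: "decseq D" by (rule decseq_SucI) (use QD in \<open>auto simp: Q_def\<close>)
  define K where "K = ?\<pi> ` (\<Inter>m. D m)"
  have K: "K = (\<Inter>m. ?\<pi> ` D m)" unfolding K_def by (rule natural_proj_INT[OF fd dec])
  have cpt: "compact (?\<pi> ` D m)" for m by (rule compact_natural_proj_image[OF fd])
  then have meas: "?\<pi> ` D m \<in> sets lebesgue" for m
    by (intro sets_completionI_sets) (simp add: compact_imp_closed borel_closed)
  \<comment> \<open>No single \<open>D m\<close> needs to lie in E; all truncations together enforce
    a hit after every time m.\<close>
  have "(\<Inter>m. D m) \<subseteq> E"
  proof
    fix \<omega> assume \<omega>: "\<omega> \<in> (\<Inter>m. D m)"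
    have "\<exists>j\<ge>m. sdrop j \<omega> \<in> cylinder (lam j)" for m
    proof -
      obtain k where "D (Suc m) = D m \<inter> V m k" using QD[of m] by (auto simp: Q_def)
      then have "\<omega> \<in> V m k" using \<omega> by blast
      then show ?thesis by (auto simp: V_def)
    qed
    then show "\<omega> \<in> E" unfolding E_def INFM_nat_le by blast
  qed
  then have KR: "K \<subseteq> shrinking_target A T lam" unfolding RE K_def by blast
  have "closed K" unfolding K by (intro closed_INT ballI compact_imp_closed cpt)
  moreover have "?\<pi> ` D 0 \<inter> K = K" unfolding K by blast
  ultimately have cK: "compact K" using compact_Int_closed[OF cpt[of 0], of K] by simp
  have "c \<le> emeasure lebesgue K"
  proof -
    have "(\<lambda>m. emeasure lebesgue (?\<pi> ` D m)) \<longlonglongrightarrow> emeasure lebesgue (\<Inter>m. ?\<pi> ` D m)"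
    proof (rule Lim_emeasure_decseq)
      show "range (\<lambda>m. ?\<pi> ` D m) \<subseteq> sets lebesgue" using meas by blast
      show "decseq (\<lambda>m. ?\<pi> ` D m)" using dec unfolding decseq_def by blast
      show "emeasure lebesgue (?\<pi> ` D m) \<noteq> \<infinity>" for m
        using fmeasurableD2[OF lmeasurable_compact[OF cpt[of m]]] by simp
    qed
    moreover have "c \<le> emeasure lebesgue (?\<pi> ` D m)" for m
    proof -
      have "c < outer_measure_of lebesgue (?\<pi> ` (E \<inter> D m))" using PD[of m] by (simp add: P_def)
      also have "\<dots> \<le> outer_measure_of lebesgue (?\<pi> ` D m)" by (intro outer_measure_of_mono image_mono) auto
      also have "\<dots> = emeasure lebesgue (?\<pi> ` D m)" by (rule outer_measure_of_eq[OF meas])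
      finally show ?thesis by simp
    qed
    ultimately show ?thesis unfolding K by (intro tendsto_lowerbound) auto
  qed
  then show "\<exists>K. compact K \<and> K \<subseteq> shrinking_target A T lam \<and> c \<le> emeasure lebesgue K" using cK KR by blast
qed

end

section \<open>The dimension formula\<close>

lemma corr_measurable:
  fixes Y :: "'b \<Rightarrow> 'w \<Rightarrow> 'a::euclidean_space"
  assumes M: "prob_space M" and Y: "(\<lambda>p. Y (fst p) (snd p)) \<in> borel_measurable (N \<Otimes>\<^sub>M M)"
  shows "(\<lambda>T. corr M (Y T) r) \<in> borel_measurable N"
proof -
  interpret M: prob_space M by fact
  interpret MM: pair_prob_space M M ..
  let ?R = "N \<Otimes>\<^sub>M (M \<Otimes>\<^sub>M M)"
  have "(\<lambda>q. (fst q, fst (snd q))) \<in> measurable ?R (N \<Otimes>\<^sub>M M)" by measurable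
  from measurable_compose[OF this Y] have 1: "(\<lambda>q. Y (fst q) (fst (snd q))) \<in> borel_measurable ?R" by simp
  have "(\<lambda>q. (fst q, snd (snd q))) \<in> measurable ?R (N \<Otimes>\<^sub>M M)" by measurable
  from measurable_compose[OF this Y] have 2: "(\<lambda>q. Y (fst q) (snd (snd q))) \<in> borel_measurable ?R" by simp
  define Q where "Q = {q \<in> space ?R. dist (Y (fst q) (fst (snd q))) (Y (fst q) (snd (snd q))) \<le> r}"
  have Q: "Q \<in> sets ?R"
    unfolding Q_def by (rule borel_measurable_le[OF borel_measurable_dist[OF 1 2] borel_measurable_const])
  have eq: "corr M (Y T) r = emeasure (M \<Otimes>\<^sub>M M) (Pair T -` Q)" if "T \<in> space N" for T
    unfolding corr_def by (rule arg_cong[where f="emeasure _"]) (use that in \<open>auto simp: Q_def space_pair_measure\<close>)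
  have "(\<lambda>T. emeasure (M \<Otimes>\<^sub>M M) (Pair T -` Q)) \<in> borel_measurable N"
    by (rule MM.measurable_emeasure_Pair[OF Q])
  then show ?thesis by (rule measurable_cong[THEN iffD2, rotated]) (rule eq)
qed

section \<open>Conclusions for almost every translation vector\<close>

context contracting_matrices
begin

lemma AE_cubeI:
  assumes "\<And>\<rho>. \<rho> \<ge> 1 \<Longrightarrow> AE T in lborel. T \<in> cube \<rho> \<longrightarrow> R T"
  shows "AE T in lborel. R (T :: (real ^ 'd) ^ 'n)"
proof -
  have "AE T in lborel. \<forall>n::nat. T \<in> cube (real n + 1) \<longrightarrow> R T"
    unfolding AE_all_countable by (intro allI assms) simp
  then show ?thesis
  proof (eventually_elim)
    fix T :: "(real ^ 'd) ^ 'n" assume *: "\<forall>n::nat. T \<in> cube (real n + 1) \<longrightarrow> R T"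
    obtain n :: nat where n: "(\<Sum>i\<in>UNIV. norm (T $ i)) \<le> real n" using real_arch_simple by blast
    have "norm (T $ i) \<le> real n + 1" for i
      using member_le_sum[of i UNIV "\<lambda>i. norm (T $ i)"] n by simp
    then have "T \<in> cube (real n + 1)" by (simp add: cube_def)
    then show "R T" using * by blast
  qed
qed

lemma AE_cube_finiteI:
  assumes g: "g \<in> borel_measurable lborel" and fin: "(\<integral>\<^sup>+T. indicator (cube \<rho>) T * g T \<partial>lborel) < top"
  shows "AE T in lborel. T \<in> cube \<rho> \<longrightarrow> g T \<noteq> (top :: ennreal)"
proof -
  have "(\<lambda>T. indicator (cube \<rho>) T * g T) \<in> borel_measurable lborel"
    by (intro borel_measurable_times_ennreal g borel_measurable_indicator) simp
  from nn_integral_PInf_AE[OF this] fin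
  have "AE T in lborel. indicator (cube \<rho>) T * g T \<noteq> \<infinity>" by simp
  then show ?thesis by eventually_elim (auto split: split_indicator_asm)
qed

lemma critical_exponentD:
  assumes "ereal s < critical_exponent A lam" "0 < s"
  shows "inverse_lower_pressure A lam s < ereal (pressure A s)"
proof (rule ccontr)
  assume "\<not> ?thesis"
  then have "critical_exponent A lam \<le> ereal s"
    unfolding critical_exponent_def using assms(2) by (intro Inf_lower) auto
  then show False using assms(1) by simp
qed

context
  fixes lam :: "nat \<Rightarrow> 'n list"
  assumes qm: "\<And>s. s > 0 \<Longrightarrow> \<exists>C>0. \<exists>K. \<forall>u v. \<exists>w. length w = K \<and> C * \<phi> s u * \<phi> s v \<le> \<phi> s (u @ w @ v)"
begin

text \<open>Giving up a little, from s to s', turns the dyadic energy series into a geometric one of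
  ratio 2 powr (s' - s) < 1. Its integral over a cube is finite, so it is finite for almost every
  T.\<close>

lemma AE_hausdorff_dim_ge:
  assumes s: "0 < s'" "s' < s" "s \<le> real CARD('d)" "ereal s < critical_exponent A lam"
  shows "AE T in lborel. ereal s' \<le> hausdorff_dim (shrinking_target A T lam)"
proof -
  have s0: "0 < s" using s by simp
  obtain M :: "(nat \<Rightarrow> 'n list) measure" and X I where M: "prob_space M"
    and X: "\<And>\<omega>. \<omega> \<in> space M \<Longrightarrow> \<exists>\<^sub>\<infinity>k. sdrop k (X \<omega>) \<in> cylinder (lam k)"
    and meas: "(\<lambda>p. natural_proj A (fst p) (X (snd p))) \<in> borel_measurable (lborel \<Otimes>\<^sub>M M)"
    and I: "0 \<le> I" and cor: "\<And>\<rho> r. \<rho> \<ge> 1 \<Longrightarrow> r > 0 \<Longrightarrow> (\<integral>\<^sup>+T. indicator (cube \<rho>) T * corr M (\<lambda>\<omega>. natural_proj A T (X \<omega>)) r \<partial>lborel) \<le> ennreal (trans_const \<rho> * I * r powr s)"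
    using random_points_exist[OF s0 s(3) qm[OF s0] critical_exponentD[OF s(4) s0]] unfolding corr_def by blast
  let ?Y = "\<lambda>T \<omega>. natural_proj A T (X \<omega>)"
  define g where "g T = (\<Sum>j. ennreal (2 powr (real (Suc j) * s')) * corr M (?Y T) (1 / 2 ^ j))" for T
  have cm: "(\<lambda>T. corr M (?Y T) r) \<in> borel_measurable lborel" for r by (rule corr_measurable[OF M meas])
  have YM: "?Y T \<in> borel_measurable M" for T
    using measurable_compose[OF measurable_Pair1' meas, of T] by simp
  show ?thesis
  proof (rule AE_cubeI)
    fix \<rho> :: real assume \<rho>: "\<rho> \<ge> 1"
    have gm: "g \<in> borel_measurable lborel"
      unfolding g_def by (intro borel_measurable_suminf_order borel_measurable_times_ennreal borel_measurable_const cm)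
    have "(\<integral>\<^sup>+T. indicator (cube \<rho>) T * g T \<partial>lborel)
        = (\<integral>\<^sup>+T. (\<Sum>j. ennreal (2 powr (real (Suc j) * s')) * (indicator (cube \<rho>) T * corr M (?Y T) (1 / 2 ^ j))) \<partial>lborel)"
      unfolding g_def by (simp only: ennreal_suminf_cmult[symmetric] mult.left_commute)
    also have "\<dots> = (\<Sum>j. \<integral>\<^sup>+T. ennreal (2 powr (real (Suc j) * s')) * (indicator (cube \<rho>) T * corr M (?Y T) (1 / 2 ^ j)) \<partial>lborel)"
      by (intro nn_integral_suminf borel_measurable_times_ennreal borel_measurable_const cm borel_measurable_indicator) simp
    also have "\<dots> = (\<Sum>j. ennreal (2 powr (real (Suc j) * s')) * (\<integral>\<^sup>+T. indicator (cube \<rho>) T * corr M (?Y T) (1 / 2 ^ j) \<partial>lborel))"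
      by (intro suminf_cong nn_integral_cmult borel_measurable_times_ennreal cm borel_measurable_indicator) simp
    also have "\<dots> \<le> (\<Sum>j. ennreal (2 powr (real (Suc j) * s')) * ennreal (trans_const \<rho> * I * (1 / 2 ^ j) powr s))"
      using \<rho> by (intro suminf_le mult_left_mono cor) auto
    also have "\<dots> = (\<Sum>j. ennreal (2 powr s' * trans_const \<rho> * I * (2 powr (s' - s)) ^ j))"
    proof (rule suminf_cong)
      fix j
      have eq: "2 powr (real (Suc j) * s') * (trans_const \<rho> * I * (1 / 2 ^ j) powr s) = 2 powr s' * trans_const \<rho> * I * (2 powr (s' - s)) ^ j"
        by (simp add: powr_realpow[symmetric] powr_powr powr_divide powr_diff powr_add[symmetric] powr_minus_divide[symmetric] algebra_simps flip: powr_add)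
      show "ennreal (2 powr (real (Suc j) * s')) * ennreal (trans_const \<rho> * I * (1 / 2 ^ j) powr s) = ennreal (2 powr s' * trans_const \<rho> * I * (2 powr (s' - s)) ^ j)"
        unfolding eq[symmetric] by (rule ennreal_mult'[OF powr_ge_zero, symmetric])
    qed
    also have "\<dots> < top"
    proof -
      have x: "2 powr (s' - s) < 1" using s by (simp add: powr_less_one)
      have "summable (\<lambda>j. 2 powr s' * trans_const \<rho> * I * (2 powr (s' - s)) ^ j)"
        using x by (intro summable_mult summable_geometric) auto
      then have "(\<Sum>j. ennreal (2 powr s' * trans_const \<rho> * I * (2 powr (s' - s)) ^ j)) = ennreal (\<Sum>j. 2 powr s' * trans_const \<rho> * I * (2 powr (s' - s)) ^ j)"
        using I trans_const_nonneg[OF \<rho>] by (intro suminf_ennreal2) auto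
      then show ?thesis by simp
    qed
    finally have "AE T in lborel. T \<in> cube \<rho> \<longrightarrow> g T \<noteq> top" by (rule AE_cube_finiteI[OF gm])
    then show "AE T in lborel. T \<in> cube \<rho> \<longrightarrow> ereal s' \<le> hausdorff_dim (shrinking_target A T lam)"
    proof eventually_elim
      case (elim T)
      have "ereal s' \<le> hausdorff_dim (shrinking_target A T lam)" if "g T \<noteq> top"
        using that unfolding g_def by (intro hausdorff_dim_ge_energy[OF M YM[of T] s(1)]) (auto simp: shrinking_target_def X)
      then show ?case using elim by blast
    qed
  qed
qed

lemma AE_hausdorff_dim_eq:
  "AE T in lborel. hausdorff_dim (shrinking_target A T lam) = min (ereal (real CARD('d))) (critical_exponent A lam)"
proof -
  let ?m = "min (ereal (real CARD('d))) (critical_exponent A lam)"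
  \<comment> \<open>Rational exponents keep the exceptional null sets countable in number.\<close>
  have "AE T in lborel. 0 < real_of_rat q \<longrightarrow> ereal (real_of_rat q) < ?m \<longrightarrow> ereal (real_of_rat q) \<le> hausdorff_dim (shrinking_target A T lam)" for q
  proof (cases "0 < real_of_rat q \<and> ereal (real_of_rat q) < ?m")
    case True
    then obtain s where s: "ereal (real_of_rat q) < ereal s" "ereal s < ?m" using ereal_dense2 by blast
    have "AE T in lborel. ereal (real_of_rat q) \<le> hausdorff_dim (shrinking_target A T lam)"
      using True s by (intro AE_hausdorff_dim_ge[of _ s]) auto
    then show ?thesis by eventually_elim simp
  qed auto
  then have "AE T in lborel. \<forall>q. 0 < real_of_rat q \<longrightarrow> ereal (real_of_rat q) < ?m \<longrightarrow> ereal (real_of_rat q) \<le> hausdorff_dim (shrinking_target A T lam)"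
    unfolding AE_all_countable by blast
  then show ?thesis
  proof eventually_elim
    case (elim T)
    have "?m \<le> hausdorff_dim (shrinking_target A T lam)"
    proof (rule dense_le)
      fix x assume "x < ?m"
      then obtain q where q: "x < ereal (real_of_rat q)" "ereal (real_of_rat q) < ?m" using ereal_dense3 by blast
      show "x \<le> hausdorff_dim (shrinking_target A T lam)"
      proof (cases "0 < real_of_rat q")
        case True
        then show ?thesis using elim q by (meson less_imp_le order_trans)
      next
        case False
        then have "ereal (real_of_rat q) \<le> 0" by simp
        then show ?thesis using q(1) hausdorff_dim_nonneg[of "shrinking_target A T lam"] by (meson less_imp_le order_trans)
      qed
    qed
    then show ?case using hausdorff_dim_shrinking_target_le[of T lam] by (simp add: antisym)
  qed
qed

text \<open>At s = d no exponent is given up: the rescaled correlation integrals have bounded means,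
  and Fatou's lemma makes their lower limit finite for almost every T.\<close>

lemma AE_shrinking_target_positive:
  assumes d: "ereal (real CARD('d)) < critical_exponent A lam"
  shows "AE T in lborel. emeasure lebesgue (shrinking_target A T lam) > 0"
proof -
  have s0: "0 < real CARD('d)" by simp
  obtain M :: "(nat \<Rightarrow> 'n list) measure" and X I where M: "prob_space M"
    and X: "\<And>\<omega>. \<omega> \<in> space M \<Longrightarrow> \<exists>\<^sub>\<infinity>k. sdrop k (X \<omega>) \<in> cylinder (lam k)"
    and meas: "(\<lambda>p. natural_proj A (fst p) (X (snd p))) \<in> borel_measurable (lborel \<Otimes>\<^sub>M M)"
    and I: "0 \<le> I" and cor: "\<And>\<rho> r. \<rho> \<ge> 1 \<Longrightarrow> r > 0 \<Longrightarrow> (\<integral>\<^sup>+T. indicator (cube \<rho>) T * corr M (\<lambda>\<omega>. natural_proj A T (X \<omega>)) r \<partial>lborel) \<le> ennreal (trans_const \<rho> * I * r powr real CARD('d))"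
    using random_points_exist[OF s0 order_refl qm[OF s0] critical_exponentD[OF d s0]] unfolding corr_def by blast
  let ?Y = "\<lambda>T \<omega>. natural_proj A T (X \<omega>)"
  have cm: "(\<lambda>T. corr M (?Y T) r) \<in> borel_measurable lborel" for r by (rule corr_measurable[OF M meas])
  have YM: "?Y T \<in> borel_measurable M" for T
    using measurable_compose[OF measurable_Pair1' meas, of T] by simp
  define u where "u n T = ennreal (2 ^ (n * CARD('d))) * corr M (?Y T) (1 / 2 ^ n)" for n T
  have um: "u n \<in> borel_measurable lborel" for n
    unfolding u_def by (intro borel_measurable_times_ennreal borel_measurable_const cm)
  define g where "g T = liminf (\<lambda>n. u n T)" for T
  show ?thesis
  proof (rule AE_cubeI)
    fix \<rho> :: real assume \<rho>: "\<rho> \<ge> 1"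
    have gm: "g \<in> borel_measurable lborel" unfolding g_def by (intro borel_measurable_liminf um)
    have "(\<integral>\<^sup>+T. indicator (cube \<rho>) T * g T \<partial>lborel) \<le> (\<integral>\<^sup>+T. liminf (\<lambda>n. indicator (cube \<rho>) T * u n T) \<partial>lborel)"
      by (intro nn_integral_mono) (auto simp: g_def Liminf_const split: split_indicator)
    also have "\<dots> \<le> liminf (\<lambda>n. \<integral>\<^sup>+T. indicator (cube \<rho>) T * u n T \<partial>lborel)"
      by (intro nn_integral_liminf borel_measurable_times_ennreal borel_measurable_indicator um) simp
    also have "\<dots> \<le> liminf (\<lambda>n::nat. ennreal (trans_const \<rho> * I))"
    proof (rule Liminf_mono, rule always_eventually, rule allI)
      fix n
      have "(\<integral>\<^sup>+T. indicator (cube \<rho>) T * u n T \<partial>lborel) = (\<integral>\<^sup>+T. ennreal (2 ^ (n * CARD('d))) * (indicator (cube \<rho>) T * corr M (?Y T) (1 / 2 ^ n)) \<partial>lborel)"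
        unfolding u_def by (simp only: mult.left_commute)
      also have "\<dots> = ennreal (2 ^ (n * CARD('d))) * (\<integral>\<^sup>+T. indicator (cube \<rho>) T * corr M (?Y T) (1 / 2 ^ n) \<partial>lborel)"
        by (intro nn_integral_cmult borel_measurable_times_ennreal cm borel_measurable_indicator) simp
      also have "\<dots> \<le> ennreal (2 ^ (n * CARD('d))) * ennreal (trans_const \<rho> * I * (1 / 2 ^ n) powr real CARD('d))"
        using \<rho> by (intro mult_left_mono cor) auto
      also have "\<dots> = ennreal (2 ^ (n * CARD('d)) * (trans_const \<rho> * I * (1 / 2 ^ n) powr real CARD('d)))"
        by (rule ennreal_mult'[symmetric]) simp
      also have "2 ^ (n * CARD('d)) * (trans_const \<rho> * I * (1 / 2 ^ n) powr real CARD('d)) = trans_const \<rho> * I"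
        by (simp add: powr_realpow power_divide power_mult)
      finally show "(\<integral>\<^sup>+T. indicator (cube \<rho>) T * u n T \<partial>lborel) \<le> ennreal (trans_const \<rho> * I)" .
    qed
    also have "\<dots> < top" by (simp add: Liminf_const)
    finally have "AE T in lborel. T \<in> cube \<rho> \<longrightarrow> g T \<noteq> top" by (rule AE_cube_finiteI[OF gm])
    then show "AE T in lborel. T \<in> cube \<rho> \<longrightarrow> emeasure lebesgue (shrinking_target A T lam) > 0"
    proof eventually_elim
      case (elim T)
      have "emeasure lebesgue (shrinking_target A T lam) > 0" if "g T \<noteq> top"
      proof -
        have "shrinking_target A T lam \<notin> null_sets lebesgue"
        proof (rule not_null_of_correlation[OF M YM[of T]])
          show "natural_proj A T (X \<omega>) \<in> shrinking_target A T lam" if "\<omega> \<in> space M" for \<omega>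
            using X[OF that] by (auto simp: shrinking_target_def)
          show "liminf (\<lambda>n. ennreal (2 ^ (n * DIM(real^'d))) * corr M (?Y T) (1 / 2 ^ n)) < top"
            using that by (simp add: g_def u_def less_top)
        qed
        \<comment> \<open>Measurability is essential here, since a nonmeasurable set has
          \<open>emeasure\<close> 0 without being a null set.\<close>
        then have "emeasure lebesgue (shrinking_target A T lam) \<noteq> 0"
          using shrinking_target_lebesgue_measurable by blast
        then show ?thesis unfolding zero_less_iff_neq_zero .
      qed
      then show ?case using elim by blast
    qed
  qed
qed

end
end

theorem theorem2p2:
  fixes A :: "'n::finite \<Rightarrow> real ^ 'd ^ 'd"
    and lam :: "nat \<Rightarrow> 'n list"
  assumes "CARD('n) \<ge> 2"
    and "\<And>i. invertible (A i)"
    and "\<And>i. onorm ((*v) (A i)) < 1 / 2"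
    and "\<And>s::real. s > 0 \<Longrightarrow>
           \<exists>C>0. \<exists>K::nat. \<forall>u v. \<exists>w. length w = K \<and>
             svf s (word_matrix A (u @ w @ v)) \<ge> C * svf s (word_matrix A u) * svf s (word_matrix A v)"
  shows "(AE t in lebesgue. hausdorff_dim (shrinking_target A t lam) =
             min (ereal (real CARD('d))) (critical_exponent A lam)) \<and>
         (critical_exponent A lam > ereal (real CARD('d)) \<longrightarrow>
           (AE t in lebesgue. emeasure lebesgue (shrinking_target A t lam) > 0))"
proof -
  \<comment> \<open>The maximum with 1/4 makes \<eta> positive at once and keeps it below
    1/2.\<close>
  define \<eta> where "\<eta> = max (1/4) (Max (range (\<lambda>i. onorm ((*v) (A i)))))"
  interpret contracting_matrices A \<eta>
  proof
    show "onorm ((*v) (A i)) \<le> \<eta>" for i unfolding \<eta>_def by (intro max.coboundedI2 Max_ge) auto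
    show "0 < \<eta>" unfolding \<eta>_def by simp
    have "Max (range (\<lambda>i. onorm ((*v) (A i)))) < 1 / 2" using assms(3) by (subst Max_less_iff) auto
    then show "\<eta> < 1 / 2" unfolding \<eta>_def by simp
  qed (rule assms(2))
  note qm = assms(4)
  show ?thesis
    using AE_completion[OF AE_hausdorff_dim_eq[OF qm, of lam]] AE_completion[OF AE_shrinking_target_positive[OF qm, of lam]] by blast
qed

end
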